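(* Let $A,B\subset\mathbb{Z}^2$ be finite subsets such that $A$ and $B$ cannot be shifted to the same proper sublattice of $\mathbb{Z}^2$ and such that neither $A$ nor $B$ lies on a segment. Then for a generic curve $\gamma=\mathcal{Z}(f)$, $f\in\mathbb{C}^B$, and for almost all points $p\in\gamma$, the following holds: for every integer $i$ with $0\le i\le |A|-|\mathrm{conv}(A)\ominus B|-1$ there exists a curve $\{g_i=0\}$ with $g_i\in\mathbb{C}^A$ that intersects $\gamma$ at $p$ with multiplicity exactly $i$.
   Context: For a finite $A\subset\mathbb{Z}^2$, $\mathbb{C}^A$ is the vector space of Laurent polynomials $\sum_{a\in A}c_a z^a$, where $z^a=z_1^{a_1}z_2^{a_2}$ and $c_a\in\mathbb{C}$. $\mathcal{Z}(f)$ denotes the zero set of $f$ in the complex torus $(\mathbb{C}^* )^2$; a curve is supported at $B$ if it is of the form $\mathcal{Z}(f)$ with $f\in\mathbb{C}^B$. $|A|$ is the number of elements of $A$, and $\mathrm{conv}(A)$ is the convex hull of $A$. $X\ominus Y=\{v\in\mathbb{Z}^2 : v+Y\subset X\}$ is the set of all integral vectors shifting $Y$ to a subset of $X$. "$A$ and $B$ cannot be shifted to the same proper sublattice" means there are no $a,b\in\mathbb{Z}^2$ and proper subgroup $L\subsetneq\mathbb{Z}^2$ with $A+a\subset L$ and $B+b\subset L$. "Generic curve" means: for all $f$ in some nonempty Zariski open subset of $\mathbb{C}^B$. "Almost all points of $\gamma$" means all but finitely many points. The intersection multiplicity of $\{g=0\}$ with $\gamma$ at a smooth point $p$ of $\gamma$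 is the (finite) order of vanishing at $p$ of the restriction of $g$ to $\gamma$; multiplicity $0$ means $g(p)\neq 0$. *)

theory Defs
  imports
    "HOL-Complex_Analysis.Complex_Analysis"
    "HOL-Library.Poly_Mapping"
    "HOL-Algebra.Elementary_Groups"
begin

definition to_plane :: "int \<times> int \<Rightarrow> real \<times> real" where
  "to_plane a = (real_of_int (fst a), real_of_int (snd a))"

abbreviation conv :: "(int \<times> int) set \<Rightarrow> (real \<times> real) set" where
  "conv A \<equiv> convex hull (to_plane ` A)"

definition lies_on_segment :: "(int \<times> int) set \<Rightarrow> bool" where
  "lies_on_segment A \<longleftrightarrow> (\<exists>x y :: real \<times> real. to_plane ` A \<subseteq> closed_segment x y)"

definition shift_diff :: "(real \<times> real) set \<Rightarrow> (int \<times> int) set \<Rightarrow> (int \<times> int) set"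
    (infixl \<open>\<ominus>\<^sub>Z\<close> 65) where
  "X \<ominus>\<^sub>Z Y = {v. \<forall>y\<in>Y. to_plane (v + y) \<in> X}"

(* A sublattice is just a subgroup of Z^2; it may have rank less than 2. *)
definition shift_to_same_proper_sublattice ::
    "(int \<times> int) set \<Rightarrow> (int \<times> int) set \<Rightarrow> bool" where
  "shift_to_same_proper_sublattice A B \<longleftrightarrow>
     (\<exists>a b L. subgroup L (integer_group \<times>\<times> integer_group) \<and> L \<noteq> UNIV \<and>
        (\<lambda>x. x + a) ` A \<subseteq> L \<and> (\<lambda>x. x + b) ` B \<subseteq> L)"

(* Finitely supported functions on Z^2 with their convolution product:
   Poly_Mapping.lookup f a is the coefficient of z^a. *)
type_synonym laurent = "(int \<times> int) \<Rightarrow>\<^sub>0 complex"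

definition leval :: "laurent \<Rightarrow> complex \<times> complex \<Rightarrow> complex" where
  "leval f z = (\<Sum>a\<in>Poly_Mapping.keys f. Poly_Mapping.lookup f a * fst z powi fst a * snd z powi snd a)"

definition supported_at :: "(int \<times> int) set \<Rightarrow> laurent set" where
  "supported_at A = {f. Poly_Mapping.keys f \<subseteq> A}"

definition torus :: "(complex \<times> complex) set" where
  "torus = {z. fst z \<noteq> 0 \<and> snd z \<noteq> 0}"

definition zero_locus :: "laurent \<Rightarrow> (complex \<times> complex) set" where
  "zero_locus f = {z \<in> torus. leval f z = 0}"

(* Polynomial functions in the coefficients indexed by B. *)
inductive_set coeff_polys :: "(int \<times> int) set \<Rightarrow> (laurent \<Rightarrow> complex) set"
  for B :: "(int \<times> int) set" where
  const: "(\<lambda>_. c) \<in> coeff_polys B"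
| coord: "b \<in> B \<Longrightarrow> (\<lambda>f. Poly_Mapping.lookup f b) \<in> coeff_polys B"
| add: "P \<in> coeff_polys B \<Longrightarrow> Q \<in> coeff_polys B \<Longrightarrow> (\<lambda>f. P f + Q f) \<in> coeff_polys B"
| mult: "P \<in> coeff_polys B \<Longrightarrow> Q \<in> coeff_polys B \<Longrightarrow> (\<lambda>f. P f * Q f) \<in> coeff_polys B"

definition zariski_open :: "(int \<times> int) set \<Rightarrow> laurent set \<Rightarrow> bool" where
  "zariski_open B U \<longleftrightarrow>
     (\<exists>S \<subseteq> coeff_polys B. U = supported_at B - {f \<in> supported_at B. \<forall>P\<in>S. P f = 0})"

definition smooth_point :: "laurent \<Rightarrow> complex \<times> complex \<Rightarrow> bool" where
  "smooth_point f p \<longleftrightarrow> p \<in> zero_locus f \<and>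
     (deriv (\<lambda>w. leval f (w, snd p)) (fst p), deriv (\<lambda>w. leval f (fst p, w)) (snd p)) \<noteq> (0, 0)"

(* At a smooth point p, any such immersed holomorphic arc through p is a local
   parametrization of the whole curve near p (implicit function theorem). *)
definition local_parametrization ::
    "laurent \<Rightarrow> complex \<times> complex \<Rightarrow> (complex \<Rightarrow> complex) \<Rightarrow> (complex \<Rightarrow> complex) \<Rightarrow> bool" where
  "local_parametrization f p x y \<longleftrightarrow>
     x analytic_on {0} \<and> y analytic_on {0} \<and> (x 0, y 0) = p \<and>
     (deriv x 0, deriv y 0) \<noteq> (0, 0) \<and>
     (\<forall>\<^sub>F t in nhds 0. (x t, y t) \<in> zero_locus f)"

(* The order of vanishing at a smooth point p of the restriction of g to the curve f = 0
   is that of g pulled back along a local parametrization, and does not depend on its choice.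
   The library's zorder is meaningful only for functions that do not vanish identically near
   the point; this clause also says that the order is finite. *)
definition meets_with_multiplicity ::
    "laurent \<Rightarrow> laurent \<Rightarrow> complex \<times> complex \<Rightarrow> int \<Rightarrow> bool" where
  "meets_with_multiplicity g f p i \<longleftrightarrow> smooth_point f p \<and>
     (\<exists>x y. local_parametrization f p x y \<and>
        (\<exists>\<^sub>F t in at 0. leval g (x t, y t) \<noteq> 0) \<and>
        zorder (\<lambda>t. leval g (x t, y t)) 0 = i)"

end

theory Submission
  imports Defs "HOL-Computational_Algebra.Computational_Algebra" "HOL-Computational_Algebra.Field_as_Ring"
begin

text \<open>
Restricted to a smooth branch of the curve, the monomials with exponents in \<open>A\<close> span a space
of holomorphic functions, and in a space of dimension \<open>n\<close> of holomorphic functions of one variable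
the orders of vanishing at all but a discrete set of points are exactly \<open>0, \<dots>, n - 1\<close>. So the
statement amounts to a lower bound for that dimension. If \<open>f\<close> is irreducible with support \<open>B\<close>, then
a Laurent polynomial in \<open>\<complex>\<^sup>A\<close> that vanishes on a branch of \<open>f\<close> is a product \<open>f h\<close>, and \<open>h\<close> is
supported at \<open>conv A \<ominus> B\<close>; this gives the bound \<open>|A| - |conv A \<ominus> B|\<close>
(\<open>independent_exponents\<close>).

The passage to generic curves starts from one good pair of a curve and a point on it. All orders are
attained at \<open>p\<close> if a function \<open>\<Phi>(f, p)\<close> does not vanish, essentially a minor of a matrix, which is
polynomial in the coefficients of \<open>f\<close> and Laurent in \<open>p\<close>: along the curve a tangent vector field \<open>\<delta>\<close> with polynomial
coefficients takes the place of the derivative, and the minor is taken in the matrix of the values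
\<open>\<delta>\<^sup>j z\<^sup>a\<close>. The equation \<open>f(p) = 0\<close> can be solved for any one coefficient of \<open>f\<close>, so the
pairs \<open>(f, p)\<close> on which it holds form an irreducible variety; if \<open>\<Phi>\<close> is nonzero at one pair, it
is nonzero at a generic pair, and then \<open>f = \<Phi> = 0\<close> has finitely many solutions for generic \<open>f\<close>.
Resultants with respect to both coordinates make this explicit
(\<open>generic_finite_exceptional_locus\<close>): moving a single coefficient of the good curve makes them
nonzero.

The good pair (\<open>good_point_exists\<close>) needs one irreducible \<open>f\<close> with full support, passing through a
smooth point. A trinomial with affinely independent exponents is irreducible, since a finite cover of
the torus turns it into a Fermat curve. Other exponents of \<open>B\<close> are then added with small
coefficients: irreducibility survives, because in the limit of a sequence of factorizations one factor
degenerates to a monomial, while the width of the other factor in a direction in which the Newton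
polygon does not grow is already the whole width (\<open>irreducible_limit\<close>). Newton polygons enter through
linear functionals that are injective on the lattice: for these, leading terms are unique and
multiplicative.
\<close>

section \<open>Laurent polynomials and their values on the torus\<close>

abbreviation lsupp :: "laurent \<Rightarrow> (int \<times> int) set" where "lsupp \<equiv> Poly_Mapping.keys"
abbreviation lcoeff :: "laurent \<Rightarrow> int \<times> int \<Rightarrow> complex" where "lcoeff \<equiv> Poly_Mapping.lookup"
abbreviation lmono :: "int \<times> int \<Rightarrow> complex \<Rightarrow> laurent" where "lmono \<equiv> Poly_Mapping.single"

definition zpow :: "complex \<times> complex \<Rightarrow> int \<times> int \<Rightarrow> complex" where
  "zpow z a = fst z powi fst a * snd z powi snd a"

lemma zpow_add: "z \<in> torus \<Longrightarrow> zpow z (a + b) = zpow z a * zpow z b"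
  by (simp add: zpow_def torus_def power_int_add)

lemma zpow_0 [simp]: "zpow z 0 = 1"
  by (simp add: zpow_def)

lemma zpow_nonzero [simp]: "z \<in> torus \<Longrightarrow> zpow z a \<noteq> 0"
  by (simp add: zpow_def torus_def)

lemma leval_sum_superset:
  assumes "finite T" "lsupp f \<subseteq> T"
  shows "leval f z = (\<Sum>a\<in>T. lcoeff f a * zpow z a)"
  unfolding leval_def zpow_def mult.assoc
  by (rule sum.mono_neutral_left) (use assms in \<open>auto simp: in_keys_iff\<close>)

lemma leval_zero [simp]: "leval 0 z = 0"
  by (simp add: leval_def)

lemma leval_add [simp]: "leval (f + g) z = leval f z + leval g z"
proof -
  let ?T = "lsupp f \<union> lsupp g"
  have "leval (f + g) z = (\<Sum>a\<in>?T. lcoeff (f + g) a * zpow z a)"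
    by (rule leval_sum_superset) (auto simp: keys_add in_keys_iff lookup_add)
  also have "\<dots> = (\<Sum>a\<in>?T. lcoeff f a * zpow z a) + (\<Sum>a\<in>?T. lcoeff g a * zpow z a)"
    by (simp add: lookup_add algebra_simps sum.distrib)
  finally show ?thesis
    by (simp add: leval_sum_superset[symmetric])
qed

lemma leval_lmono [simp]: "leval (lmono a c) z = c * zpow z a"
  by (cases "c = 0") (auto simp: leval_def zpow_def)

lemma leval_sum: "leval (\<Sum>i\<in>I. f i) z = (\<Sum>i\<in>I. leval (f i) z)"
  by (induction I rule: infinite_finite_induct) auto

lemma laurent_sum_lmono:
  assumes "finite T" "lsupp f \<subseteq> T"
  shows "f = (\<Sum>a\<in>T. lmono a (lcoeff f a))"
proof (rule poly_mapping_eqI)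
  fix k
  have "lcoeff (\<Sum>a\<in>T. lmono a (lcoeff f a)) k = (\<Sum>a\<in>T. if a = k then lcoeff f a else 0)"
    by (auto simp: lookup_sum lookup_single when_def intro!: sum.cong)
  also have "\<dots> = lcoeff f k"
    using assms by (cases "k \<in> T") (auto simp: in_keys_iff dest: subsetD)
  finally show "lcoeff f k = lcoeff (\<Sum>a\<in>T. lmono a (lcoeff f a)) k" by simp
qed

text \<open>The sum runs over a fixed finite set instead of the support of \<open>f\<close>, so that coefficients of
products of varying factors can be compared and passed to the limit.\<close>

lemma lcoeff_mult:
  assumes "finite T" "lsupp f \<subseteq> T"
  shows "lcoeff (f * g) k = (\<Sum>a\<in>T. lcoeff f a * lcoeff g (k - a))"
proof -
  have "(\<Sum>q. lcoeff g q when k = a + q) = lcoeff g (k - a)" for a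
  proof -
    have "(\<lambda>q. lcoeff g q when k = a + q) = (\<lambda>q. lcoeff g q when q = k - a)"
      by (auto simp: fun_eq_iff when_def algebra_simps)
    then show ?thesis by (simp only: Sum_any_when_equal)
  qed
  then have "lcoeff (f * g) k = Sum_any (\<lambda>a. lcoeff f a * lcoeff g (k - a))"
    by (simp add: lookup_mult)
  also have "\<dots> = (\<Sum>a\<in>T. lcoeff f a * lcoeff g (k - a))"
    by (rule Sum_any.expand_superset) (use assms in \<open>auto simp: in_keys_iff\<close>)
  finally show ?thesis .
qed

lemma lcoeff_lmono_mult [simp]: "lcoeff (lmono a c * g) k = c * lcoeff g (k - a)"
  by (subst lcoeff_mult[of "{a}"]) auto

lemma leval_lmono_mult:
  assumes z: "z \<in> torus"
  shows "leval (lmono a c * g) z = c * zpow z a * leval g z"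
proof -
  have "leval (lmono a c * g) z = (\<Sum>k\<in>(+) a ` lsupp g. lcoeff (lmono a c * g) k * zpow z k)"
  proof (rule leval_sum_superset)
    show "lsupp (lmono a c * g) \<subseteq> (+) a ` lsupp g"
    proof
      fix k assume "k \<in> lsupp (lmono a c * g)"
      then have "k - a \<in> lsupp g" by (auto simp: in_keys_iff)
      then show "k \<in> (+) a ` lsupp g" by (metis add.commute diff_add_cancel image_eqI)
    qed
  qed auto
  also have "\<dots> = (\<Sum>b\<in>lsupp g. c * lcoeff g b * zpow z (a + b))"
    by (subst sum.reindex) auto
  also have "\<dots> = c * zpow z a * leval g z"
    by (subst leval_sum_superset[of "lsupp g"]) (auto simp: zpow_add z sum_distrib_left algebra_simps)
  finally show ?thesis .
qed

lemma leval_mult: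
  assumes z: "z \<in> torus"
  shows "leval (f * g) z = leval f z * leval g z"
proof -
  have "f * g = (\<Sum>a\<in>lsupp f. lmono a (lcoeff f a)) * g"
    using laurent_sum_lmono[of "lsupp f" f] by simp
  also have "\<dots> = (\<Sum>a\<in>lsupp f. lmono a (lcoeff f a) * g)"
    by (simp add: sum_distrib_right)
  finally have "leval (f * g) z = (\<Sum>a\<in>lsupp f. lcoeff f a * zpow z a * leval g z)"
    by (simp add: leval_sum leval_lmono_mult z)
  also have "\<dots> = leval f z * leval g z"
    by (subst leval_sum_superset[of "lsupp f"]) (auto simp: sum_distrib_right)
  finally show ?thesis .
qed

text \<open>After multiplication by a power of \<open>w\<close> the exponents are nonnegative, and a nonzero polynomial has finitely
many roots. Any infinite set of zeros will do, so that the converse bounds the zeros of a Laurent polynomial.\<close>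

lemma power_int_independent:
  fixes c :: "int \<Rightarrow> complex"
  assumes fin: "finite S" and inf: "infinite W" "0 \<notin> W" 
    and zero: "\<And>w. w \<in> W \<Longrightarrow> (\<Sum>k\<in>S. c k * w powi k) = 0" and k: "k \<in> S"
  shows "c k = 0"
proof -
  define m where "m = Min S"
  have m: "m \<le> j" if "j \<in> S" for j using fin that by (simp add: m_def)
  define p where "p = (\<Sum>j\<in>S. monom (c j) (nat (j - m)))"
  have "poly p w = 0" if w: "w \<in> W" for w
  proof -
    have w0: "w \<noteq> 0" using w inf by auto
    have "poly p w = (\<Sum>j\<in>S. w powi (- m) * (c j * w powi j))"
      unfolding p_def poly_sum
    proof (rule sum.cong)
      fix j assume j: "j \<in> S"
      have "w ^ nat (j - m) = w powi (j - m)" using m[OF j] by (simp add: power_int_def)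
      also have "\<dots> = w powi (-m) * w powi j" using w0 by (simp add: power_int_diff power_int_minus field_simps)
      finally show "poly (monom (c j) (nat (j - m))) w = w powi (- m) * (c j * w powi j)"
        by (simp add: poly_monom)
    qed simp
    also have "\<dots> = 0" using zero[OF w] by (simp add: sum_distrib_left[symmetric])
    finally show ?thesis .
  qed
  then have "W \<subseteq> {w. poly p w = 0}" by auto
  then have "p = 0" using poly_roots_finite[of p] inf(1) finite_subset by blast
  then have "0 = coeff p (nat (k - m))" by simp
  also have "\<dots> = (\<Sum>j\<in>S. if j = k then c j else 0)"
    unfolding p_def coeff_sum coeff_monom
    by (rule sum.cong) (use m k in \<open>auto simp: nat_eq_iff\<close>)
  also have "\<dots> = c k" using k fin by simp
  finally show ?thesis by simp
qed

lemma infinite_nonzero_complex: "infinite (- {0 :: complex})"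
  by (metis Compl_eq_Diff_UNIV finite.emptyI finite_insert infinite_UNIV_char_0 Diff_infinite_finite)

lemma leval_eq_0_imp_zero:
  assumes "\<And>z. z \<in> torus \<Longrightarrow> leval f z = 0"
  shows "f = 0"
proof (rule ccontr)
  assume "f \<noteq> 0"
  then obtain k where k: "k \<in> lsupp f" by (metis ex_in_conv keys_eq_empty)
  \<comment> \<open>Substituting \<open>(w^N, w)\<close> with \<open>N\<close> large keeps the exponents apart.\<close>
  define K where "K = Max ((\<lambda>a. \<bar>snd a\<bar>) ` lsupp f)"
  have K: "\<bar>snd a\<bar> \<le> K" if "a \<in> lsupp f" for a using that by (simp add: K_def)
  define N where "N = 2 * K + 1"
  define e where "e = (\<lambda>a :: int \<times> int. N * fst a + snd a)"
  have inj: "inj_on e (lsupp f)"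
  proof (rule inj_onI)
    fix a b assume a: "a \<in> lsupp f" and b: "b \<in> lsupp f" and "e a = e b"
    then have eq: "N * (fst a - fst b) = snd b - snd a" by (simp add: e_def algebra_simps)
    have lt: "\<bar>snd b - snd a\<bar> < N" using K[OF a] K[OF b] by (simp add: N_def)
    have "fst a - fst b = 0"
    proof (rule ccontr)
      assume ne: "fst a - fst b \<noteq> 0"
      have "N * 1 \<le> \<bar>N\<bar> * \<bar>fst a - fst b\<bar>" by (rule mult_mono) (use ne lt in auto)
      then show False using eq lt by (simp add: abs_mult[symmetric])
    qed
    then show "a = b" using eq by (simp add: prod_eq_iff)
  qed
  have "lcoeff f (inv_into (lsupp f) e (e k)) = 0"
  proof (rule power_int_independent[where c = "\<lambda>j. lcoeff f (inv_into (lsupp f) e j)" and S = "e ` lsupp f"])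
    fix w :: complex assume "w \<in> -{0}"
    then have w: "w \<noteq> 0" by simp
    then have t: "(w powi N, w) \<in> torus" by (simp add: torus_def)
    have "(\<Sum>j\<in>e ` lsupp f. lcoeff f (inv_into (lsupp f) e j) * w powi j) = (\<Sum>a\<in>lsupp f. lcoeff f a * w powi (e a))"
      by (simp add: sum.reindex[OF inj] inj)
    also have "\<dots> = leval f (w powi N, w)"
      by (simp add: leval_sum_superset[of "lsupp f"] zpow_def e_def power_int_add w power_int_mult)
    also have "\<dots> = 0" using assms t by blast
    finally show "(\<Sum>j\<in>e ` lsupp f. lcoeff f (inv_into (lsupp f) e j) * w powi j) = 0" .
  qed (use k infinite_nonzero_complex in auto)
  then show False using k inj by (simp add: in_keys_iff)
qed

lemma laurent_eqI:
  assumes "\<And>z. z \<in> torus \<Longrightarrow> leval f z = leval g z"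
  shows "f = g"
proof -
  have "f + lmono 0 (-1) * g = 0"
    by (rule leval_eq_0_imp_zero) (simp add: leval_mult assms)
  then have "lcoeff (f + lmono 0 (-1) * g) k = 0" for k by simp
  then show ?thesis by (intro poly_mapping_eqI) (simp add: lookup_add)
qed

section \<open>Generic heights\<close>

text \<open>An injective linear functional on the lattice, that is, a functional of irrational slope. It orders the
exponents totally and compatibly with addition, so each nonzero Laurent polynomial has a unique leading
term.\<close>

definition generic_height :: "(int \<times> int \<Rightarrow> real) \<Rightarrow> bool" where
  "generic_height u \<longleftrightarrow> (\<forall>a b. u (a + b) = u a + u b) \<and> inj u"

lemma generic_height_add: "generic_height u \<Longrightarrow> u (a + b) = u a + u b"
  unfolding generic_height_def by blast

lemma generic_height_diff: "generic_height u \<Longrightarrow> u (a - b) = u a - u b"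
  using generic_height_add[of u "a - b" b] by simp

lemma generic_height_zero: "generic_height u \<Longrightarrow> u 0 = 0"
  using generic_height_diff[of u 0 0] by simp

lemma generic_height_eq_iff: "generic_height u \<Longrightarrow> u a = u b \<longleftrightarrow> a = b"
  unfolding generic_height_def inj_def by blast

lemma generic_height_uminus: "generic_height u \<Longrightarrow> generic_height (\<lambda>a. - u a)"
  by (auto simp: generic_height_def inj_def)

definition top_height :: "(int \<times> int \<Rightarrow> real) \<Rightarrow> laurent \<Rightarrow> real" where
  "top_height u f = Max (u ` lsupp f)"

lemma top_height_ge: "a \<in> lsupp f \<Longrightarrow> u a \<le> top_height u f"
  by (simp add: top_height_def)

lemma top_height_attained: "f \<noteq> 0 \<Longrightarrow> \<exists>a\<in>lsupp f. top_height u f = u a"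
proof -
  assume "f \<noteq> 0"
  then have "Max (u ` lsupp f) \<in> u ` lsupp f" by (intro Max_in) (auto simp: keys_eq_empty)
  then show ?thesis unfolding top_height_def by blast
qed

lemma top_height_mono: "f \<noteq> 0 \<Longrightarrow> lsupp f \<subseteq> lsupp g \<Longrightarrow> top_height u f \<le> top_height u g"
  using top_height_attained[of f u] top_height_ge[of _ g u] by force

text \<open>The product of the two leading terms cannot be cancelled, since by injectivity no other pair of
exponents has the same sum of heights. This also shows that there are no zero divisors.\<close>

lemma top_height_mult:
  assumes u: "generic_height u" and f: "f \<noteq> 0" and g: "g \<noteq> 0"
  shows "f * g \<noteq> 0" and "top_height u (f * g) = top_height u f + top_height u g"
proof -
  obtain a where a: "a \<in> lsupp f" "top_height u f = u a" using top_height_attained[OF f] by metis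
  obtain b where b: "b \<in> lsupp g" "top_height u g = u b" using top_height_attained[OF g] by metis
  have "lcoeff (f * g) (a + b) = (\<Sum>x\<in>lsupp f. lcoeff f x * lcoeff g (a + b - x))"
    by (rule lcoeff_mult) auto
  also have "\<dots> = (\<Sum>x\<in>{a}. lcoeff f x * lcoeff g (a + b - x))"
  proof (rule sum.mono_neutral_right)
    show "\<forall>x\<in>lsupp f - {a}. lcoeff f x * lcoeff g (a + b - x) = 0"
    proof
      fix x assume x: "x \<in> lsupp f - {a}"
      have "a + b - x \<notin> lsupp g"
      proof
        assume "a + b - x \<in> lsupp g"
        then have "u (a + b - x) \<le> u b" using top_height_ge b by metis
        moreover have "u x \<le> u a" using x top_height_ge a by (metis DiffD1)
        ultimately have "u x = u a" by (simp add: generic_height_diff[OF u] generic_height_add[OF u])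
        then show False using x generic_height_eq_iff[OF u] by blast
      qed
      then show "lcoeff f x * lcoeff g (a + b - x) = 0" by (simp add: in_keys_iff)
    qed
  qed (use a in auto)
  also have "\<dots> = lcoeff f a * lcoeff g b" by simp
  finally have top: "a + b \<in> lsupp (f * g)" using a b by (auto simp: in_keys_iff)
  then show nz: "f * g \<noteq> 0" by force
  obtain k where k: "k \<in> lsupp (f * g)" "top_height u (f * g) = u k"
    using top_height_attained[OF nz] by metis
  then obtain x y where "x \<in> lsupp f" "y \<in> lsupp g" "k = x + y" using subsetD[OF keys_mult k(1)] by blast
  then have "u k \<le> u a + u b" using top_height_ge[of x f u] top_height_ge[of y g u] a b
    by (simp add: generic_height_add[OF u])
  moreover have "u a + u b \<le> u k" using top_height_ge[OF top, of u] k by (simp add: generic_height_add[OF u])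
  ultimately show "top_height u (f * g) = top_height u f + top_height u g" using a b k by simp
qed

text \<open>The width of the Newton polygon in the given direction.\<close>

definition height_width :: "(int \<times> int \<Rightarrow> real) \<Rightarrow> laurent \<Rightarrow> real" where
  "height_width u f = top_height u f + top_height (\<lambda>a. - u a) f"

lemma height_width_mult:
  assumes "generic_height u" "f \<noteq> 0" "g \<noteq> 0"
  shows "height_width u (f * g) = height_width u f + height_width u g"
  using top_height_mult(2)[OF assms] top_height_mult(2)[OF generic_height_uminus[OF assms(1)] assms(2,3)]
  by (simp add: height_width_def)

lemma height_width_mono: "f \<noteq> 0 \<Longrightarrow> lsupp f \<subseteq> lsupp g \<Longrightarrow> height_width u f \<le> height_width u g"
  by (simp add: height_width_def add_mono top_height_mono)

lemma height_diff_le_width: "a \<in> lsupp f \<Longrightarrow> b \<in> lsupp f \<Longrightarrow> u a - u b \<le> height_width u f"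
  using top_height_ge[of a f u] top_height_ge[of b f "\<lambda>a. - u a"] by (simp add: height_width_def)

lemma height_width_nonneg: "f \<noteq> 0 \<Longrightarrow> 0 \<le> height_width u f"
proof -
  assume "f \<noteq> 0"
  then obtain a where "a \<in> lsupp f" using keys_eq_empty[of f] by blast
  from height_diff_le_width[OF this this, of u] show ?thesis by simp
qed

lemma height_width_eq_0_iff:
  assumes u: "generic_height u" and f: "f \<noteq> 0"
  shows "height_width u f = 0 \<longleftrightarrow> card (lsupp f) = 1"
proof
  assume w: "height_width u f = 0"
  obtain a where a: "a \<in> lsupp f" using f keys_eq_empty[of f] by blast
  have "b = a" if b: "b \<in> lsupp f" for b
  proof -
    have "u b = u a"
      using height_diff_le_width[OF a b, of u] height_diff_le_width[OF b a, of u] w by linarith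
    then show ?thesis by (simp only: generic_height_eq_iff[OF u])
  qed
  then have "lsupp f = {a}" using a by blast
  then show "card (lsupp f) = 1" by simp
next
  assume "card (lsupp f) = 1"
  then obtain a where "lsupp f = {a}" by (rule card_1_singletonE)
  then show "height_width u f = 0" by (simp add: height_width_def top_height_def)
qed

definition det2 :: "int \<times> int \<Rightarrow> int \<times> int \<Rightarrow> int" where
  "det2 a b = fst a * snd b - snd a * fst b"

lemma det2_self [simp]: "det2 a a = 0"
  by (simp add: det2_def)

definition noncollinear :: "(int \<times> int) set \<Rightarrow> bool" where
  "noncollinear S \<longleftrightarrow> (\<exists>a\<in>S. \<exists>b\<in>S. \<exists>c\<in>S. det2 (b - a) (c - a) \<noteq> 0)"

lemma noncollinear_mono: "noncollinear S \<Longrightarrow> S \<subseteq> T \<Longrightarrow> noncollinear T"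
  unfolding noncollinear_def by blast

lemma irrational_between:
  fixes x y :: real
  assumes "x < y"
  obtains t where "x < t" "t < y" "t \<notin> \<rat>"
proof -
  have "uncountable ({x<..<y} - \<rat>)"
    using assms by (intro uncountable_minus_countable) (auto simp: uncountable_open_interval countable_rat)
  then have "\<exists>t. t \<in> {x<..<y} - \<rat>" by (metis countable_empty ex_in_conv)
  then show ?thesis using that by auto
qed

lemma generic_height_irrational:
  assumes t: "t \<notin> \<rat>" and rat: "\<And>a. m a \<in> \<rat>" "\<And>a. n a \<in> \<rat>"
    and add: "\<And>a b. m (a + b) = m a + m b" "\<And>a b. n (a + b) = n a + n b"
    and inj: "\<And>a. m a = 0 \<Longrightarrow> n a = 0 \<Longrightarrow> a = 0"
  shows "generic_height (\<lambda>a. t * m a + n a)"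
  unfolding generic_height_def
proof (intro conjI allI injI)
  fix a b
  show "t * m (a + b) + n (a + b) = t * m a + n a + (t * m b + n b)" by (simp add: add algebra_simps)
  assume "t * m a + n a = t * m b + n b"
  moreover have "m (a - b) = m a - m b" "n (a - b) = n a - n b"
    using add[of "a - b" b] by simp_all
  ultimately have eq: "t * m (a - b) = - n (a - b)" by (simp only: right_diff_distrib)
  have "m (a - b) = 0"
  proof (rule ccontr)
    assume "m (a - b) \<noteq> 0"
    then have "t = - n (a - b) / m (a - b)" using eq by (simp add: field_simps)
    then show False using t rat by simp
  qed
  then show "a = b" using eq inj[of "a - b"] by simp
qed

text \<open>Two of the vectors from \<open>b\<close> to points of \<open>S\<close> are linearly independent, for otherwise \<open>S\<close>
would be collinear. In the rational coordinates with respect to this basis, the functional with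
coefficients \<open>t\<close> and \<open>-1\<close>, up to scaling, is positive on one of them, negative on the
other, and injective for irrational \<open>t\<close>.\<close>

lemma generic_height_straddling:
  assumes "noncollinear S"
  obtains u i j where "generic_height u" "i \<in> S" "j \<in> S" "u b \<le> u i" "u j \<le> u b"
proof -
  obtain p q r where pqr: "p \<in> S" "q \<in> S" "r \<in> S" "det2 (q - p) (r - p) \<noteq> 0"
    using assms by (auto simp: noncollinear_def)
  have "det2 (q - p) (r - p) = det2 (q - b) (r - b) - det2 (q - b) (p - b) - det2 (p - b) (r - b)"
    by (simp add: det2_def algebra_simps)
  then have "det2 (q - b) (r - b) \<noteq> 0 \<or> det2 (q - b) (p - b) \<noteq> 0 \<or> det2 (p - b) (r - b) \<noteq> 0" using pqr(4) by linarith
  then have "\<exists>i\<in>S. \<exists>j\<in>S. det2 (i - b) (j - b) \<noteq> 0" using pqr by blast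
  then obtain i j where ij: "i \<in> S" "j \<in> S" "det2 (i - b) (j - b) \<noteq> 0" by blast
  \<comment> \<open>The factor \<open>D\<close> in \<open>u\<close> makes the signs independent of the orientation of the basis.\<close>
  define D where "D = det2 (i - b) (j - b)"
  obtain t :: real where t: "0 < t" "t \<notin> \<rat>" using irrational_between[of 0 1] by auto
  define u where "u = (\<lambda>a. t * of_int (det2 a (j - b) * D) + of_int (- det2 (i - b) a * D))"
  have inj: "a = 0" if "det2 a (j - b) = 0" "det2 (i - b) a = 0" for a
  proof -
    have "D * fst a = det2 a (j - b) * fst (i - b) + det2 (i - b) a * fst (j - b)"
      "D * snd a = det2 a (j - b) * snd (i - b) + det2 (i - b) a * snd (j - b)"
      unfolding D_def det2_def by algebra+
    then show ?thesis using that ij by (simp add: D_def prod_eq_iff)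
  qed
  have u: "generic_height u"
    unfolding u_def
  proof (rule generic_height_irrational)
    show "a = 0" if "real_of_int (det2 a (j - b) * D) = 0" "real_of_int (- det2 (i - b) a * D) = 0" for a
      using that inj[of a] ij by (simp add: D_def)
  qed (use t in \<open>auto simp: det2_def algebra_simps\<close>)
  have "u (i - b) = t * of_int (D * D)" "u (j - b) = - of_int (D * D)"
    by (simp_all add: u_def D_def[symmetric] det2_self)
  moreover have "0 \<le> t * of_int (D * D)" "0 \<le> (of_int (D * D) :: real)" using t by auto
  ultimately have "u b \<le> u i" "u j \<le> u b"
    using generic_height_diff[OF u, of i b] generic_height_diff[OF u, of j b] by linarith+
  then show ?thesis using that u ij by blast
qed

text \<open>Two generic heights can serve as coordinates of the plane, so together they bound the exponents. This
replaces the bounding box of a Newton polygon.\<close>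

lemma finite_height_box:
  obtains v w where "generic_height v" "generic_height w"
    "\<And>C. finite {a. \<bar>v a\<bar> \<le> C \<and> \<bar>w a\<bar> \<le> C}"
proof -
  obtain t :: real where t: "1 < t" "t \<notin> \<rat>" using irrational_between[of 1 2] by auto
  define v where "v = (\<lambda>a :: int \<times> int. t * of_int (fst a) + of_int (snd a))"
  define w where "w = (\<lambda>a :: int \<times> int. t * of_int (fst a) + of_int (- snd a))"
  have v: "generic_height v" unfolding v_def by (rule generic_height_irrational) (use t in \<open>auto simp: prod_eq_iff\<close>)
  have w: "generic_height w" unfolding w_def by (rule generic_height_irrational) (use t in \<open>auto simp: prod_eq_iff\<close>)
  have "finite {a. \<bar>v a\<bar> \<le> C \<and> \<bar>w a\<bar> \<le> C}" for C
  proof (rule finite_subset)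
    show "finite ({-\<lceil>C\<rceil>..\<lceil>C\<rceil>} \<times> {-\<lceil>C\<rceil>..\<lceil>C\<rceil>})" by simp
    show "{a. \<bar>v a\<bar> \<le> C \<and> \<bar>w a\<bar> \<le> C} \<subseteq> {-\<lceil>C\<rceil>..\<lceil>C\<rceil>} \<times> {-\<lceil>C\<rceil>..\<lceil>C\<rceil>}"
    proof clarify
      fix x y assume h: "\<bar>v (x, y)\<bar> \<le> C" "\<bar>w (x, y)\<bar> \<le> C"
      have "\<bar>t * of_int x\<bar> \<le> C" "\<bar>of_int y\<bar> \<le> C"
        using h by (auto simp: v_def w_def)
      moreover have "\<bar>real_of_int x\<bar> \<le> \<bar>t * of_int x\<bar>" using t by (simp add: abs_mult mult_le_cancel_right1)
      ultimately have "\<bar>real_of_int x\<bar> \<le> C" "\<bar>real_of_int y\<bar> \<le> C" by linarith+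
      then show "x \<in> {-\<lceil>C\<rceil>..\<lceil>C\<rceil>} \<and> y \<in> {-\<lceil>C\<rceil>..\<lceil>C\<rceil>}" by (auto simp: le_ceiling_iff) linarith+
    qed
  qed
  then show ?thesis using that v w by blast
qed

text \<open>A strictly separating line exists because the convex hull is compact; being finitely many strict
inequalities, separation is an open condition on the functional, and functionals of irrational slope are
dense.\<close>

lemma generic_height_separating:
  assumes A: "finite A" "A \<noteq> {}" and v: "to_plane v \<notin> conv A"
  obtains u where "generic_height u" "\<And>a. a \<in> A \<Longrightarrow> u a < u v"
proof -
  have "compact (conv A)" using A by (simp add: finite_imp_compact_convex_hull)
  then obtain w c where w: "w \<bullet> to_plane v < c" "\<And>x. x \<in> conv A \<Longrightarrow> c < w \<bullet> x"
    using separating_hyperplane_closed_point[of "conv A" "to_plane v"] v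
      convex_convex_hull compact_imp_closed by metis
  define G where "G = (\<Inter>a\<in>A. {x :: real \<times> real. x \<bullet> (to_plane a - to_plane v) < 0})"
  have "open G" unfolding G_def
    by (intro open_INT open_Collect_less continuous_intros A(1) ballI)
  moreover have "- w \<in> G"
    proof -
    have "w \<bullet> to_plane v < w \<bullet> to_plane a" if "a \<in> A" for a
      using w(1) w(2)[of "to_plane a"] that by (meson hull_inc imageI less_trans)
    then show ?thesis by (simp add: G_def inner_diff_right)
  qed
  ultimately obtain X Y where XY: "open X" "open Y" "- w \<in> X \<times> Y" "X \<times> Y \<subseteq> G"
    by (rule open_prod_elim)
  obtain e1 where e1: "e1 > 0" "\<And>y. \<bar>y - fst (- w)\<bar> < e1 \<Longrightarrow> y \<in> X"
    using XY(1,3) unfolding open_dist dist_real_def mem_Times_iff by blast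
  obtain e2 where e2: "e2 > 0" "\<And>y. \<bar>y - snd (- w)\<bar> < e2 \<Longrightarrow> y \<in> Y"
    using XY(2,3) unfolding open_dist dist_real_def mem_Times_iff by blast
  define x where "x = fst (- w)"
  have "\<exists>r\<in>\<rat>. r \<noteq> 0 \<and> x < r \<and> r < x + e1"
  proof (cases "x \<ge> 0")
    case True
    obtain r where "r \<in> \<rat>" "x < r" "r < x + e1" using Rats_dense_in_real[of x "x + e1"] e1 by auto
    then show ?thesis using True by (intro bexI[of _ r]) auto
  next
    case False
    obtain r where "r \<in> \<rat>" "x < r" "r < min (x + e1) 0"
      using Rats_dense_in_real[of x "min (x + e1) 0"] e1 False by auto
    then show ?thesis by (intro bexI[of _ r]) auto
  qed
  then obtain r where r: "r \<in> \<rat>" "r \<noteq> 0" "x < r" "r < x + e1" by blast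
  then have rX: "r \<in> X" by (intro e1(2)) (simp add: x_def)
  obtain s where s: "snd (- w) < s" "s < snd (- w) + e2" "s \<notin> \<rat>"
    using irrational_between[of "snd (- w)" "snd (- w) + e2"] e2(1) by auto
  then have sY: "s \<in> Y" by (intro e2(2)) simp
  define u where "u = (\<lambda>a :: int \<times> int. s * of_int (snd a) + r * of_int (fst a))"
  have "generic_height u"
    unfolding u_def by (rule generic_height_irrational) (use r s in \<open>auto simp: prod_eq_iff algebra_simps\<close>)
  moreover have "u a < u v" if "a \<in> A" for a
  proof -
    have "(r, s) \<in> G" using XY(4) rX sY by blast
    then have "(r, s) \<bullet> (to_plane a - to_plane v) < 0" using that by (simp add: G_def)
    then show ?thesis by (simp add: u_def to_plane_def algebra_simps)
  qed
  ultimately show ?thesis using that by blast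
qed

lemma noncollinear_if_not_on_segment:
  assumes B: "finite B" and nseg: "\<not> lies_on_segment B"
  shows "noncollinear B"
proof (rule ccontr)
  assume col: "\<not> noncollinear B"
  obtain a where a: "a \<in> B" using nseg unfolding lies_on_segment_def by blast
  obtain b where b: "b \<in> B" "b \<noteq> a" 
  proof (rule ccontr)
    assume "\<not> thesis"
    then have "to_plane ` B \<subseteq> closed_segment (to_plane a) (to_plane a)" using a that by auto
    then show False using nseg lies_on_segment_def by blast
  qed
  define d where "d = to_plane (b - a)"
  define p where "p = to_plane a"
  have "\<exists>t. to_plane c = p + t *\<^sub>R d" if "c \<in> B" for c
  proof -
    have "real_of_int (det2 (b - a) (c - a)) = 0" using col a b that unfolding noncollinear_def by auto
    then have dt: "(real_of_int (fst b) - fst a) * (snd c - snd a) = (real_of_int (snd b) - snd a) * (fst c - fst a)"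
      by (simp add: det2_def)
    show ?thesis
    proof (cases "fst b = fst a")
      case True
      then have "snd b \<noteq> snd a" using b by (auto simp: prod_eq_iff)
      then show ?thesis using True dt
        by (intro exI[of _ "(real_of_int (snd c) - snd a) / (snd b - snd a)"]) (simp add: p_def d_def to_plane_def)
    next
      case False
      then show ?thesis using dt
        by (intro exI[of _ "(real_of_int (fst c) - fst a) / (fst b - fst a)"]) (simp add: p_def d_def to_plane_def field_simps)
    qed
  qed
  then obtain t where t: "\<And>c. c \<in> B \<Longrightarrow> to_plane c = p + t c *\<^sub>R d" by metis
  define m M where "m = Min (t ` B)" and "M = Max (t ` B)"
  have "to_plane c \<in> closed_segment (p + m *\<^sub>R d) (p + M *\<^sub>R d)" if c: "c \<in> B" for c
  proof -
    have mM: "m \<le> t c" "t c \<le> M" using c B by (auto simp: m_def M_def)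
    then have "t c \<in> closed_segment m M" by (simp add: closed_segment_eq_real_ivl)
    then obtain z where "0 \<le> z" "z \<le> 1" "t c = (1 - z) * m + z * M" by (auto simp: in_segment)
    then show ?thesis unfolding t[OF c] in_segment
      by (intro exI[of _ z]) (simp add: scaleR_left_distrib scaleR_right_distrib scaleR_left_diff_distrib)
  qed
  then have "to_plane ` B \<subseteq> closed_segment (p + m *\<^sub>R d) (p + M *\<^sub>R d)" by blast
  then show False using nseg lies_on_segment_def by blast
qed

section \<open>Polynomials in two variables\<close>

text \<open>The inner polynomials are in the first coordinate, the outer variable is the second one.\<close>

definition eval2 :: "complex poly poly \<Rightarrow> complex \<times> complex \<Rightarrow> complex" where
  "eval2 P z = poly (poly P [:snd z:]) (fst z)"

lemma eval2_simps [simp]: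
  "eval2 (P + Q) z = eval2 P z + eval2 Q z" "eval2 (P * Q) z = eval2 P z * eval2 Q z"
  "eval2 0 z = 0" "eval2 1 z = 1" "eval2 [:p:] z = poly p (fst z)"
  "eval2 (monom p j) z = poly p (fst z) * snd z ^ j"
  "eval2 (pCons p P) z = poly p (fst z) + snd z * eval2 P z"
  by (simp_all add: eval2_def poly_monom)

lemma eval2_sum: "eval2 (\<Sum>i\<in>I. P i) z = (\<Sum>i\<in>I. eval2 (P i) z)"
  by (induction I rule: infinite_finite_induct) auto

lemma eval2_eqI:
  assumes "\<And>z. z \<in> torus \<Longrightarrow> eval2 P z = eval2 Q z"
  shows "P = Q"
proof -
  have root: "poly (P - Q) [:y:] = 0" if y: "y \<noteq> 0" for y
  proof (rule ccontr)
    assume "poly (P - Q) [:y:] \<noteq> 0"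
    then have "finite {x. poly (poly (P - Q) [:y:]) x = 0}" by (rule poly_roots_finite)
    moreover have "- {0} \<subseteq> {x. poly (poly (P - Q) [:y:]) x = 0}"
      using assms[of "(_, y)"] y by (auto simp: torus_def eval2_def)
    ultimately show False using infinite_nonzero_complex finite_subset by blast
  qed
  have "P - Q = 0"
  proof (rule ccontr)
    assume "P - Q \<noteq> 0"
    then have "finite {x. poly (P - Q) x = 0}" by (rule poly_roots_finite)
    moreover have "(\<lambda>y. [:y:]) ` (- {0}) \<subseteq> {x. poly (P - Q) x = 0}" using root by auto
    ultimately have "finite ((\<lambda>y :: complex. [:y:]) ` (- {0}))" using finite_subset by blast
    then have "finite (- {0 :: complex})" by (rule finite_imageD) (auto intro: inj_onI)
    then show False using infinite_nonzero_complex by blast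
  qed
  then show ?thesis by simp
qed

lemma laurent_of_poly_ex: "\<exists>p. \<forall>z\<in>torus. leval p z = eval2 P z"
proof (induction P)
  case 0
  then show ?case by (intro exI[of _ 0]) simp
next
  case (pCons c P)
  then obtain p where p: "\<forall>z\<in>torus. leval p z = eval2 P z" by blast
  have "\<exists>q. \<forall>z\<in>torus. leval q z = poly c (fst z)"
  proof (induction c)
    case 0
    then show ?case by (intro exI[of _ 0]) simp
  next
    case (pCons a c)
    then obtain q where "\<forall>z\<in>torus. leval q z = poly c (fst z)" by blast
    then show ?case
      by (intro exI[of _ "lmono 0 a + lmono (1, 0) 1 * q"]) (simp add: leval_mult zpow_def)
  qed
  then obtain q where "\<forall>z\<in>torus. leval q z = poly c (fst z)" by blast
  then show ?case using p
    by (intro exI[of _ "q + lmono (0, 1) 1 * p"]) (simp add: leval_mult zpow_def)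
qed

lemma poly_of_laurent_ex: "\<exists>N. \<forall>n\<ge>N. \<exists>P. \<forall>z\<in>torus. eval2 P z = zpow z (int n, int n) * leval p z"
proof -
  define N where "N = Max (insert 0 ((\<lambda>a. nat (max \<bar>fst a\<bar> \<bar>snd a\<bar>)) ` lsupp p))"
  have "\<exists>P. \<forall>z\<in>torus. eval2 P z = zpow z (int n, int n) * leval p z" if n: "n \<ge> N" for n
  proof (intro exI ballI)
    let ?P = "\<Sum>a\<in>lsupp p. monom (monom (lcoeff p a) (nat (fst a + n))) (nat (snd a + n))"
    fix z assume z: "z \<in> torus"
    have "eval2 (monom (monom (lcoeff p a) (nat (fst a + n))) (nat (snd a + n))) z
        = lcoeff p a * zpow z ((int n, int n) + a)" if a: "a \<in> lsupp p" for a
    proof -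
      have "nat (max \<bar>fst a\<bar> \<bar>snd a\<bar>) \<le> N" unfolding N_def using a by (intro Max_ge) auto
      then have "\<bar>fst a\<bar> \<le> n" "\<bar>snd a\<bar> \<le> n" using n by linarith+
      then have ge: "0 \<le> fst a + n" "0 \<le> snd a + n" by linarith+
      then have "fst z ^ nat (fst a + n) = fst z powi (n + fst a)" "snd z ^ nat (snd a + n) = snd z powi (n + snd a)"
        by (simp_all add: power_int_def add.commute)
      then show ?thesis by (simp add: zpow_def poly_monom)
    qed
    then show "eval2 ?P z = zpow z (int n, int n) * leval p z"
      using z by (simp add: eval2_sum leval_sum_superset[of "lsupp p" p] zpow_add sum_distrib_left algebra_simps)
  qed
  then show ?thesis by blast
qed

text \<open>Gauss' lemma: over the field of fractions the constant factor \<open>c\<close> is invertible.\<close>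

lemma primitive_dvd_of_dvd_smult:
  fixes P Q :: "complex poly poly"
  assumes dvd: "P dvd smult c Q" and c: "c \<noteq> 0" and prim: "content P = 1"
  shows "P dvd Q"
proof (rule fract_poly_dvdD[OF _ prim])
  have "fract_poly P dvd fract_poly (smult c Q)" using dvd by (rule fract_poly_dvd)
  then have "fract_poly P dvd smult (to_fract c) (fract_poly Q)" by (simp add: fract_poly_smult)
  then show "fract_poly P dvd fract_poly Q" using c by (simp add: dvd_smult_iff)
qed

text \<open>An element of least degree in the ideal generated by \<open>F\<close> and \<open>G\<close> divides both, up to constants of
\<open>\<complex>[x]\<close>, by pseudo-division. By Gauss' lemma its primitive part is a common divisor, hence a
unit. Geometrically, two curves without common component meet over finitely many \<open>x\<close>.\<close>

lemma coprime_bezout_const: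
  fixes F G :: "complex poly poly"
  assumes cop: "coprime F G"
  obtains U V R where "R \<noteq> 0" "U * F + V * G = [:R:]"
proof -
  define I where "I = {P. P \<noteq> 0 \<and> (\<exists>U V. P = U * F + V * G)}"
  have "F \<noteq> 0 \<or> G \<noteq> 0" using cop by auto
  moreover have "F = 1 * F + 0 * G" "G = 0 * F + 1 * G" by simp_all
  ultimately have "\<exists>P. P \<in> I" unfolding I_def by blast
  then obtain D where D: "D \<in> I" and min: "\<And>P. P \<in> I \<Longrightarrow> degree D \<le> degree P"
    using ex_has_least_nat[of "\<lambda>P. P \<in> I" _ degree] by metis
  obtain U V where UV: "D = U * F + V * G" and D0: "D \<noteq> 0" using D by (auto simp: I_def)
  have dvd: "primitive_part D dvd P" if P: "P = X * F + Y * G" for P X Y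
  proof -
    obtain a q where aq: "a \<noteq> 0" "smult a P = D * q + pseudo_mod P D" using pseudo_mod(1)[OF D0] by blast
    have "pseudo_mod P D = (smult a X - q * U) * F + (smult a Y - q * V) * G"
      using aq(2) unfolding P UV by (simp add: algebra_simps smult_add_right)
    then have "pseudo_mod P D = 0"
      using pseudo_mod(2)[OF D0, of P] min[of "pseudo_mod P D"] unfolding I_def by force
    then have "D dvd smult a P" using aq by simp
    moreover have "primitive_part D dvd D"
      by (metis content_times_primitive_part dvd_smult dvd_refl)
    ultimately have "primitive_part D dvd smult a P" by (metis dvd_trans)
    then show ?thesis by (rule primitive_dvd_of_dvd_smult[OF _ aq(1) content_primitive_part[OF D0]])
  qed
  have "primitive_part D dvd F" "primitive_part D dvd G"
    by (rule dvd[of _ 1 0], simp) (rule dvd[of _ 0 1], simp)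
  then have "is_unit (primitive_part D)" using cop coprime_common_divisor by blast
  then have "degree D = 0" by (metis degree_primitive_part is_unit_polyE degree_pCons_0)
  then obtain R where "D = [:R:]" by (rule degree_eq_zeroE)
  then show ?thesis using that[of R U V] UV D0 by auto
qed

text \<open>Eisenstein's criterion at a root \<open>w\<close> of \<open>c\<^sub>0 + c\<^sub>1 x\<^sup>D\<close>. Modulo \<open>x - w\<close> the polynomial is
\<open>c\<^sub>2 y\<^sup>D\<close>, so the constant terms (in \<open>y\<close>) of two factors of positive degree both vanish at \<open>w\<close>,
although \<open>w\<close> is a simple root of their product.\<close>

lemma fermat_irreducible:
  fixes c0 c1 c2 :: complex
  assumes D: "D > 0" and c: "c0 \<noteq> 0" "c1 \<noteq> 0" "c2 \<noteq> 0"
  shows "irreducible (monom [:c2:] D + [:[:c0:] + monom c1 D:])" (is "irreducible ?F")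
proof -
  have coeffF: "coeff ?F D = [:c2:]" "coeff ?F 0 = [:c0:] + monom c1 D"
    "\<And>i. i > D \<Longrightarrow> coeff ?F i = 0" "\<And>i. 0 < i \<Longrightarrow> i < D \<Longrightarrow> coeff ?F i = 0"
    using D by (auto simp: coeff_pCons split: nat.splits)
  have degF: "degree ?F = D"
    by (rule antisym, rule degree_le, use coeffF c in \<open>auto intro!: le_degree\<close>)
  obtain w where w: "poly ([:c0:] + monom c1 D) w = 0"
  proof -
    have "degree ([:c0:] + monom c1 D) = D"
      using D c by (subst degree_add_eq_right) (auto simp: degree_monom_eq)
    then have "\<not> constant (poly ([:c0:] + monom c1 D))" using D by (simp add: constant_degree)
    then show ?thesis using fundamental_theorem_of_algebra that by blast
  qed
  have w0: "w \<noteq> 0" using w D c by (auto simp: poly_monom zero_power)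
  have simple: "\<not> (poly p w = 0 \<and> poly q w = 0)" if pq: "p * q = [:c0:] + monom c1 D" for p q
  proof
    assume z: "poly p w = 0 \<and> poly q w = 0"
    have "poly (pderiv (p * q)) w = 0" using z by (simp add: pderiv_mult)
    then show False using D c w0 unfolding pq by (simp add: pderiv_add pderiv_monom poly_monom pderiv_pCons)
  qed
  \<comment> \<open>Reduction modulo \<open>x - w\<close>.\<close>
  have key: "coeff P 0 = 0 \<or> poly (coeff P 0) w = 0" 
    if PQ: "P * Q = ?F" and deg: "degree P > 0" for P Q
  proof -
    define red where "red = (\<lambda>P :: complex poly poly. map_poly (\<lambda>p. poly p w) P)"
    have coeff_red: "coeff (red P) i = poly (coeff P i) w" for P i
      by (simp add: red_def coeff_map_poly)
    have redm: "red P * red Q = monom c2 D"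
    proof (rule poly_eqI)
      fix i
      have "coeff (red P * red Q) i = poly (coeff (P * Q) i) w"
        by (simp add: coeff_mult coeff_red poly_sum)
      also have "\<dots> = coeff (monom c2 D) i"
        unfolding PQ using w D by (cases i) (auto simp: poly_monom coeff_pCons)
      finally show "coeff (red P * red Q) i = coeff (monom c2 D) i" .
    qed
    have lead: "lead_coeff P * lead_coeff Q = [:c2:]"
      using lead_coeff_mult[of P Q] coeffF(1) degF unfolding PQ by simp
    then have "poly (lead_coeff P) w * poly (lead_coeff Q) w = c2"
      by (metis poly_mult poly_const_conv)
    then have "coeff (red P) (degree P) \<noteq> 0" using c by (auto simp: coeff_red)
    then have "degree (red P) > 0" using le_degree deg by force
    then have "\<not> constant (poly (red P))" by (simp add: constant_degree)
    then obtain y where y: "poly (red P) y = 0" using fundamental_theorem_of_algebra by blast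
    have "poly (monom c2 D) y = 0" using y unfolding redm[symmetric] by simp
    then have "y = 0" using c D by (simp add: poly_monom)
    then have "coeff (red P) 0 = 0" using y by (simp add: poly_0_coeff_0)
    then show ?thesis by (simp add: coeff_red)
  qed
  have unit: "is_unit P" if PQ: "P * Q = ?F" and deg: "degree P = 0" for P Q
  proof -
    obtain a where a: "P = [:a:]" using deg by (rule degree_eq_zeroE)
    have "a * coeff Q D = [:c2:]" using coeffF(1) unfolding PQ[symmetric] a by simp
    moreover have "is_unit [:c2:]" using c by (simp add: is_unit_const_poly_iff dvd_field_iff)
    ultimately have "is_unit a" by (metis dvd_trans dvd_triv_left)
    then show ?thesis unfolding a by (simp add: is_unit_const_poly_iff)
  qed
  show ?thesis
  proof (rule irreducibleI)
    show "?F \<noteq> 0" using coeffF(1) c by (metis coeff_0 pCons_eq_0_iff)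
    show "\<not> is_unit ?F" using degF D by (metis is_unit_polyE degree_pCons_0 not_less0)
    fix P Q assume PQ: "?F = P * Q"
    show "is_unit P \<or> is_unit Q"
    proof (rule ccontr)
      assume "\<not> (is_unit P \<or> is_unit Q)"
      then have deg: "degree P > 0" "degree Q > 0"
        using unit[of P Q] unit[of Q P] PQ by (auto simp: mult.commute)
      have "coeff P 0 * coeff Q 0 = [:c0:] + monom c1 D"
        using coeffF(2) unfolding PQ by (simp add: coeff_mult_0)
      then show False using key[of P Q] key[of Q P] deg PQ simple[of "coeff P 0" "coeff Q 0"]
        by (auto simp: mult.commute)
    qed
  qed
qed

section \<open>Irreducible Laurent polynomials\<close>

text \<open>The units of the ring of Laurent polynomials are the monomials, which are the elements with exactly one
exponent.\<close>

definition laurent_irreducible :: "laurent \<Rightarrow> bool" where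
  "laurent_irreducible f \<longleftrightarrow> (\<forall>p q. f = p * q \<longrightarrow> card (lsupp p) = 1 \<or> card (lsupp q) = 1)"

lemma monomial_iff: "card (lsupp p) = 1 \<longleftrightarrow> (\<exists>a c. c \<noteq> 0 \<and> p = lmono a c)"
proof
  assume "card (lsupp p) = 1"
  then obtain a where a: "lsupp p = {a}" by (rule card_1_singletonE)
  then have "p = lmono a (lcoeff p a)" using laurent_sum_lmono[of "{a}" p] by simp
  moreover have "lcoeff p a \<noteq> 0" using a by (metis in_keys_iff insertI1)
  ultimately show "\<exists>a c. c \<noteq> 0 \<and> p = lmono a c" by blast
qed auto

lemma lmono_cancel:
  assumes "c \<noteq> 0"
  shows "lmono (- a) (1 / c) * (lmono a c * f) = f"
  using assms by (simp add: mult.assoc[symmetric] mult_single single_one)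

lemma factors_of_monomial:
  assumes "card (lsupp (p * q)) = 1"
  shows "card (lsupp p) = 1" "card (lsupp q) = 1"
proof -
  obtain v w where v: "generic_height v" using finite_height_box by metis
  have nz: "p * q \<noteq> 0" "p \<noteq> 0" "q \<noteq> 0" using assms by auto
  have "height_width v p + height_width v q = 0"
    using assms nz height_width_mult[OF v nz(2,3)] height_width_eq_0_iff[OF v nz(1)] by simp
  then have "height_width v p = 0" "height_width v q = 0"
    using height_width_nonneg[OF nz(2), of v] height_width_nonneg[OF nz(3), of v] by linarith+
  then show "card (lsupp p) = 1" "card (lsupp q) = 1"
    using height_width_eq_0_iff[OF v nz(2)] height_width_eq_0_iff[OF v nz(3)] by simp_all
qed

lemma polys_of_laurents_ex:
  "\<exists>n\<ge>N. \<exists>P Q. \<forall>z\<in>torus. eval2 P z = zpow z (int n, int n) * leval p z \<and>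
     eval2 Q z = zpow z (int n, int n) * leval q z"
proof -
  obtain N1 where N1: "\<forall>n\<ge>N1. \<exists>P. \<forall>z\<in>torus. eval2 P z = zpow z (int n, int n) * leval p z"
    using poly_of_laurent_ex by blast
  obtain N2 where N2: "\<forall>n\<ge>N2. \<exists>P. \<forall>z\<in>torus. eval2 P z = zpow z (int n, int n) * leval q z"
    using poly_of_laurent_ex by blast
  define n where "n = max N (max N1 N2)"
  have "N \<le> n" "N1 \<le> n" "N2 \<le> n" by (simp_all add: n_def)
  then show ?thesis using N1 N2 by meson
qed

text \<open>Split off the greatest common divisor in \<open>\<complex>[x, y]\<close>. If it is a monomial, the cofactors are coprime and have
common zeros over only finitely many \<open>x\<close>; otherwise the cofactor of \<open>f\<close> is a monomial.\<close>

lemma irreducible_dvd_if_common_zeros: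
  assumes irr: "laurent_irreducible f" and W: "infinite W"
    and zeros: "\<And>x. x \<in> W \<Longrightarrow> \<exists>y. (x, y) \<in> torus \<and> leval f (x, y) = 0 \<and> leval g (x, y) = 0"
  obtains h where "g = f * h"
proof -
  obtain n F G where FG_eval: "\<And>z. z \<in> torus \<Longrightarrow> eval2 F z = zpow z (int n, int n) * leval f z"
    "\<And>z. z \<in> torus \<Longrightarrow> eval2 G z = zpow z (int n, int n) * leval g z"
    using polys_of_laurents_ex[of 0 f g] by blast
  define m where "m = (int n, int n)"
  note F = FG_eval(1)[folded m_def] and G = FG_eval(2)[folded m_def]
  show ?thesis
  proof (cases "F = 0 \<and> G = 0")
    case True
    have "g = f * 0" by (rule laurent_eqI) (use G True in auto)
    then show ?thesis using that by blast
  next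
    case False
    then obtain F' G' where FG: "F = gcd F G * F'" "G = gcd F G * G'" "coprime F' G'"
      by (metis gcd_coprime_exists gcd_eq_0_iff mult.commute)
    obtain d where d: "\<And>z. z \<in> torus \<Longrightarrow> leval d z = eval2 (gcd F G) z" using laurent_of_poly_ex by blast
    obtain f' where f': "\<And>z. z \<in> torus \<Longrightarrow> leval f' z = eval2 F' z" using laurent_of_poly_ex by blast
    obtain g' where g': "\<And>z. z \<in> torus \<Longrightarrow> leval g' z = eval2 G' z" using laurent_of_poly_ex by blast
    have F2: "zpow z m * leval f z = leval d z * leval f' z" if "z \<in> torus" for z
      using F[OF that] FG(1) d f' that by (metis eval2_simps(2))
    have G2: "zpow z m * leval g z = leval d z * leval g' z" if "z \<in> torus" for z
      using G[OF that] FG(2) d g' that by (metis eval2_simps(2))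
    have mf: "lmono m 1 * f = d * f'" by (rule laurent_eqI) (simp add: leval_mult F2)
    have mg: "lmono m 1 * g = d * g'" by (rule laurent_eqI) (simp add: leval_mult G2)
    have "f = (lmono (-m) 1 * d) * f'"
      using lmono_cancel[of 1 m f] by (simp add: mf mult.assoc)
    then consider "card (lsupp (lmono (-m) 1 * d)) = 1" | "card (lsupp f') = 1"
      using irr by (auto simp: laurent_irreducible_def)
    then show ?thesis
    proof cases
      case 1
      then have "card (lsupp d) = 1" by (rule factors_of_monomial)
      then obtain a c where ac: "c \<noteq> 0" "d = lmono a c" unfolding monomial_iff by blast
      obtain U V R where R: "R \<noteq> 0" "U * F' + V * G' = [:R:]" using coprime_bezout_const[OF FG(3)] .
      have "poly R x = 0" if x: "x \<in> W" for x
      proof -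
        obtain y where y: "(x, y) \<in> torus" "leval f (x, y) = 0" "leval g (x, y) = 0" using zeros[OF x] by blast
        have "eval2 F' (x, y) = 0" "eval2 G' (x, y) = 0"
          using F2[OF y(1)] G2[OF y(1)] y ac by (auto simp: f' g')
        then have "eval2 (U * F' + V * G') (x, y) = 0" by simp
        then show ?thesis unfolding R by simp
      qed
      then have "W \<subseteq> {x. poly R x = 0}" by blast
      then have False using W poly_roots_finite[OF R(1)] finite_subset by blast
      then show ?thesis ..
    next
      case 2
      then obtain a c where ac: "c \<noteq> 0" "f' = lmono a c" unfolding monomial_iff by blast
      have "d = lmono (- a) (1 / c) * (lmono m 1 * f)"
        unfolding mf ac(2) using lmono_cancel[OF ac(1), of a d] by (simp add: mult.commute)
      then have "lmono m 1 * g = lmono m 1 * (f * (lmono (- a) (1 / c) * g'))"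
        unfolding mg by (simp add: mult_ac)
      then have "g = f * (lmono (- a) (1 / c) * g')"
        using lmono_cancel[of 1 m] by (metis zero_neq_one)
      then show ?thesis using that by blast
    qed
  qed
qed

lemma det2_linear: "det2 (a + b) c = det2 a c + det2 b c" "det2 c (a + b) = det2 c a + det2 c b"
  "det2 (a - b) c = det2 a c - det2 b c" "det2 c (a - b) = det2 c a - det2 c b"
  "det2 (- a) b = - det2 a b" "det2 a (- b) = - det2 a b"
  by (simp_all add: det2_def algebra_simps)

lemma zpow_powi: "zpow w k powi n = zpow w (n * fst k, n * snd k)"
  unfolding zpow_def fst_conv snd_conv power_int_mult_distrib
  by (simp only: mult.commute[of n] power_int_mult)

text \<open>The linear map \<open>M\<close>, the adjugate of the matrix with columns \<open>d\<^sub>1, d\<^sub>2\<close>, sends these vectors to multiples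
of the coordinate vectors. Substituting accordingly (a finite cover \<open>\<mu>\<close> of the torus) turns the trinomial into a
monomial times a Fermat polynomial, and a factorization of the trinomial into one of the latter. As
\<open>M\<close> is injective, only monomials pull back to monomials.\<close>

lemma trinomial_irreducible_aux:
  assumes D: "det2 d1 d2 > 0" and c: "c0 \<noteq> 0" "c1 \<noteq> 0" "c2 \<noteq> 0"
  shows "laurent_irreducible (lmono b c0 + lmono (b + d1) c1 + lmono (b + d2) c2)" (is "laurent_irreducible ?f")
proof -
  define D where "D = nat (det2 d1 d2)"
  have D0: "D > 0" and iD: "int D = det2 d1 d2" using D by (auto simp: D_def)
  \<comment> \<open>\<open>M\<close> acts on exponents, \<open>\<mu>\<close> on points; \<open>pb q\<close> below is the pullback of \<open>q\<close> along \<open>\<mu>\<close>.\<close>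
  define M where "M = (\<lambda>a. (det2 a d2, det2 d1 a))"
  define \<mu> where "\<mu> = (\<lambda>w. (zpow w (M (1, 0)), zpow w (M (0, 1))))"
  have \<mu>_torus: "\<mu> w \<in> torus" if "w \<in> torus" for w using that by (simp add: \<mu>_def torus_def zpow_def)
  have zpow_\<mu>: "zpow (\<mu> w) a = zpow w (M a)" if "w \<in> torus" for w a
  proof -
    have "zpow (\<mu> w) a = zpow w (fst a * fst (M (1, 0)), fst a * snd (M (1, 0)))
        * zpow w (snd a * fst (M (0, 1)), snd a * snd (M (0, 1)))"
      unfolding \<mu>_def zpow_def[of "(_, _)" a] by (simp only: fst_conv snd_conv zpow_powi)
    also have "\<dots> = zpow w (M a)"
      unfolding zpow_add[OF that, symmetric] by (simp add: M_def det2_def algebra_simps)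
    finally show ?thesis .
  qed
  have M_add: "M (a + b) = M a + M b" for a b by (simp add: M_def det2_linear)
  have M_d: "M d1 = (int D, 0)" "M d2 = (0, int D)" by (simp_all add: M_def iD)
  have M_inj: "inj M"
  proof (rule injI)
    fix a b assume "M a = M b"
    then have z: "det2 (a - b) d2 = 0" "det2 d1 (a - b) = 0" by (simp_all add: M_def det2_linear)
    have "int D * fst (a - b) = det2 (a - b) d2 * fst d1 + det2 d1 (a - b) * fst d2"
      "int D * snd (a - b) = det2 (a - b) d2 * snd d1 + det2 d1 (a - b) * snd d2"
      unfolding iD det2_def by algebra+
    then show "a = b" using z D0 by (simp add: prod_eq_iff)
  qed
  define pb where "pb = (\<lambda>q. \<Sum>a\<in>lsupp q. lmono (M a) (lcoeff q a))"
  have leval_pb: "leval (pb q) w = leval q (\<mu> w)" if "w \<in> torus" for q w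
    using that by (simp add: pb_def leval_sum leval_sum_superset[of "lsupp q" q] zpow_\<mu>)
  have lcoeff_pb: "lcoeff (pb q) (M a) = lcoeff q a" if "a \<in> lsupp q" for q a
  proof -
    have "lcoeff (pb q) (M a) = (\<Sum>x\<in>lsupp q. if x = a then lcoeff q x else 0)"
      unfolding pb_def lookup_sum lookup_single by (rule sum.cong) (auto simp: when_def inj_eq[OF M_inj])
    then show ?thesis using that by simp
  qed
  have pb_mono: "card (lsupp q) = 1" if m: "card (lsupp (pb q)) = 1" for q
  proof -
    obtain k where k: "lsupp (pb q) = {k}" using m by (rule card_1_singletonE)
    have sub: "M ` lsupp q \<subseteq> {k}" unfolding k[symmetric] by (auto simp: in_keys_iff lcoeff_pb)
    have "card (M ` lsupp q) = card (lsupp q)" by (rule card_image) (rule inj_on_subset[OF M_inj], simp)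
    moreover have ne: "lsupp q \<noteq> {}"
    proof
      assume "lsupp q = {}"
      then have "pb q = 0" by (simp add: pb_def)
      then show False using m by simp
    qed
    moreover have "M ` lsupp q = {k}" using sub ne by blast
    ultimately show ?thesis by simp
  qed
  define F where "F = monom [:c2:] D + [:[:c0:] + monom c1 D:]"
  have "irreducible F" unfolding F_def by (rule fermat_irreducible[OF D0 c])
  then have prime: "prime_elem F" by (rule irreducible_imp_prime_elem)
  then have F0: "F \<noteq> 0" by auto
  have leval_f: "leval ?f (\<mu> w) = zpow w (M b) * eval2 F w" if w: "w \<in> torus" for w
    using w by (simp add: zpow_\<mu> M_add M_d zpow_add F_def poly_monom algebra_simps) (simp add: zpow_def)
  have half: "card (lsupp q) = 1"
    if P: "\<And>z. z \<in> torus \<Longrightarrow> eval2 P z = zpow z (int n, int n) * leval (pb p) z"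
      and Q: "\<And>z. z \<in> torus \<Longrightarrow> eval2 Q z = zpow z (int n, int n) * leval (pb q) z"
      and PQ: "P * Q = monom (monom 1 k1) k2 * F" and dvd: "F dvd P" for p q P Q n k1 k2
  proof -
    obtain R where R: "P = F * R" using dvd by (rule dvdE)
    have "F * (R * Q) = F * monom (monom 1 k1) k2" using PQ unfolding R by (simp add: mult_ac)
    then have RQ: "R * Q = monom (monom 1 k1) k2" using F0 by (metis mult_left_cancel)
    obtain r where r: "\<And>z. z \<in> torus \<Longrightarrow> leval r z = eval2 R z" using laurent_of_poly_ex by blast
    have "r * (lmono (int n, int n) 1 * pb q) = lmono (int k1, int k2) 1"
    proof (rule laurent_eqI)
      fix z assume z: "z \<in> torus"
      have "leval (r * (lmono (int n, int n) 1 * pb q)) z = eval2 (R * Q) z" using z by (simp add: leval_mult r Q)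
      also have "\<dots> = leval (lmono (int k1, int k2) 1) z" unfolding RQ using z by (simp add: poly_monom zpow_def)
      finally show "leval (r * (lmono (int n, int n) 1 * pb q)) z = leval (lmono (int k1, int k2) 1) z" .
    qed
    then have "card (lsupp (r * (lmono (int n, int n) 1 * pb q))) = 1" by simp
    then show ?thesis using factors_of_monomial(2) pb_mono by blast
  qed
  show ?thesis
    unfolding laurent_irreducible_def
  proof (intro allI impI)
    fix p q assume fpq: "?f = p * q"
    obtain n P Q where n: "n \<ge> nat (max \<bar>fst (M b)\<bar> \<bar>snd (M b)\<bar>)"
      and P: "\<And>z. z \<in> torus \<Longrightarrow> eval2 P z = zpow z (int n, int n) * leval (pb p) z"
      and Q: "\<And>z. z \<in> torus \<Longrightarrow> eval2 Q z = zpow z (int n, int n) * leval (pb q) z"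
      using polys_of_laurents_ex[of _ "pb p" "pb q"] by blast
    define k1 k2 where "k1 = nat (2 * int n + fst (M b))" and "k2 = nat (2 * int n + snd (M b))"
    have "\<bar>fst (M b)\<bar> \<le> int n" "\<bar>snd (M b)\<bar> \<le> int n" using n by linarith+
    then have "0 \<le> 2 * int n + fst (M b)" "0 \<le> 2 * int n + snd (M b)" by linarith+
    then have k: "M b + (int n, int n) + (int n, int n) = (int k1, int k2)"
      by (simp add: k1_def k2_def prod_eq_iff)
    have PQ: "P * Q = monom (monom 1 k1) k2 * F"
    proof (rule eval2_eqI)
      fix z assume z: "z \<in> torus"
      have "eval2 (P * Q) z = zpow z (int n, int n) * zpow z (int n, int n) * leval (p * q) (\<mu> z)"
        using z \<mu>_torus by (simp add: P Q leval_pb leval_mult)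
      also have "\<dots> = zpow z (M b + (int n, int n) + (int n, int n)) * eval2 F z"
        unfolding fpq[symmetric] leval_f[OF z] by (simp add: zpow_add z)
      also have "\<dots> = eval2 (monom (monom 1 k1) k2 * F) z"
        unfolding k by (simp add: zpow_def poly_monom)
      finally show "eval2 (P * Q) z = eval2 (monom (monom 1 k1) k2 * F) z" .
    qed
    then have "F dvd P \<or> F dvd Q" using prime by (metis dvd_triv_right prime_elem_dvd_multD)
    then show "card (lsupp p) = 1 \<or> card (lsupp q) = 1"
      using half[OF P Q PQ] half[OF Q P] PQ by (metis mult.commute)
  qed
qed

lemma trinomial_irreducible:
  assumes D: "det2 (b1 - b0) (b2 - b0) \<noteq> 0" and c: "c0 \<noteq> 0" "c1 \<noteq> 0" "c2 \<noteq> 0"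
  shows "laurent_irreducible (lmono b0 c0 + lmono b1 c1 + lmono b2 c2)"
proof (cases "det2 (b1 - b0) (b2 - b0) > 0")
  case True
  then show ?thesis using trinomial_irreducible_aux[OF True c, of b0] by simp
next
  case False
  then have "det2 (b2 - b0) (b1 - b0) > 0" using D by (simp add: det2_def algebra_simps)
  from trinomial_irreducible_aux[OF this c(1,3,2), of b0] show ?thesis by (simp add: add_ac)
qed

section \<open>Irreducibility under small perturbations\<close>

text \<open>In a factorization, the widths add up and the first factor may be normalized to have a constant term.
Then the supports of both factors are bounded in terms of the product alone, which provides the
compactness for the limit argument.\<close>

lemma factor_heights_bounded:
  assumes u: "generic_height u" and pq: "p \<noteq> 0" "q \<noteq> 0" and zero: "0 \<in> lsupp p"
    and C: "\<And>a. a \<in> lsupp (p * q) \<Longrightarrow> \<bar>u a\<bar> \<le> C" and a: "a \<in> lsupp p \<union> lsupp q"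
  shows "\<bar>u a\<bar> \<le> 2 * C"
proof -
  have bound: "v a \<le> 2 * C" if v: "generic_height v" and Cv: "\<And>a. a \<in> lsupp (p * q) \<Longrightarrow> \<bar>v a\<bar> \<le> C" for v
  proof -
    have nz: "p * q \<noteq> 0" by (rule top_height_mult(1)[OF v pq])
    have v': "generic_height (\<lambda>a. - v a)" by (rule generic_height_uminus[OF v])
    have "top_height v (p * q) \<le> C" "top_height (\<lambda>a. - v a) (p * q) \<le> C"
      using top_height_attained[OF nz, of v] top_height_attained[OF nz, of "\<lambda>a. - v a"] Cv
      by (force simp: abs_le_iff)+
    then have top: "top_height v p + top_height v q \<le> C"
      "top_height (\<lambda>a. - v a) p + top_height (\<lambda>a. - v a) q \<le> C"
      using top_height_mult(2)[OF v pq] top_height_mult(2)[OF v' pq] by linarith+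
    have "0 \<le> top_height v p" "0 \<le> top_height (\<lambda>a. - v a) p"
      using top_height_ge[OF zero, of v] top_height_ge[OF zero, of "\<lambda>a. - v a"]
      by (simp_all add: generic_height_zero[OF v])
    moreover have "0 \<le> height_width v q" by (rule height_width_nonneg[OF pq(2)])
    moreover have "v a \<le> top_height v p \<or> v a \<le> top_height v q"
      using a top_height_ge[of a p v] top_height_ge[of a q v] by blast
    ultimately show ?thesis using top unfolding height_width_def by linarith
  qed
  have "u a \<le> 2 * C" by (rule bound[OF u C])
  moreover have "- u a \<le> 2 * C" by (rule bound[OF generic_height_uminus[OF u]]) (simp add: C)
  ultimately show ?thesis by simp
qed

lemma bounded_coefficients_subsequence:
  fixes x :: "nat \<Rightarrow> 'a \<Rightarrow> complex"
  assumes "finite T" "\<And>n a. a \<in> T \<Longrightarrow> norm (x n a) \<le> 1"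
  shows "\<exists>r L. strict_mono (r :: nat \<Rightarrow> nat) \<and> (\<forall>a\<in>T. (\<lambda>n. x (r n) a) \<longlonglongrightarrow> L a)"
  using assms
proof (induction T rule: finite_induct)
  case empty
  show ?case by (intro exI[of _ id]) (simp add: strict_mono_def)
next
  case (insert a T)
  then obtain r L where r: "strict_mono r" "\<And>b. b \<in> T \<Longrightarrow> (\<lambda>n. x (r n) b) \<longlonglongrightarrow> L b" by blast
  have "\<forall>n. x (r n) a \<in> cball 0 1" using insert.prems by simp
  moreover have "seq_compact (cball (0 :: complex) 1)" by (rule compact_imp_seq_compact) (rule compact_cball)
  ultimately obtain l r' where r': "strict_mono r'" "((\<lambda>n. x (r n) a) \<circ> r') \<longlonglongrightarrow> l"
    using seq_compactE[of "cball 0 1" "\<lambda>n. x (r n) a"] by blast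
  have "(\<lambda>n. x ((r \<circ> r') n) b) \<longlonglongrightarrow> (L(a := l)) b" if "b \<in> insert a T" for b
  proof (cases "b = a")
    case True
    then show ?thesis using r'(2) by (simp add: o_def)
  next
    case False
    then have "(\<lambda>n. x (r n) b) \<longlonglongrightarrow> L b" using that r(2) by blast
    from LIMSEQ_subseq_LIMSEQ[OF this r'(1)] show ?thesis using False by (simp add: o_def)
  qed
  moreover have "strict_mono (r \<circ> r')" using r(1) r'(1) by (rule strict_mono_o)
  ultimately show ?case by blast
qed

definition coeffs_tendsto :: "(nat \<Rightarrow> laurent) \<Rightarrow> laurent \<Rightarrow> bool" where
  "coeffs_tendsto P L \<longleftrightarrow> (\<forall>a. (\<lambda>n. lcoeff (P n) a) \<longlonglongrightarrow> lcoeff L a)"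

lemma coeffs_tendsto_supp:
  assumes "coeffs_tendsto P L"
  shows "\<forall>\<^sub>F n in sequentially. lsupp L \<subseteq> lsupp (P n)"
proof -
  have "\<forall>\<^sub>F n in sequentially. \<forall>a\<in>lsupp L. lcoeff (P n) a \<noteq> 0"
  proof (rule eventually_ball_finite, simp, rule ballI)
    fix a assume "a \<in> lsupp L"
    then have "lcoeff L a \<noteq> 0" by (simp add: in_keys_iff)
    then show "\<forall>\<^sub>F n in sequentially. lcoeff (P n) a \<noteq> 0"
      using assms tendsto_imp_eventually_ne unfolding coeffs_tendsto_def by blast
  qed
  then show ?thesis by eventually_elim (auto simp: in_keys_iff)
qed

lemma coeffs_tendsto_mult:
  assumes T: "finite T" "\<And>n. lsupp (P n) \<subseteq> T" "lsupp L \<subseteq> T"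
    and lim: "coeffs_tendsto P L" "coeffs_tendsto Q M"
  shows "coeffs_tendsto (\<lambda>n. P n * Q n) (L * M)"
  unfolding coeffs_tendsto_def lcoeff_mult[OF T(1,2)] lcoeff_mult[OF T(1,3)]
  using lim unfolding coeffs_tendsto_def by (intro allI tendsto_intros) auto

text \<open>The normalization by the sum of the absolute values is preserved in the limit, which is therefore not zero.\<close>

lemma normalized_subsequence:
  assumes T: "finite T" "\<And>n. lsupp (P n) \<subseteq> T" and one: "\<And>n. (\<Sum>a\<in>T. norm (lcoeff (P n) a)) = 1"
  obtains r L where "strict_mono (r :: nat \<Rightarrow> nat)" "lsupp L \<subseteq> T" "coeffs_tendsto (\<lambda>n. P (r n)) L" "L \<noteq> 0"
proof -
  have "norm (lcoeff (P n) a) \<le> 1" if "a \<in> T" for n a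
    using member_le_sum[OF that, of "\<lambda>a. norm (lcoeff (P n) a)"] T(1) one[of n] by simp
  then obtain r l where r: "strict_mono (r :: nat \<Rightarrow> nat)" "\<And>a. a \<in> T \<Longrightarrow> (\<lambda>n. lcoeff (P (r n)) a) \<longlonglongrightarrow> l a"
    using bounded_coefficients_subsequence[OF T(1), of "\<lambda>n. lcoeff (P n)"] by blast
  define L where "L = (\<Sum>a\<in>T. lmono a (l a))"
  have L: "lcoeff L a = (if a \<in> T then l a else 0)" for a
    using T(1) by (simp add: L_def lookup_sum lookup_single when_def)
  have lim: "coeffs_tendsto (\<lambda>n. P (r n)) L"
    unfolding coeffs_tendsto_def
  proof
    fix a
    show "(\<lambda>n. lcoeff (P (r n)) a) \<longlonglongrightarrow> lcoeff L a"
    proof (cases "a \<in> T")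
      case True
      then show ?thesis using r(2) by (simp add: L)
    next
      case False
      then have "lcoeff (P n) a = 0" for n using T(2)[of n] by (metis in_keys_iff subsetD)
      then show ?thesis using False by (simp add: L)
    qed
  qed
  have "(\<lambda>n. \<Sum>a\<in>T. norm (lcoeff (P (r n)) a)) \<longlonglongrightarrow> (\<Sum>a\<in>T. norm (lcoeff L a))"
    using lim unfolding coeffs_tendsto_def by (intro tendsto_intros) blast
  then have "(\<Sum>a\<in>T. norm (lcoeff L a)) = 1" unfolding one using LIMSEQ_const_iff by metis
  then have "L \<noteq> 0" by (metis (no_types, lifting) lookup_zero norm_zero sum.neutral zero_neq_one)
  moreover have "lsupp L \<subseteq> T" by (metis L in_keys_iff subsetI)
  ultimately show ?thesis using that r lim by blast
qed

lemma height_width_monomial_mult: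
  assumes "generic_height u" "c \<noteq> 0" "f \<noteq> 0"
  shows "height_width u (lmono a c * f) = height_width u f"
proof -
  have "lmono a c \<noteq> 0" using assms(2) by (metis lookup_single_eq lookup_zero)
  moreover from this have "height_width u (lmono a c) = 0"
    using height_width_eq_0_iff[OF assms(1), of "lmono a c"] assms(2) by simp
  ultimately show ?thesis using height_width_mult[OF assms(1) _ assms(3)] by simp
qed

text \<open>If one factor degenerates to a monomial, the limit of the other one carries the whole width \<open>W\<close>. The
support can only shrink in the limit, so that factor has width at least \<open>W\<close> before the limit already and leaves
width \<open>0\<close> for its cofactor.\<close>

lemma limit_factor_monomial:
  assumes u: "generic_height u"
    and lim: "coeffs_tendsto P L" and nz: "\<And>n. P n \<noteq> 0" "\<And>n. Q n \<noteq> 0" "L \<noteq> 0" "M \<noteq> 0"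
    and f: "height_width u (L * M) = W" and w: "\<forall>\<^sub>F n in sequentially. height_width u (P n * Q n) = W"
    and mono: "card (lsupp M) = 1"
  shows "\<exists>n. card (lsupp (Q n)) = 1"
proof -
  have "height_width u M = 0" using mono nz height_width_eq_0_iff[OF u] by blast
  then have L: "height_width u L = W" using f height_width_mult[OF u nz(3,4)] by simp
  have "\<forall>\<^sub>F n in sequentially. card (lsupp (Q n)) = 1"
    using coeffs_tendsto_supp[OF lim] w
  proof eventually_elim
    case (elim n)
    have "W \<le> height_width u (P n)" using height_width_mono[OF nz(3) elim(1), of u] L by simp
    then have "height_width u (Q n) \<le> 0"
      using elim(2) height_width_mult[OF u nz(1)[of n] nz(2)[of n]] by simp
    then have "height_width u (Q n) = 0" using height_width_nonneg[OF nz(2)[of n], of u] by simp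
    then show ?case using height_width_eq_0_iff[OF u nz(2)[of n]] by blast
  qed
  then show ?thesis using eventually_happens'[OF sequentially_bot] by blast
qed

text \<open>A sequence of factorizations of \<open>F n\<close>, normalized by a monomial and a constant, has a subsequence converging
to a factorization of \<open>f\<close>, in which one of the factors is a monomial. The new exponent \<open>b\<close> lies
between exponents of \<open>f\<close> with respect to some generic height, and there the widths of \<open>F n\<close> and \<open>f\<close>
agree; so \<open>limit_factor_monomial\<close> applies.\<close>

lemma irreducible_limit:
  assumes irr: "laurent_irreducible f" and nc: "noncollinear (lsupp f)"
    and lim: "coeffs_tendsto F f" and supp: "\<And>n. lsupp f \<subseteq> lsupp (F n)" "\<And>n. lsupp (F n) \<subseteq> insert b (lsupp f)"
  shows "\<exists>n. laurent_irreducible (F n)"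
proof (rule ccontr)
  assume "\<not> ?thesis"
  then have "\<forall>n. \<exists>p q. F n = p * q \<and> card (lsupp p) \<noteq> 1 \<and> card (lsupp q) \<noteq> 1"
    by (auto simp: laurent_irreducible_def)
  then obtain p q where pq: "\<And>n. F n = p n * q n" "\<And>n. card (lsupp (p n)) \<noteq> 1" "\<And>n. card (lsupp (q n)) \<noteq> 1"
    by metis
  obtain u i j where u: "generic_height u" "i \<in> lsupp f" "j \<in> lsupp f" "u b \<le> u i" "u j \<le> u b"
    using generic_height_straddling[OF nc] by metis
  obtain v w where vw: "generic_height v" "generic_height w" "\<And>C. finite {a. \<bar>v a\<bar> \<le> C \<and> \<bar>w a\<bar> \<le> C}"
    using finite_height_box by metis
  have f0: "f \<noteq> 0" using u(2) by auto
  have F0: "F n \<noteq> 0" for n using supp(1)[of n] u(2) by auto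
  have nz: "p n \<noteq> 0" "q n \<noteq> 0" for n using F0[of n] pq(1)[of n] by auto
  define S where "S = insert b (lsupp f)"
  have S: "finite S" "S \<noteq> {}" by (simp_all add: S_def)
  define C where "C = Max ((\<lambda>a. max \<bar>v a\<bar> \<bar>w a\<bar>) ` S)"
  have C: "\<bar>v a\<bar> \<le> C" "\<bar>w a\<bar> \<le> C" if "a \<in> S" for a
  proof -
    have "max \<bar>v a\<bar> \<bar>w a\<bar> \<le> C" unfolding C_def using S that by (intro Max_ge) auto
    then show "\<bar>v a\<bar> \<le> C" "\<bar>w a\<bar> \<le> C" by auto
  qed
  define T where "T = {a. \<bar>v a\<bar> \<le> 2 * C \<and> \<bar>w a\<bar> \<le> 2 * C}"
  have T: "finite T" using vw(3) by (simp add: T_def)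
  have "lsupp (p n) \<noteq> {}" for n using nz(1) by simp
  then have "\<forall>n. \<exists>k. k \<in> lsupp (p n)" by blast
  then obtain k where k: "\<And>n. k n \<in> lsupp (p n)" by metis
  define p1 where "p1 = (\<lambda>n. lmono (- k n) 1 * p n)"
  define q1 where "q1 = (\<lambda>n. lmono (k n) 1 * q n)"
  have pq1: "p1 n * q1 n = F n" for n
  proof -
    have "p1 n * q1 n = (lmono (- k n) 1 * lmono (k n) 1) * (p n * q n)"
      unfolding p1_def q1_def by (simp only: mult_ac)
    then show ?thesis by (simp add: mult_single pq(1))
  qed
  have nz1: "p1 n \<noteq> 0" "q1 n \<noteq> 0" for n using F0[of n] pq1[of n] by auto
  have zero: "0 \<in> lsupp (p1 n)" for n using k[of n] by (simp add: p1_def in_keys_iff)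
  have CF: "\<bar>v a\<bar> \<le> C" "\<bar>w a\<bar> \<le> C" if "a \<in> lsupp (p1 n * q1 n)" for n a
    using that supp(2)[of n] C[of a] unfolding pq1 S_def by auto
  have sub: "lsupp (p1 n) \<union> lsupp (q1 n) \<subseteq> T" for n
  proof
    fix a assume a: "a \<in> lsupp (p1 n) \<union> lsupp (q1 n)"
    have "\<bar>v a\<bar> \<le> 2 * C" by (rule factor_heights_bounded[OF vw(1) nz1 zero CF(1) a])
    moreover have "\<bar>w a\<bar> \<le> 2 * C" by (rule factor_heights_bounded[OF vw(2) nz1 zero CF(2) a])
    ultimately show "a \<in> T" by (simp add: T_def)
  qed
  define N where "N = (\<lambda>g :: laurent. \<Sum>a\<in>T. norm (lcoeff g a))"
  have N: "N g > 0" if "g \<noteq> 0" "lsupp g \<subseteq> T" for g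
  proof -
    have "lsupp g \<noteq> {}" using that(1) by simp
    then obtain a where a: "a \<in> lsupp g" by blast
    then have "0 < norm (lcoeff g a)" by (simp add: in_keys_iff)
    also have "\<dots> \<le> N g" unfolding N_def using a that T by (intro member_le_sum) auto
    finally show ?thesis .
  qed
  define nrm where "nrm = (\<lambda>g. lmono 0 (of_real (1 / N g)) * g)"
  have nrm: "N (nrm g) = 1" "lsupp (nrm g) = lsupp g" if "g \<noteq> 0" "lsupp g \<subseteq> T" for g
  proof -
    have "N (nrm g) = (\<Sum>a\<in>T. norm (lcoeff (nrm g) a))" by (simp only: N_def)
    also have "\<dots> = (\<Sum>a\<in>T. norm (lcoeff g a) / N g)"
      unfolding nrm_def lcoeff_lmono_mult using N[OF that]
      by (intro sum.cong) (auto simp: norm_mult norm_divide)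
    also have "\<dots> = 1" using N[OF that] by (simp add: N_def flip: sum_divide_distrib)
    finally show "N (nrm g) = 1" .
    have "a \<in> lsupp (nrm g) \<longleftrightarrow> a \<in> lsupp g" for a
      using N[OF that] unfolding nrm_def in_keys_iff lcoeff_lmono_mult by simp
    then show "lsupp (nrm g) = lsupp g" by blast
  qed
  have subp: "lsupp (p1 n) \<subseteq> T" and subq: "lsupp (q1 n) \<subseteq> T" for n using sub[of n] by auto
  define l where "l = (\<lambda>n. complex_of_real (N (p1 n) * N (q1 n)))"
  have F_eq: "F n = lmono 0 (l n) * (nrm (p1 n) * nrm (q1 n))" for n
  proof -
    have "lmono 0 (l n) * (nrm (p1 n) * nrm (q1 n))
        = (lmono 0 (l n) * (lmono 0 (of_real (1 / N (p1 n))) * lmono 0 (of_real (1 / N (q1 n))))) * (p1 n * q1 n)"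
      unfolding nrm_def by (simp only: mult_ac)
    also have "lmono 0 (l n) * (lmono 0 (of_real (1 / N (p1 n))) * lmono 0 (of_real (1 / N (q1 n)))) = (1 :: laurent)"
      using N[OF nz1(1) subp, of n] N[OF nz1(2) subq, of n] by (simp add: mult_single l_def)
    finally show ?thesis by (simp add: pq1)
  qed
  obtain r1 L where r1: "strict_mono (r1 :: nat \<Rightarrow> nat)" "lsupp L \<subseteq> T" "coeffs_tendsto (\<lambda>n. nrm (p1 (r1 n))) L" "L \<noteq> 0"
    using normalized_subsequence[of T "\<lambda>n. nrm (p1 n)"] T nrm nz1(1) subp unfolding N_def by metis
  obtain r2 M where r2: "strict_mono (r2 :: nat \<Rightarrow> nat)" "lsupp M \<subseteq> T" "coeffs_tendsto (\<lambda>n. nrm (q1 (r1 (r2 n)))) M" "M \<noteq> 0"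
    using normalized_subsequence[of T "\<lambda>n. nrm (q1 (r1 n))"] T nrm nz1(2) subq unfolding N_def by metis
  define s where "s = r1 \<circ> r2"
  have s: "strict_mono s" unfolding s_def using r1(1) r2(1) by (rule strict_mono_o)
  define P where "P = (\<lambda>n. nrm (p1 (s n)))"
  define Q where "Q = (\<lambda>n. nrm (q1 (s n)))"
  have limP: "coeffs_tendsto P L" unfolding coeffs_tendsto_def
  proof
    fix a
    have "(\<lambda>n. lcoeff (nrm (p1 (r1 n))) a) \<longlonglongrightarrow> lcoeff L a" using r1(3) unfolding coeffs_tendsto_def by blast
    from LIMSEQ_subseq_LIMSEQ[OF this r2(1)] show "(\<lambda>n. lcoeff (P n) a) \<longlonglongrightarrow> lcoeff L a"
      by (simp add: P_def s_def o_def)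
  qed
  have limQ: "coeffs_tendsto Q M" using r2(3) by (simp add: Q_def s_def)
  have suppP: "lsupp (P n) = lsupp (p1 (s n))" and suppQ: "lsupp (Q n) = lsupp (q1 (s n))" for n
    unfolding P_def Q_def using nrm(2)[OF nz1(1) subp] nrm(2)[OF nz1(2) subq] by simp_all
  have nzPQ: "P n \<noteq> 0" "Q n \<noteq> 0" for n
  proof -
    have "lsupp (P n) \<noteq> {}" "lsupp (Q n) \<noteq> {}"
      unfolding suppP suppQ using nz1 by simp_all
    then show "P n \<noteq> 0" "Q n \<noteq> 0" by auto
  qed
  have limPQ: "coeffs_tendsto (\<lambda>n. P n * Q n) (L * M)"
    by (rule coeffs_tendsto_mult[OF T _ r1(2) limP limQ]) (simp add: suppP subp)
  have FPQ: "F (s n) = lmono 0 (l (s n)) * (P n * Q n)" for n unfolding P_def Q_def by (rule F_eq)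
  have l0: "l n \<noteq> 0" for n using N[OF nz1(1) subp, of n] N[OF nz1(2) subq, of n] by (simp add: l_def)
  have LM: "L * M \<noteq> 0" by (rule top_height_mult(1)[OF u(1) r1(4) r2(4)])
  then obtain c where c: "lcoeff (L * M) c \<noteq> 0" using poly_mapping_eqI[of "L * M" 0] by auto
  have limF: "(\<lambda>n. lcoeff (F (s n)) a) \<longlonglongrightarrow> lcoeff f a" for a
    using LIMSEQ_subseq_LIMSEQ[OF lim[unfolded coeffs_tendsto_def, rule_format, of a] s] by (simp add: o_def)
  have limPQc: "(\<lambda>n. lcoeff (P n * Q n) a) \<longlonglongrightarrow> lcoeff (L * M) a" for a
    using limPQ unfolding coeffs_tendsto_def by blast
  have coeffF: "lcoeff (F (s n)) a = l (s n) * lcoeff (P n * Q n) a" for n a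
    unfolding FPQ lcoeff_lmono_mult by simp
  define m where "m = lcoeff f c / lcoeff (L * M) c"
  have "(\<lambda>n. lcoeff (F (s n)) c / lcoeff (P n * Q n) c) \<longlonglongrightarrow> m"
    unfolding m_def by (intro tendsto_divide limF limPQc c)
  moreover have "\<forall>\<^sub>F n in sequentially. lcoeff (F (s n)) c / lcoeff (P n * Q n) c = l (s n)"
    using tendsto_imp_eventually_ne[OF limPQc[of c] c] by eventually_elim (simp add: coeffF)
  ultimately have liml: "(\<lambda>n. l (s n)) \<longlonglongrightarrow> m" by (rule Lim_transform_eventually)
  have f_eq: "f = lmono 0 m * (L * M)"
  proof (rule poly_mapping_eqI)
    fix a
    have "(\<lambda>n. lcoeff (F (s n)) a) \<longlonglongrightarrow> m * lcoeff (L * M) a"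
      unfolding coeffF by (intro tendsto_intros liml limPQc)
    then have "lcoeff f a = m * lcoeff (L * M) a" using limF LIMSEQ_unique by blast
    then show "lcoeff f a = lcoeff (lmono 0 m * (L * M)) a" by simp
  qed
  have m0: "m \<noteq> 0" using f0 f_eq by auto
  have width_f: "height_width u (L * M) = height_width u f"
    unfolding f_eq using height_width_monomial_mult[OF u(1) m0 LM] by simp
  have width_F: "height_width u (F n) = height_width u f" for n
  proof (rule antisym)
    show "height_width u f \<le> height_width u (F n)" by (rule height_width_mono[OF f0 supp(1)])
    obtain x where x: "x \<in> lsupp (F n)" "top_height u (F n) = u x" using top_height_attained[OF F0] by metis
    obtain y where y: "y \<in> lsupp (F n)" "top_height (\<lambda>a. - u a) (F n) = - u y" using top_height_attained[OF F0] by metis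
    have "x = b \<or> x \<in> lsupp f" "y = b \<or> y \<in> lsupp f" using supp(2)[of n] x y by auto
    then have "u x \<le> top_height u f" "- u y \<le> top_height (\<lambda>a. - u a) f"
      using top_height_ge[of i f u] top_height_ge[of x f u] top_height_ge[of j f "\<lambda>a. - u a"]
        top_height_ge[of y f "\<lambda>a. - u a"] u by auto
    then show "height_width u (F n) \<le> height_width u f" using x y by (simp add: height_width_def)
  qed
  have PQ0: "P n * Q n \<noteq> 0" for n by (rule top_height_mult(1)[OF u(1) nzPQ])
  have width_PQ: "height_width u (P n * Q n) = height_width u f" for n
    using width_F[of "s n"] unfolding FPQ using height_width_monomial_mult[OF u(1) l0 PQ0] by simp
  have "f = (lmono 0 m * L) * M" unfolding f_eq by (simp only: mult_ac)
  then consider "card (lsupp (lmono 0 m * L)) = 1" | "card (lsupp M) = 1"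
    using irr unfolding laurent_irreducible_def by blast
  then show False
  proof cases
    case 1
    then have L1: "card (lsupp L) = 1" by (rule factors_of_monomial)
    have "\<exists>n. card (lsupp (P n)) = 1"
      by (rule limit_factor_monomial[OF u(1) limQ nzPQ(2,1) r2(4) r1(4) _ _ L1, of "height_width u f"])
        (simp_all add: mult.commute[of M] mult.commute[of "Q _"] width_f width_PQ)
    then obtain n where "card (lsupp (p1 (s n))) = 1" unfolding suppP by blast
    then have "card (lsupp (p (s n))) = 1" unfolding p1_def by (rule factors_of_monomial)
    then show False using pq(2) by blast
  next
    case 2
    have "\<exists>n. card (lsupp (Q n)) = 1"
      by (rule limit_factor_monomial[OF u(1) limP nzPQ r1(4) r2(4) _ _ 2, of "height_width u f"])
        (simp_all add: width_f width_PQ)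
    then obtain n where "card (lsupp (q1 (s n))) = 1" unfolding suppQ by blast
    then have "card (lsupp (q (s n))) = 1" unfolding q1_def by (rule factors_of_monomial)
    then show False using pq(3) by blast
  qed
qed

section \<open>Exponents independent on an irreducible curve\<close>

text \<open>All nondegeneracy conditions on the coefficients have this form: presence of an exponent, smoothness at
\<open>(1, 1)\<close>, and nonvanishing of the edge polynomials.\<close>

definition weighted_sum :: "(int \<times> int \<Rightarrow> complex) \<Rightarrow> laurent \<Rightarrow> complex" where
  "weighted_sum w f = (\<Sum>a\<in>lsupp f. w a * lcoeff f a)"

lemma weighted_sum_superset:
  assumes "finite T" "lsupp f \<subseteq> T"
  shows "weighted_sum w f = (\<Sum>a\<in>T. w a * lcoeff f a)"
  unfolding weighted_sum_def
  by (rule sum.mono_neutral_left) (use assms in \<open>auto simp: in_keys_iff\<close>)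

lemma weighted_sum_perturb:
  assumes f: "c \<in> lsupp f"
  shows "weighted_sum w (f + lmono 0 s * (lmono b 1 - lmono c 1)) = weighted_sum w f + s * (w b - w c)"
proof -
  let ?T = "insert b (lsupp f)"
  have sub: "lsupp (f + lmono 0 s * (lmono b 1 - lmono c 1)) \<subseteq> ?T"
    using f by (auto simp: in_keys_iff lookup_add lookup_minus lookup_single when_def split: if_splits)
  have "weighted_sum w (f + lmono 0 s * (lmono b 1 - lmono c 1))
      = (\<Sum>a\<in>?T. w a * lcoeff f a + s * ((if b = a then w a else 0) - (if c = a then w a else 0)))"
    unfolding weighted_sum_superset[OF _ sub, simplified]
    by (intro sum.cong) (auto simp: lookup_add lookup_minus lookup_single when_def algebra_simps)
  also have "\<dots> = weighted_sum w f + s * (w b - w c)"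
    using f by (simp add: sum.distrib sum_distrib_left[symmetric] sum_subtractf
        weighted_sum_superset[of ?T f] subset_insertI)
  finally show ?thesis .
qed

text \<open>By \<open>irreducible_limit\<close>, no sequence \<open>s \<longlonglongrightarrow> 0\<close> consists of parameters of reducible perturbations.\<close>

lemma irreducible_perturb:
  assumes irr: "laurent_irreducible f" and nc: "noncollinear (lsupp f)" and e: "lsupp e \<subseteq> insert b (lsupp f)"
  shows "\<forall>\<^sub>F s in at 0. laurent_irreducible (f + lmono 0 s * e) \<and> lsupp f \<subseteq> lsupp (f + lmono 0 s * e)"
proof -
  define F where "F = (\<lambda>s. f + lmono 0 s * e)"
  have coeffF: "lcoeff (F s) a = lcoeff f a + s * lcoeff e a" for s a by (simp add: F_def lookup_add)
  have "\<forall>\<^sub>F s in at 0. \<forall>a\<in>lsupp f. lcoeff (F s) a \<noteq> 0"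
  proof (rule eventually_ball_finite, simp, rule ballI)
    fix a assume a: "a \<in> lsupp f"
    have "((\<lambda>s. lcoeff (F s) a) \<longlongrightarrow> lcoeff f a + 0 * lcoeff e a) (at 0)"
      unfolding coeffF by (intro tendsto_intros)
    moreover have "lcoeff f a + 0 * lcoeff e a \<noteq> 0" using a by (simp add: in_keys_iff)
    ultimately show "\<forall>\<^sub>F s in at 0. lcoeff (F s) a \<noteq> 0" by (rule tendsto_imp_eventually_ne)
  qed
  then have supp: "\<forall>\<^sub>F s in at 0. lsupp f \<subseteq> lsupp (F s)"
    by eventually_elim (auto simp: in_keys_iff)
  have supp2: "lsupp (F s) \<subseteq> insert b (lsupp f)" for s
  proof
    fix a assume "a \<in> lsupp (F s)"
    then have "a \<in> lsupp f \<or> a \<in> lsupp e" by (auto simp: in_keys_iff coeffF)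
    then show "a \<in> insert b (lsupp f)" using e by blast
  qed
  have "\<forall>\<^sub>F s in at 0. lsupp f \<subseteq> lsupp (F s) \<longrightarrow> laurent_irreducible (F s)"
  proof (rule sequentially_imp_eventually_at, intro allI impI)
    fix X :: "nat \<Rightarrow> complex" assume X: "(\<forall>n. X n \<noteq> 0) \<and> X \<longlonglongrightarrow> 0"
    show "\<forall>\<^sub>F n in sequentially. lsupp f \<subseteq> lsupp (F (X n)) \<longrightarrow> laurent_irreducible (F (X n))"
    proof (rule ccontr)
      assume "\<not> ?thesis"
      then obtain r where r: "strict_mono (r :: nat \<Rightarrow> nat)"
        "\<And>n. lsupp f \<subseteq> lsupp (F (X (r n)))" "\<And>n. \<not> laurent_irreducible (F (X (r n)))"
        using not_eventually_sequentiallyD by blast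
      have "(\<lambda>n. X (r n)) \<longlonglongrightarrow> 0" using LIMSEQ_subseq_LIMSEQ[OF _ r(1)] X by (auto simp: o_def)
      then have "(\<lambda>n. lcoeff (F (X (r n))) a) \<longlonglongrightarrow> lcoeff f a + 0 * lcoeff e a" for a
        unfolding coeffF by (intro tendsto_intros)
      then have "coeffs_tendsto (\<lambda>n. F (X (r n))) f" unfolding coeffs_tendsto_def by simp
      then show False using irreducible_limit[OF irr nc, of "\<lambda>n. F (X (r n))" b] r(2,3) supp2 by blast
    qed
  qed
  then show ?thesis using supp unfolding F_def by eventually_elim blast
qed

text \<open>Start with the trinomial with coefficients \<open>1, 1, -2\<close>, which vanishes at \<open>(1, 1)\<close>. To make one more weighted
sum nonzero, add a small multiple of \<open>z\<^sup>b - z\<^sup>c\<close>, where \<open>c\<close> is an exponent in use and the weights of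
\<open>b\<close> and \<open>c\<close> differ: this keeps the zero at \<open>(1, 1)\<close>, the irreducibility, and the sums treated before.\<close>

lemma irreducible_with_weights:
  assumes B: "finite B" "noncollinear B" and W: "finite W" 
    and w: "\<And>w. w \<in> W \<Longrightarrow> \<exists>b\<in>B. \<exists>c\<in>B. w b \<noteq> w c"
  shows "\<exists>f. lsupp f \<subseteq> B \<and> laurent_irreducible f \<and> noncollinear (lsupp f) \<and>
           weighted_sum (\<lambda>_. 1) f = 0 \<and> (\<forall>w\<in>W. weighted_sum w f \<noteq> 0)"
  using W w
proof (induction W rule: finite_induct)
  case empty
  obtain b0 b1 b2 where b: "b0 \<in> B" "b1 \<in> B" "b2 \<in> B" "det2 (b1 - b0) (b2 - b0) \<noteq> 0"
    using B(2) unfolding noncollinear_def by blast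
  define f where "f = lmono b0 1 + lmono b1 1 + lmono b2 (-2)"
  have ne: "b0 \<noteq> b1" "b0 \<noteq> b2" "b1 \<noteq> b2" using b(4) by (auto simp: det2_def)
  have supp: "lsupp f = {b0, b1, b2}"
    using ne by (auto simp: in_keys_iff f_def lookup_add lookup_single when_def split: if_splits)
  have "laurent_irreducible f" unfolding f_def by (rule trinomial_irreducible[OF b(4)]) auto
  moreover have "weighted_sum (\<lambda>_. 1) f = 0"
    unfolding weighted_sum_def supp using ne by (simp add: f_def lookup_add lookup_single when_def)
  moreover have "noncollinear (lsupp f)" unfolding supp noncollinear_def using b(4) by blast
  moreover have "lsupp f \<subseteq> B" using b supp by simp
  ultimately show ?case by (intro exI[of _ f]) simp
next
  case (insert w W)
  have "\<And>w. w \<in> W \<Longrightarrow> \<exists>b\<in>B. \<exists>c\<in>B. w b \<noteq> w c" using insert.prems by blast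
  then obtain f where f: "lsupp f \<subseteq> B" "laurent_irreducible f" "noncollinear (lsupp f)"
    "weighted_sum (\<lambda>_. 1) f = 0" "\<And>w. w \<in> W \<Longrightarrow> weighted_sum w f \<noteq> 0"
    using insert.IH by blast
  show ?case
  proof (cases "weighted_sum w f = 0")
    case False
    then show ?thesis using f by blast
  next
    case True
    obtain c where c: "c \<in> lsupp f" using f(3) unfolding noncollinear_def by blast
    obtain b where b: "b \<in> B" "w b \<noteq> w c" using insert.prems[of w] by (metis insertI1)
    define F where "F = (\<lambda>s. f + lmono 0 s * (lmono b 1 - lmono c 1))"
    have wF: "weighted_sum w' (F s) = weighted_sum w' f + s * (w' b - w' c)" for w' s
      unfolding F_def by (rule weighted_sum_perturb[OF c])
    have "lsupp (lmono b 1 - lmono c 1 :: laurent) \<subseteq> insert b (lsupp f)"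
      using c by (auto simp: in_keys_iff lookup_minus lookup_single when_def split: if_splits)
    from irreducible_perturb[OF f(2,3) this]
    have ev1: "\<forall>\<^sub>F s in at 0. laurent_irreducible (F s) \<and> lsupp f \<subseteq> lsupp (F s)" unfolding F_def .
    have ev2: "\<forall>\<^sub>F s in at 0. \<forall>w'\<in>W. weighted_sum w' (F s) \<noteq> 0"
    proof (rule eventually_ball_finite[OF insert.hyps(1)], rule ballI)
      fix w' assume w': "w' \<in> W"
      have "((\<lambda>s. weighted_sum w' (F s)) \<longlongrightarrow> weighted_sum w' f + 0 * (w' b - w' c)) (at 0)"
        unfolding wF by (intro tendsto_intros)
      moreover have "weighted_sum w' f + 0 * (w' b - w' c) \<noteq> 0" using f(5)[OF w'] by simp
      ultimately show "\<forall>\<^sub>F s in at 0. weighted_sum w' (F s) \<noteq> 0" by (rule tendsto_imp_eventually_ne)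
    qed
    have "\<forall>\<^sub>F s in at (0::complex). s \<noteq> 0" by (rule eventually_neq_at_within)
    with ev1 ev2 have "\<forall>\<^sub>F s in at 0. laurent_irreducible (F s) \<and> lsupp f \<subseteq> lsupp (F s) \<and>
        (\<forall>w'\<in>W. weighted_sum w' (F s) \<noteq> 0) \<and> s \<noteq> 0"
      by eventually_elim blast
    then obtain s where s: "laurent_irreducible (F s)" "lsupp f \<subseteq> lsupp (F s)"
      "\<And>w'. w' \<in> W \<Longrightarrow> weighted_sum w' (F s) \<noteq> 0" "s \<noteq> 0"
      using eventually_happens'[OF trivial_limit_at] by blast
    have "weighted_sum w (F s) \<noteq> 0" using True s(4) b(2) by (simp add: wF)
    moreover have "weighted_sum (\<lambda>_. 1) (F s) = 0" using f(4) by (simp add: wF)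
    moreover have "lsupp (F s) \<subseteq> B"
    proof
      fix a assume "a \<in> lsupp (F s)"
      then have "a \<in> lsupp f \<or> a = b \<or> a = c"
        by (auto simp: F_def in_keys_iff lookup_add lookup_minus lookup_single when_def split: if_splits)
      then show "a \<in> B" using f(1) b(1) c by blast
    qed
    ultimately show ?thesis using s noncollinear_mono[OF f(3) s(2)] by blast
  qed
qed

text \<open>If some \<open>v + b\<close> were outside of the convex hull of \<open>A\<close>, a generic height would separate it from \<open>A\<close>; but the
leading term of the product is at least as high.\<close>

lemma quotient_support:
  assumes A: "finite A" and g: "lsupp (f * h) \<subseteq> A" and f: "f \<noteq> 0"
  shows "lsupp h \<subseteq> conv A \<ominus>\<^sub>Z lsupp f"
proof
  fix v assume v: "v \<in> lsupp h"
  then have h: "h \<noteq> 0" by auto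
  have "to_plane (v + b) \<in> conv A" if b: "b \<in> lsupp f" for b
  proof (rule ccontr)
    assume out: "to_plane (v + b) \<notin> conv A"
    obtain w where "generic_height w" using finite_height_box by metis
    then have nz: "f * h \<noteq> 0" using top_height_mult(1) f h by blast
    then have "lsupp (f * h) \<noteq> {}" by simp
    then have "A \<noteq> {}" using g by blast
    then obtain u where u: "generic_height u" "\<And>a. a \<in> A \<Longrightarrow> u a < u (v + b)"
      using generic_height_separating[OF A _ out] by blast
    obtain a where a: "a \<in> lsupp (f * h)" "top_height u (f * h) = u a" using top_height_attained[OF nz] by metis
    have "u (v + b) = u v + u b" by (rule generic_height_add[OF u(1)])
    also have "\<dots> \<le> top_height u (f * h)"
      using top_height_mult(2)[OF u(1) f h] top_height_ge[OF v, of u] top_height_ge[OF b, of u] by linarith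
    finally show False using a u(2)[of a] g by force
  qed
  then show "v \<in> conv A \<ominus>\<^sub>Z lsupp f" by (simp add: shift_diff_def)
qed

lemma finite_shift_diff:
  assumes A: "finite A" and B: "b \<in> B"
  shows "finite (conv A \<ominus>\<^sub>Z B)"
proof -
  have "bounded (conv A)" using A by (simp add: bounded_convex_hull finite_imp_bounded)
  then obtain C where C: "\<And>x. x \<in> conv A \<Longrightarrow> norm x \<le> C" by (auto simp: bounded_iff)
  let ?I = "{-\<lceil>C\<rceil>..\<lceil>C\<rceil>} \<times> {-\<lceil>C\<rceil>..\<lceil>C\<rceil>}"
  have "v + b \<in> ?I" if "v \<in> conv A \<ominus>\<^sub>Z B" for v
  proof -
    have "norm (to_plane (v + b)) \<le> C" using that B C by (auto simp: shift_diff_def)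
    then have "\<bar>real_of_int (fst (v + b))\<bar> \<le> C" "\<bar>real_of_int (snd (v + b))\<bar> \<le> C"
      using norm_fst_le[of "real_of_int (fst (v + b))" "real_of_int (snd (v + b))"]
        norm_snd_le[of "real_of_int (snd (v + b))" "real_of_int (fst (v + b))"]
      unfolding to_plane_def real_norm_def by linarith+
    then have "real_of_int (fst (v + b)) \<le> C" "real_of_int (- fst (v + b)) \<le> C"
      "real_of_int (snd (v + b)) \<le> C" "real_of_int (- snd (v + b)) \<le> C" by linarith+
    then have "fst (v + b) \<le> \<lceil>C\<rceil>" "- fst (v + b) \<le> \<lceil>C\<rceil>" "snd (v + b) \<le> \<lceil>C\<rceil>" "- snd (v + b) \<le> \<lceil>C\<rceil>"
      by linarith+
    then show ?thesis unfolding mem_Times_iff by auto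
  qed
  then have "conv A \<ominus>\<^sub>Z B \<subseteq> (\<lambda>x. x - b) ` ?I" by (metis (no_types, lifting) add_diff_cancel_right' image_eqI subsetI)
  then show ?thesis by (rule finite_subset) simp
qed

text \<open>Remove from \<open>A\<close> the exponents that can be leading exponents of a multiple of \<open>f\<close> supported at \<open>A\<close>. They are
the sums of the leading exponent of \<open>f\<close> with elements of \<open>conv A \<ominus> lsupp f\<close>. A Laurent polynomial supported at
the remaining exponents and vanishing on the curve would be such a multiple, with an excluded leading
exponent.\<close>

lemma independent_exponents:
  assumes A: "finite A" and irr: "laurent_irreducible f" and f: "f \<noteq> 0" and W: "infinite W"
    and zeros: "\<And>x. x \<in> W \<Longrightarrow> (x, y x) \<in> torus \<and> leval f (x, y x) = 0"
  obtains A' where "A' \<subseteq> A" "card A \<le> card A' + card (conv A \<ominus>\<^sub>Z lsupp f)"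
    "\<And>c a. (\<And>x. x \<in> W \<Longrightarrow> (\<Sum>a\<in>A'. c a * zpow (x, y x) a) = 0) \<Longrightarrow> a \<in> A' \<Longrightarrow> c a = 0"
proof -
  obtain u where u: "generic_height u" using finite_height_box by metis
  obtain b where b: "b \<in> lsupp f" "top_height u f = u b" using top_height_attained[OF f] by metis
  define S where "S = conv A \<ominus>\<^sub>Z lsupp f"
  define A' where "A' = A - (+) b ` S"
  have S: "finite S" unfolding S_def by (rule finite_shift_diff[OF A b(1)])
  have "card A \<le> card (A' \<union> (+) b ` S)" using A S by (intro card_mono) (auto simp: A'_def)
  also have "\<dots> \<le> card A' + card ((+) b ` S)" by (rule card_Un_le)
  also have "card ((+) b ` S) = card S" by (intro card_image) simp
  finally have card: "card A \<le> card A' + card S" .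
  have "c a = 0" if zero: "\<And>x. x \<in> W \<Longrightarrow> (\<Sum>a\<in>A'. c a * zpow (x, y x) a) = 0" and a: "a \<in> A'" for c a
  proof -
    have A'f: "finite A'" using A by (simp add: A'_def)
    define g where "g = (\<Sum>a\<in>A'. lmono a (c a))"
    have coeff_g: "lcoeff g k = (if k \<in> A' then c k else 0)" for k
      using A'f by (simp add: g_def lookup_sum lookup_single when_def)
    have "leval g (x, y x) = 0" if "x \<in> W" for x using zero[OF that] by (simp add: g_def leval_sum)
    then obtain h where h: "g = f * h" using irreducible_dvd_if_common_zeros[OF irr W, of g] zeros by metis
    have supp_g: "lsupp g \<subseteq> A'" by (metis coeff_g in_keys_iff subsetI)
    have "g = 0"
    proof (rule ccontr)
      assume g0: "g \<noteq> 0"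
      then have h0: "h \<noteq> 0" using h by auto
      obtain k where k: "k \<in> lsupp g" "top_height u g = u k" using top_height_attained[OF g0] by metis
      obtain l where l: "l \<in> lsupp h" "top_height u h = u l" using top_height_attained[OF h0] by metis
      have "u k = u (b + l)"
        using top_height_mult(2)[OF u f h0] k b l unfolding h by (simp add: generic_height_add[OF u])
      then have "k = b + l" using generic_height_eq_iff[OF u] by blast
      moreover have "lsupp (f * h) \<subseteq> A" using supp_g unfolding h A'_def by blast
      then have "l \<in> S" using quotient_support[OF A _ f, of h] l unfolding S_def by blast
      ultimately have "k \<notin> A'" unfolding A'_def by blast
      then show False using k supp_g by blast
    qed
    then have "lcoeff g a = 0" by simp
    then show ?thesis using a by (simp add: coeff_g)
  qed
  moreover have "A' \<subseteq> A" by (auto simp: A'_def)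
  ultimately show ?thesis using that card unfolding S_def by blast
qed

section \<open>Orders of vanishing in spaces of holomorphic functions\<close>

text \<open>In contrast to \<open>zorder\<close>, this excludes functions that vanish identically.\<close>

definition has_order :: "(complex \<Rightarrow> complex) \<Rightarrow> complex \<Rightarrow> nat \<Rightarrow> bool" where
  "has_order u x k \<longleftrightarrow>
     (\<exists>r>0. \<exists>h. h holomorphic_on ball x r \<and> h x \<noteq> 0 \<and> (\<forall>w\<in>ball x r. u w = (w - x) ^ k * h w))"

lemma has_order_cong:
  assumes "has_order u x k" "r > 0" "\<And>w. w \<in> ball x r \<Longrightarrow> v w = u w"
  shows "has_order v x k"
proof -
  obtain s h where h: "s > 0" "h holomorphic_on ball x s" "h x \<noteq> 0" "\<And>w. w \<in> ball x s \<Longrightarrow> u w = (w - x) ^ k * h w"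
    using assms(1) unfolding has_order_def by blast
  have "h holomorphic_on ball x (min r s)" using h(2) by (rule holomorphic_on_subset) auto
  then show ?thesis unfolding has_order_def using h assms
    by (intro exI[of _ "min r s"] exI[of _ h]) auto
qed

lemma has_order_zorder:
  assumes "has_order u x k"
  shows "zorder u x = int k" and "\<exists>\<^sub>F w in at x. u w \<noteq> 0"
proof -
  obtain r h where h: "r > 0" "h holomorphic_on ball x r" "h x \<noteq> 0" "\<And>w. w \<in> ball x r \<Longrightarrow> u w = (w - x) ^ k * h w"
    using assms unfolding has_order_def by blast
  show "zorder u x = int k"
    by (rule zorder_eqI[OF open_ball _ h(2,3)]) (use h(1,4) in \<open>auto simp: mult.commute\<close>)
  have "isCont h x" using h(1,2) by (metis centre_in_ball holomorphic_on_imp_continuous_on continuous_on_interior interior_ball)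
  then have "\<forall>\<^sub>F w in at x. h w \<noteq> 0" using h(3) by (simp add: isCont_def tendsto_imp_eventually_ne)
  moreover have "\<forall>\<^sub>F w in at x. w \<in> ball x r" using h(1) by (intro eventually_at_in_open') auto
  moreover have "\<forall>\<^sub>F w in at x. w \<noteq> x" by (rule eventually_neq_at_within)
  ultimately have "\<forall>\<^sub>F w in at x. u w \<noteq> 0" by eventually_elim (simp add: h(4))
  then show "\<exists>\<^sub>F w in at x. u w \<noteq> 0" by (rule eventually_frequently[OF trivial_limit_at])
qed

lemma has_order_unique: "has_order u x k \<Longrightarrow> has_order u x l \<Longrightarrow> k = l"
  using has_order_zorder(1)[of u x k] has_order_zorder(1)[of u x l] by simp

lemma has_order_value: "has_order u x k \<Longrightarrow> u x = 0 \<longleftrightarrow> k > 0"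
  unfolding has_order_def by (auto simp: zero_power)

lemma has_order_0:
  assumes "u holomorphic_on ball x r" "r > 0" "u x \<noteq> 0"
  shows "has_order u x 0"
  using assms unfolding has_order_def by auto

lemma has_order_exists:
  assumes "u holomorphic_on ball x r" "r > 0" "\<exists>w\<in>ball x r. u w \<noteq> 0"
  shows "\<exists>k. has_order u x k"
proof -
  have "\<exists>s>0. cball x s \<subseteq> ball x r \<and> zor_poly u x holomorphic_on cball x s \<and>
      (\<forall>w\<in>cball x s. u w = zor_poly u x w * (w - x) ^ nat (zorder u x) \<and> zor_poly u x w \<noteq> 0)"
    using zorder_exist_zero[OF assms(1) open_ball connected_ball _ assms(3)] assms(2) by simp
  then obtain s where s: "s > 0" "zor_poly u x holomorphic_on cball x s"
    "\<And>w. w \<in> cball x s \<Longrightarrow> u w = zor_poly u x w * (w - x) ^ nat (zorder u x) \<and> zor_poly u x w \<noteq> 0" by blast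
  have "zor_poly u x holomorphic_on ball x s" using s(2) by (rule holomorphic_on_subset) auto
  then show ?thesis unfolding has_order_def using s(1,3)
    by (intro exI[of _ "nat (zorder u x)"] exI[of _ s] conjI exI[of _ "zor_poly u x"]) (auto simp: mult.commute)
qed

lemma has_order_mult:
  assumes "has_order u x k" "m holomorphic_on ball x r" "r > 0" "m x \<noteq> 0"
  shows "has_order (\<lambda>w. m w * u w) x k"
proof -
  obtain s h where h: "s > 0" "h holomorphic_on ball x s" "h x \<noteq> 0" "\<And>w. w \<in> ball x s \<Longrightarrow> u w = (w - x) ^ k * h w"
    using assms(1) unfolding has_order_def by blast
  have "(\<lambda>w. m w * h w) holomorphic_on ball x (min r s)"
    by (intro holomorphic_on_mult holomorphic_on_subset[OF assms(2)] holomorphic_on_subset[OF h(2)]) auto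
  then show ?thesis unfolding has_order_def using h assms
    by (intro exI[of _ "min r s"] conjI exI[of _ "\<lambda>w. m w * h w"]) auto
qed

lemma has_order_deriv:
  assumes "has_order u x (Suc k)"
  shows "has_order (deriv u) x k"
proof -
  obtain r h where h: "r > 0" "h holomorphic_on ball x r" "h x \<noteq> 0"
      "\<And>w. w \<in> ball x r \<Longrightarrow> u w = (w - x) ^ Suc k * h w"
    using assms unfolding has_order_def by blast
  define H where "H = (\<lambda>w. of_nat (Suc k) * h w + (w - x) * deriv h w)"
  have "H holomorphic_on ball x r" unfolding H_def using h(2) by (intro holomorphic_intros) auto
  moreover have "H x \<noteq> 0" using h(3) unfolding H_def by (simp del: of_nat_Suc)
  moreover have "deriv u w = (w - x) ^ k * H w" if w: "w \<in> ball x r" for w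
  proof -
    have "(h has_field_derivative deriv h w) (at w)" using h(2) w by (intro holomorphic_derivI) auto
    moreover have "((\<lambda>w. (w - x) ^ Suc k) has_field_derivative of_nat (Suc k) * (w - x) ^ k) (at w)"
    proof -
      have "((\<lambda>w. w - x) has_field_derivative 1) (at w)" by (auto intro!: derivative_eq_intros)
      from DERIV_power_Suc[OF this, of k] show ?thesis by simp
    qed
    ultimately have "((\<lambda>w. (w - x) ^ Suc k * h w) has_field_derivative
        of_nat (Suc k) * (w - x) ^ k * h w + deriv h w * (w - x) ^ Suc k) (at w)"
      by (intro DERIV_mult)
    also have "of_nat (Suc k) * (w - x) ^ k * h w + deriv h w * (w - x) ^ Suc k = (w - x) ^ k * H w"
      unfolding H_def by (simp only: power_Suc distrib_left mult_ac)
    finally have "((\<lambda>w. (w - x) ^ Suc k * h w) has_field_derivative (w - x) ^ k * H w) (at w)" .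
    then have "(u has_field_derivative (w - x) ^ k * H w) (at w)"
      by (rule has_field_derivative_transform_within_open[OF _ open_ball w]) (simp add: h(4))
    then show ?thesis by (rule DERIV_imp_deriv)
  qed
  ultimately show ?thesis unfolding has_order_def using h(1) by blast
qed

lemma has_order_Suc_iff_deriv:
  assumes u: "u holomorphic_on ball x r" "r > 0" "u x = 0" and d: "has_order (deriv u) x k"
  shows "has_order u x (Suc k)"
proof -
  have "\<exists>w\<in>ball x r. u w \<noteq> 0"
  proof (rule ccontr)
    assume "\<not> ?thesis"
    then have z: "\<And>w. w \<in> ball x r \<Longrightarrow> u w = 0" by blast
    have "deriv u w = 0" if "w \<in> ball x r" for w
    proof -
      have "((\<lambda>_. 0) has_field_derivative 0) (at w)" by simp
      then have "(u has_field_derivative 0) (at w)"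
        by (rule has_field_derivative_transform_within_open[OF _ open_ball that]) (simp add: z)
      then show ?thesis by (rule DERIV_imp_deriv)
    qed
    moreover have "\<exists>\<^sub>F w in at x. deriv u w \<noteq> 0" by (rule has_order_zorder(2)[OF d])
    moreover have "\<forall>\<^sub>F w in at x. w \<in> ball x r" using u(2) by (intro eventually_at_in_open') auto
    ultimately show False unfolding frequently_def by (metis (mono_tags, lifting) eventually_mono)
  qed
  then obtain l where l: "has_order u x l" using has_order_exists u by blast
  then obtain l' where l': "l = Suc l'" using has_order_value[OF l] u(3) by (cases l) auto
  have "l' = k" using has_order_unique[OF has_order_deriv d] l unfolding l' by blast
  then show ?thesis using l unfolding l' by simp
qed

text \<open>The coefficient \<open>m\<close> has no zeros, so each application of \<open>m d/dx\<close> lowers a positive order by one.\<close>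

lemma order_iff_iterated_derivation:
  assumes r: "r > 0" and m: "m holomorphic_on ball x r" "\<And>w. w \<in> ball x r \<Longrightarrow> m w \<noteq> 0"
    and v: "\<And>j. v j holomorphic_on ball x r"
    and step: "\<And>j w. w \<in> ball x r \<Longrightarrow> v (Suc j) w = m w * deriv (v j) w"
  shows "has_order (v i) x k \<longleftrightarrow> (\<forall>j<k. v (i + j) x = 0) \<and> v (i + k) x \<noteq> 0"
proof (induction k arbitrary: i)
  case 0
  show ?case using has_order_0[OF v r] has_order_value by fastforce
next
  case (Suc k)
  have "has_order (v i) x (Suc k) \<longleftrightarrow> v i x = 0 \<and> has_order (v (Suc i)) x k"
  proof
    assume o: "has_order (v i) x (Suc k)"
    have "has_order (\<lambda>w. m w * deriv (v i) w) x k"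
      by (rule has_order_mult[OF has_order_deriv[OF o] m(1) r]) (simp add: m(2) r)
    then have "has_order (v (Suc i)) x k"
      by (rule has_order_cong[OF _ r]) (rule step)
    then show "v i x = 0 \<and> has_order (v (Suc i)) x k" using has_order_value[OF o] by simp
  next
    assume a: "v i x = 0 \<and> has_order (v (Suc i)) x k"
    have "(\<lambda>w. 1 / m w) holomorphic_on ball x r" using m by (intro holomorphic_intros) auto
    then have "has_order (\<lambda>w. 1 / m w * v (Suc i) w) x k"
      using a m(2)[of x] r by (intro has_order_mult) auto
    then have "has_order (deriv (v i)) x k"
      by (rule has_order_cong[OF _ r]) (simp add: step m(2))
    then show "has_order (v i) x (Suc k)" using a by (intro has_order_Suc_iff_deriv[OF v r]) auto
  qed
  also have "\<dots> \<longleftrightarrow> v i x = 0 \<and> (\<forall>j<k. v (i + Suc j) x = 0) \<and> v (i + Suc k) x \<noteq> 0"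
    unfolding Suc.IH by simp
  also have "\<dots> \<longleftrightarrow> (\<forall>j<Suc k. v (i + j) x = 0) \<and> v (i + Suc k) x \<noteq> 0"
    by (metis (no_types, opaque_lifting) Suc_less_eq add.right_neutral not0_implies_Suc zero_less_Suc)
  finally show ?case .
qed

text \<open>This replaces the Wronskian. Near a point where \<open>u a\<close> has no zero, divide all functions by it and differentiate:
the remaining functions stay independent, because a relation between the derivatives of the
quotients is, up to a constant, a relation between the quotients. At a point provided by induction, a
combination either has order \<open>0\<close> or has order one more than the derivative of its quotient by \<open>u a\<close>.\<close>

lemma independent_functions_low_order:
  assumes "finite I" "r > 0" "\<And>i. i \<in> I \<Longrightarrow> u i holomorphic_on ball c r"
    and "\<And>\<alpha> i. (\<And>x. x \<in> ball c r \<Longrightarrow> (\<Sum>i\<in>I. \<alpha> i * u i x) = 0) \<Longrightarrow> i \<in> I \<Longrightarrow> \<alpha> i = 0"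
  shows "\<exists>x\<in>ball c r. \<forall>\<alpha>. (\<exists>i\<in>I. \<alpha> i \<noteq> 0) \<longrightarrow> (\<exists>k<card I. has_order (\<lambda>w. \<Sum>i\<in>I. \<alpha> i * u i w) x k)"
  using assms
proof (induction I arbitrary: c r u rule: finite_induct)
  case empty
  then show ?case by (intro bexI[of _ c]) auto
next
  case (insert a I)
  note indep = insert.prems(3)
  have hol: "u i holomorphic_on ball c r" if "i \<in> insert a I" for i using insert.prems(2) that by blast
  have fin: "finite I" and a: "a \<notin> I" by (rule insert.hyps)+
  have sum_upd: "(\<Sum>i\<in>insert a I. (\<alpha>(a := b)) i * u i x) = (\<Sum>i\<in>I. \<alpha> i * u i x) + b * u a x" for \<alpha> b x
    using fin a by (simp add: add.commute) (intro sum.cong, auto)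
  have "\<exists>x1\<in>ball c r. u a x1 \<noteq> 0"
  proof (rule ccontr)
    assume "\<not> ?thesis"
    then have "(\<Sum>i\<in>insert a I. ((\<lambda>_. 0)(a := 1)) i * u i x) = 0" if "x \<in> ball c r" for x
      unfolding sum_upd using that by simp
    from indep[OF this, of a] show False by simp
  qed
  then obtain x1 where x1: "x1 \<in> ball c r" "u a x1 \<noteq> 0" by blast
  have "open (ball c r \<inter> u a -` (- {0}))"
    by (rule continuous_open_preimage[OF _ open_ball]) (auto intro!: holomorphic_on_imp_continuous_on hol)
  then obtain s where s: "s > 0" "ball x1 s \<subseteq> ball c r \<inter> u a -` (- {0})"
    using x1 by (elim openE[of _ x1]) auto
  then have sub: "ball x1 s \<subseteq> ball c r" and nz: "\<And>x. x \<in> ball x1 s \<Longrightarrow> u a x \<noteq> 0" by auto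
  define \<phi> where "\<phi> = (\<lambda>i w. u i w / u a w)"
  have hol_u: "u i holomorphic_on ball x1 s" if "i \<in> insert a I" for i
    using hol[OF that] sub by (rule holomorphic_on_subset)
  have hol_quot: "\<phi> i holomorphic_on ball x1 s" if "i \<in> I" for i
    unfolding \<phi>_def using hol_u that nz by (intro holomorphic_on_divide) auto
  have D_quot: "((\<lambda>w. (\<Sum>i\<in>I. \<alpha> i * \<phi> i w) - b) has_field_derivative (\<Sum>i\<in>I. \<alpha> i * deriv (\<phi> i) w)) (at w)"
    if "w \<in> ball x1 s" for \<alpha> b w
  proof -
    have "(\<phi> i has_field_derivative deriv (\<phi> i) w) (at w)" if "i \<in> I" for i
      using hol_quot[OF that] \<open>w \<in> ball x1 s\<close> by (intro holomorphic_derivI) auto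
    then have "((\<lambda>w. (\<Sum>i\<in>I. \<alpha> i * \<phi> i w) - b) has_field_derivative (\<Sum>i\<in>I. \<alpha> i * deriv (\<phi> i) w) - 0) (at w)"
      by (intro DERIV_diff DERIV_sum DERIV_cmult DERIV_const)
    then show ?thesis by simp
  qed
  have rescale: "(\<Sum>i\<in>insert a I. (\<alpha>(a := - b)) i * u i w) = u a w * ((\<Sum>i\<in>I. \<alpha> i * \<phi> i w) - b)"
    if "w \<in> ball x1 s" for \<alpha> b w
    unfolding sum_upd \<phi>_def using nz[OF that] by (simp add: sum_distrib_left algebra_simps)
  have "\<exists>x\<in>ball x1 s. \<forall>\<alpha>. (\<exists>i\<in>I. \<alpha> i \<noteq> 0) \<longrightarrow>
      (\<exists>k<card I. has_order (\<lambda>w. \<Sum>i\<in>I. \<alpha> i * deriv (\<phi> i) w) x k)"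
  proof (rule insert.IH[OF s(1)])
    show "deriv (\<phi> i) holomorphic_on ball x1 s" if "i \<in> I" for i
      using hol_quot[OF that] by (intro holomorphic_deriv) auto
    fix \<alpha> i assume zero: "\<And>x. x \<in> ball x1 s \<Longrightarrow> (\<Sum>i\<in>I. \<alpha> i * deriv (\<phi> i) x) = 0" and i: "i \<in> I"
    have "((\<lambda>w. (\<Sum>i\<in>I. \<alpha> i * \<phi> i w) - 0) has_field_derivative 0) (at w within ball x1 s)" if "w \<in> ball x1 s" for w
      using D_quot[OF that, of \<alpha> 0] zero[OF that] by (simp add: has_field_derivative_at_within)
    from has_field_derivative_zero_constant[OF convex_ball this]
    obtain b where b: "\<And>w. w \<in> ball x1 s \<Longrightarrow> (\<Sum>i\<in>I. \<alpha> i * \<phi> i w) - 0 = b" by blast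
    have "(\<Sum>i\<in>insert a I. (\<alpha>(a := - b)) i * u i x) = 0" if x: "x \<in> ball c r" for x
    proof (rule analytic_continuation_open[where s = "ball x1 s" and s' = "ball c r" and z = x
            and f = "\<lambda>x. \<Sum>i\<in>insert a I. (\<alpha>(a := - b)) i * u i x" and g = "\<lambda>_. 0"])
      show "(\<lambda>x. \<Sum>i\<in>insert a I. (\<alpha>(a := - b)) i * u i x) holomorphic_on ball c r"
        by (intro holomorphic_intros hol)
      show "(\<Sum>i\<in>insert a I. (\<alpha>(a := - b)) i * u i z) = 0" if "z \<in> ball x1 s" for z
        unfolding rescale[OF that] using b[OF that] by simp
    qed (use s sub x in auto)
    from indep[OF this, of i] show "\<alpha> i = 0" using i a by (auto split: if_splits)
  qed
  then obtain x where x: "x \<in> ball x1 s" "\<And>\<alpha> i. i \<in> I \<Longrightarrow> \<alpha> i \<noteq> 0 \<Longrightarrow>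
      \<exists>k<card I. has_order (\<lambda>w. \<Sum>i\<in>I. \<alpha> i * deriv (\<phi> i) w) x k" by blast
  obtain t where t: "t > 0" "ball x t \<subseteq> ball x1 s" using x(1) by (rule openE[OF open_ball])
  have "\<exists>k<card (insert a I). has_order (\<lambda>w. \<Sum>i\<in>insert a I. \<alpha> i * u i w) x k"
    if \<alpha>: "\<exists>i\<in>insert a I. \<alpha> i \<noteq> 0" for \<alpha>
  proof -
    define \<Phi> where "\<Phi> = (\<lambda>w. (\<Sum>i\<in>I. \<alpha> i * \<phi> i w) - (- \<alpha> a))"
    have hol_\<Phi>: "\<Phi> holomorphic_on ball x t"
      unfolding \<Phi>_def by (intro holomorphic_intros holomorphic_on_subset[OF hol_quot t(2)])
    have "\<exists>k<card (insert a I). has_order \<Phi> x k"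
    proof (cases "\<Phi> x = 0")
      case False
      then show ?thesis using has_order_0[OF hol_\<Phi> t(1)] fin a by (intro exI[of _ 0]) simp
    next
      case True
      have "\<exists>i\<in>I. \<alpha> i \<noteq> 0"
      proof (rule ccontr)
        assume "\<not> ?thesis"
        then show False using True \<alpha> by (simp add: \<Phi>_def)
      qed
      then obtain k where k: "k < card I" "has_order (\<lambda>w. \<Sum>i\<in>I. \<alpha> i * deriv (\<phi> i) w) x k"
        using x(2) by blast
      have "has_order (deriv \<Phi>) x k"
        by (rule has_order_cong[OF k(2) t(1)]) (unfold \<Phi>_def, rule DERIV_imp_deriv, rule D_quot, use t(2) in blast)
      then have "has_order \<Phi> x (Suc k)"
        by (rule has_order_Suc_iff_deriv[OF hol_\<Phi> t(1) True])
      then show ?thesis using k(1) fin a by (intro exI[of _ "Suc k"]) simp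
    qed
    then obtain k where k: "k < card (insert a I)" "has_order \<Phi> x k" by blast
    have "has_order (\<lambda>w. u a w * \<Phi> w) x k"
      by (rule has_order_mult[OF k(2) holomorphic_on_subset[OF hol_u t(2)] t(1) nz[OF x(1)]]) simp
    then have "has_order (\<lambda>w. \<Sum>i\<in>insert a I. (\<alpha>(a := - (- \<alpha> a))) i * u i w) x k"
      by (rule has_order_cong[OF _ t(1)]) (unfold \<Phi>_def, rule rescale, use t(2) in blast)
    then show ?thesis using k(1) by auto
  qed
  then show ?case using x(1) sub by blast
qed

section \<open>Branches of a curve and the tangent vector field\<close>

text \<open>With \<open>w\<close> a coordinate of the exponent this is the logarithmic partial derivative \<open>z\<^sub>i \<partial>f/\<partial>z\<^sub>i\<close>,
which stays inside the Laurent polynomials with the same support.\<close>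

definition log_deriv :: "(int \<times> int \<Rightarrow> int) \<Rightarrow> laurent \<Rightarrow> complex \<times> complex \<Rightarrow> complex" where
  "log_deriv w f z = (\<Sum>a\<in>lsupp f. of_int (w a) * lcoeff f a * zpow z a)"

lemma zpow_has_derivative:
  assumes z: "z \<in> torus"
  shows "((\<lambda>z. zpow z a) has_derivative
     (\<lambda>h. zpow z a * (of_int (fst a) * fst h / fst z + of_int (snd a) * snd h / snd z))) (at z)"
proof -
  have nz: "fst z \<noteq> 0" "snd z \<noteq> 0" using z by (auto simp: torus_def)
  have p: "((\<lambda>w. w powi n) has_derivative (\<lambda>h. (of_int n * w powi (n - 1)) * h)) (at w)" if "w \<noteq> 0" for n and w :: complex
    using that by (intro has_field_derivative_imp_has_derivative) (auto intro!: derivative_eq_intros)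
  have d1: "((\<lambda>z. fst z powi n) has_derivative (\<lambda>h. (of_int n * fst z powi (n - 1)) * fst h)) (at z)" for n
    using has_derivative_compose[OF has_derivative_fst[OF has_derivative_ident] p[OF nz(1)]] by simp
  have d2: "((\<lambda>z. snd z powi n) has_derivative (\<lambda>h. (of_int n * snd z powi (n - 1)) * snd h)) (at z)" for n
    using has_derivative_compose[OF has_derivative_snd[OF has_derivative_ident] p[OF nz(2)]] by simp
  have "fst z powi (fst a - 1) = fst z powi fst a / fst z" "snd z powi (snd a - 1) = snd z powi snd a / snd z"
    using nz by (simp_all add: power_int_diff)
  then show ?thesis unfolding zpow_def
    by (intro has_derivative_eq_rhs[OF has_derivative_mult[OF d1 d2]]) (auto simp: fun_eq_iff algebra_simps)
qed

lemma leval_has_derivative: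
  assumes z: "z \<in> torus"
  shows "(leval f has_derivative (\<lambda>h. log_deriv fst f z / fst z * fst h + log_deriv snd f z / snd z * snd h)) (at z)"
proof -
  have "((\<lambda>z. \<Sum>a\<in>lsupp f. lcoeff f a * zpow z a) has_derivative
      (\<lambda>h. \<Sum>a\<in>lsupp f. lcoeff f a * (zpow z a * (of_int (fst a) * fst h / fst z + of_int (snd a) * snd h / snd z)))) (at z)"
    by (intro has_derivative_sum has_derivative_mult_right zpow_has_derivative[OF z])
  moreover have "leval f = (\<lambda>z. \<Sum>a\<in>lsupp f. lcoeff f a * zpow z a)"
    by (rule ext, rule leval_sum_superset) auto
  moreover have "(\<Sum>a\<in>lsupp f. lcoeff f a * (zpow z a * (of_int (fst a) * fst h / fst z + of_int (snd a) * snd h / snd z)))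
      = log_deriv fst f z / fst z * fst h + log_deriv snd f z / snd z * snd h" for h
    unfolding log_deriv_def sum_divide_distrib sum_distrib_right sum.distrib[symmetric]
    by (intro sum.cong) (auto simp: algebra_simps)
  ultimately show ?thesis by simp
qed

lemma open_torus: "open torus"
proof -
  have "torus = (- {0}) \<times> (- {0 :: complex})" by (auto simp: torus_def)
  moreover have "open ((- {0 :: complex}) \<times> (- {0 :: complex}))" by (intro open_Times open_Compl) auto
  ultimately show ?thesis by metis
qed

lemma continuous_on_zpow: "continuous_on torus (\<lambda>z. zpow z a)"
  by (rule has_derivative_continuous_on) (rule has_derivative_at_withinI, rule zpow_has_derivative)

lemma continuous_on_log_deriv: "continuous_on torus (log_deriv w f)"
  unfolding log_deriv_def by (intro continuous_intros continuous_on_zpow)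

text \<open>A piece of the curve that is a graph over the first coordinate. The value of the derivative is
the one given by implicit differentiation.\<close>

definition branch :: "laurent \<Rightarrow> complex \<Rightarrow> real \<Rightarrow> (complex \<Rightarrow> complex) \<Rightarrow> bool" where
  "branch f c r y \<longleftrightarrow> r > 0 \<and> (\<forall>x\<in>ball c r. (x, y x) \<in> zero_locus f \<and> log_deriv snd f (x, y x) \<noteq> 0 \<and>
     (y has_field_derivative - (log_deriv fst f (x, y x) * y x) / (x * log_deriv snd f (x, y x))) (at x))"

text \<open>The inverse function theorem for \<open>(x, y) \<mapsto> (x, f(x, y))\<close>, as a map of real vector spaces. The derivative of the
inverse, restricted to the first coordinate, is multiplication by a complex number, so the
implicit function is holomorphic.\<close>

lemma branch_exists:
  assumes p: "p \<in> zero_locus f" and smooth: "log_deriv snd f p \<noteq> 0"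
  obtains r y where "branch f (fst p) r y" "y (fst p) = snd p"
proof -
  define F where "F = (\<lambda>z. (fst z, leval f z))"
  define fx where "fx = (\<lambda>z. log_deriv fst f z / fst z)"
  define fy where "fy = (\<lambda>z. log_deriv snd f z / snd z)"
  have cont: "continuous_on torus fx" "continuous_on torus fy"
    unfolding fx_def fy_def by (intro continuous_intros continuous_on_log_deriv; auto simp: torus_def)+
  define L where "L = (\<lambda>z h. (fst h, fx z * fst h + fy z * snd h))"
  have blL: "bounded_linear (L z)" for z
    unfolding L_def by (intro bounded_linear_Pair bounded_linear_add bounded_linear_fst bounded_linear_snd
        bounded_linear_const_mult)
  define F' where "F' = (\<lambda>z. Blinfun (L z))"
  have F': "blinfun_apply (F' z) = L z" for z unfolding F'_def using blL by (rule bounded_linear_Blinfun_apply)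
  define K where "K = (\<lambda>h. (fst h, (snd h - fx p * fst h) / fy p))"
  have blK: "bounded_linear K"
    unfolding K_def by (intro bounded_linear_Pair bounded_linear_sub bounded_linear_fst bounded_linear_snd
        bounded_linear_const_mult bounded_linear_compose[OF bounded_linear_divide])
  have pt: "p \<in> torus" "leval f p = 0" using p by (auto simp: zero_locus_def)
  have fyp: "fy p \<noteq> 0" using smooth pt by (simp add: fy_def torus_def)
  have "Blinfun K o\<^sub>L F' p = id_blinfun"
    using fyp by (intro blinfun_eqI) (simp add: F' bounded_linear_Blinfun_apply[OF blK], simp add: K_def L_def)
  moreover have "(F has_derivative blinfun_apply (F' z)) (at z)" if "z \<in> torus" for z
    unfolding F' F_def L_def fx_def fy_def
    by (intro has_derivative_Pair leval_has_derivative[OF that] has_derivative_fst has_derivative_ident)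
  moreover have "continuous_on torus F'"
    by (rule continuous_on_blinfun_componentwise) (simp add: F' L_def, intro continuous_intros cont)
  ultimately obtain U V g g' where UV: "open U" "U \<subseteq> torus" "p \<in> U" "open V" "F p \<in> V" "homeomorphism U V F g"
    and g': "\<And>y. y \<in> V \<Longrightarrow> (g has_derivative g' y) (at y)" "\<And>y. y \<in> V \<Longrightarrow> g' y = inv_into UNIV (L (g y))"
      "\<And>y. y \<in> V \<Longrightarrow> bij (L (g y))"
    using inverse_function_theorem[OF open_torus, of F F' p "Blinfun K"] pt(1) unfolding F' by metis
  define y where "y = (\<lambda>x. snd (g (x, 0)))"
  have Fp: "F p = (fst p, 0)" by (simp add: F_def pt)
  have gp: "g (fst p, 0) = p" using homeomorphism_apply1[OF UV(6,3)] by (simp add: Fp)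
  have "open ((\<lambda>x. (x, 0)) -` V)" by (intro open_vimage UV(4) continuous_intros)
  moreover have "fst p \<in> (\<lambda>x. (x, 0)) -` V" using UV(5) Fp by simp
  ultimately obtain r where r: "r > 0" "ball (fst p) r \<subseteq> (\<lambda>x. (x, 0)) -` V" by (rule openE)
  have "(x, y x) \<in> zero_locus f \<and> log_deriv snd f (x, y x) \<noteq> 0 \<and>
     (y has_field_derivative - (log_deriv fst f (x, y x) * y x) / (x * log_deriv snd f (x, y x))) (at x)"
    if x: "x \<in> ball (fst p) r" for x
  proof -
    have xV: "(x, 0) \<in> V" using x r by auto
    define z where "z = g (x, 0)"
    have "z \<in> U" using homeomorphism_image2[OF UV(6)] xV z_def by blast
    then have zt: "z \<in> torus" using UV by auto
    have "F z = (x, 0)" unfolding z_def by (rule homeomorphism_apply2[OF UV(6) xV])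
    then have z: "fst z = x" "leval f z = 0" by (auto simp: F_def)
    have zy: "z = (x, y x)" using z(1) by (simp add: z_def y_def prod_eq_iff)
    have fyz: "fy z \<noteq> 0"
    proof
      assume "fy z = 0"
      then have "L z (0, 1) = L z (0, 0)" by (simp add: L_def)
      then show False using g'(3)[OF xV] by (auto simp: z_def[symmetric] bij_def dest: injD)
    qed
    have inv_L: "snd (g' (x, 0) (h, 0)) = - (fx z / fy z) * h" for h
    proof -
      obtain h' k where hk: "g' (x, 0) (h, 0) = (h', k)" by force
      have "L z (g' (x, 0) (h, 0)) = (h, 0)"
        unfolding g'(2)[OF xV] z_def by (rule surj_f_inv_f[OF bij_is_surj[OF g'(3)[OF xV]]])
      then have "h' = h" "fx z * h' + fy z * k = 0" unfolding hk by (auto simp: L_def)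
      then show ?thesis unfolding hk using fyz by (simp add: field_simps add_eq_0_iff)
    qed
    have pair: "((\<lambda>x. (x, 0 :: complex)) has_derivative (\<lambda>h. (h, 0))) (at x)" by (intro derivative_intros)
    have "((\<lambda>x. g (x, 0)) has_derivative (\<lambda>h. g' (x, 0) (h, 0))) (at x)"
      using has_derivative_compose[OF pair, of g "g' (x, 0)"] g'(1)[OF xV] by simp
    then have "(y has_derivative (\<lambda>h. snd (g' (x, 0) (h, 0)))) (at x)"
      unfolding y_def by (rule has_derivative_snd)
    then have "(y has_field_derivative - (fx z / fy z)) (at x)"
      unfolding inv_L has_field_derivative_def by (rule has_derivative_eq_rhs) (simp add: fun_eq_iff)
    moreover have "- (fx z / fy z) = - (log_deriv fst f (x, y x) * y x) / (x * log_deriv snd f (x, y x))"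
      using fyz unfolding fx_def fy_def zy by simp
    moreover have "log_deriv snd f z \<noteq> 0" using fyz by (auto simp: fy_def)
    ultimately show ?thesis using zt z zy by (auto simp: zero_locus_def)
  qed
  then have "branch f (fst p) r y" using r(1) unfolding branch_def by blast
  moreover have "y (fst p) = snd p" by (simp add: y_def gp)
  ultimately show ?thesis by (rule that)
qed

lemma branch_torus: "branch f c r y \<Longrightarrow> x \<in> ball c r \<Longrightarrow> (x, y x) \<in> torus"
  by (simp add: branch_def zero_locus_def)

lemma branch_subset:
  assumes "branch f c r y" "ball d s \<subseteq> ball c r" "s > 0"
  shows "branch f d s y"
  using assms unfolding branch_def by blast

text \<open>The values of \<open>\<delta>\<^sup>j z\<^sup>a\<close>, where \<open>\<delta>\<close> is the vector field \<open>\<theta>\<^sub>2 f \<theta>\<^sub>1 - \<theta>\<^sub>1 f \<theta>\<^sub>2\<close> with the logarithmic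
derivatives \<open>\<theta>\<^sub>i = z\<^sub>i \<partial>/\<partial>z\<^sub>i\<close>. It annihilates \<open>f\<close> and maps \<open>z\<^sup>a\<close> to the sum of
\<open>f\<^sub>b det(a, b) z\<^bsup>a + b\<^esup>\<close>, which gives the recursion. The sum runs over \<open>B\<close> rather than the support of \<open>f\<close> to make the
value visibly polynomial in the coefficients.\<close>

fun tangent_iter :: "(int \<times> int) set \<Rightarrow> laurent \<Rightarrow> nat \<Rightarrow> int \<times> int \<Rightarrow> complex \<times> complex \<Rightarrow> complex" where
  "tangent_iter B f 0 a z = zpow z a"
| "tangent_iter B f (Suc j) a z = (\<Sum>b\<in>B. lcoeff f b * of_int (det2 a b) * tangent_iter B f j (a + b) z)"

text \<open>On a branch, \<open>\<delta>\<close> acts as \<open>x \<theta>\<^sub>2 f d/dx\<close>.\<close>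

lemma tangent_iter_has_derivative:
  assumes B: "finite B" "lsupp f \<subseteq> B" and br: "branch f c r y" and x: "x \<in> ball c r"
  shows "((\<lambda>x. tangent_iter B f j a (x, y x)) has_field_derivative
     tangent_iter B f (Suc j) a (x, y x) / (x * log_deriv snd f (x, y x))) (at x)"
proof (induction j arbitrary: a)
  case 0
  let ?z = "(x, y x)"
  have z: "?z \<in> torus" by (rule branch_torus[OF br x])
  then have nz: "x \<noteq> 0" "y x \<noteq> 0" by (auto simp: torus_def)
  define D where "D = - (log_deriv fst f ?z * y x) / (x * log_deriv snd f ?z)"
  have s: "log_deriv snd f ?z \<noteq> 0" and D: "(y has_field_derivative D) (at x)"
    using br x by (auto simp: branch_def D_def)
  have "((\<lambda>x. (x, y x)) has_derivative (\<lambda>h. (h, D * h))) (at x)"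
    using D by (intro has_derivative_Pair has_derivative_ident) (simp add: has_field_derivative_def)
  from has_derivative_compose[OF this zpow_has_derivative[OF z]]
  have "((\<lambda>x. zpow (x, y x) a) has_derivative
      (\<lambda>h. zpow ?z a * (of_int (fst a) * h / x + of_int (snd a) * (D * h) / y x))) (at x)" by simp
  then have "((\<lambda>x. zpow (x, y x) a) has_field_derivative
      zpow ?z a * (of_int (fst a) / x + of_int (snd a) * D / y x)) (at x)"
    unfolding has_field_derivative_def by (rule has_derivative_eq_rhs) (simp add: fun_eq_iff algebra_simps)
  also have "zpow ?z a * (of_int (fst a) / x + of_int (snd a) * D / y x)
      = zpow ?z a * (of_int (fst a) * log_deriv snd f ?z - of_int (snd a) * log_deriv fst f ?z) / (x * log_deriv snd f ?z)"
    unfolding D_def using nz s by (simp add: field_simps)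
  also have "zpow ?z a * (of_int (fst a) * log_deriv snd f ?z - of_int (snd a) * log_deriv fst f ?z)
      = (\<Sum>b\<in>lsupp f. lcoeff f b * of_int (det2 a b) * zpow ?z (a + b))"
    unfolding log_deriv_def sum_distrib_left sum_subtractf[symmetric]
    by (intro sum.cong) (simp_all add: zpow_add[OF z] det2_def algebra_simps)
  also have "\<dots> = (\<Sum>b\<in>B. lcoeff f b * of_int (det2 a b) * zpow ?z (a + b))"
    by (rule sum.mono_neutral_left) (use B in \<open>auto simp: in_keys_iff\<close>)
  finally show ?case by simp
next
  case (Suc j)
  have "((\<lambda>x. \<Sum>b\<in>B. lcoeff f b * of_int (det2 a b) * tangent_iter B f j (a + b) (x, y x)) has_field_derivative
      (\<Sum>b\<in>B. lcoeff f b * of_int (det2 a b) * (tangent_iter B f (Suc j) (a + b) (x, y x) / (x * log_deriv snd f (x, y x))))) (at x)"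
    by (intro DERIV_sum DERIV_cmult Suc.IH)
  then show ?case
    unfolding tangent_iter.simps(2)[of B f "Suc j" a] tangent_iter.simps(2)[of B f j a]
    by (simp add: sum_divide_distrib del: tangent_iter.simps)
qed

lemma order_on_branch_iff:
  assumes B: "finite B" "lsupp f \<subseteq> B" and br: "branch f c r y" and x: "x \<in> ball c r"
  shows "has_order (\<lambda>x. \<Sum>a\<in>A. \<alpha> a * zpow (x, y x) a) x k \<longleftrightarrow>
     (\<forall>j<k. (\<Sum>a\<in>A. \<alpha> a * tangent_iter B f j a (x, y x)) = 0) \<and> (\<Sum>a\<in>A. \<alpha> a * tangent_iter B f k a (x, y x)) \<noteq> 0"
proof -
  obtain s where s: "s > 0" "ball x s \<subseteq> ball c r" using x by (rule openE[OF open_ball])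
  have br': "branch f x s y" by (rule branch_subset[OF br s(2,1)])
  define v where "v = (\<lambda>j x. \<Sum>a\<in>A. \<alpha> a * tangent_iter B f j a (x, y x))"
  define m where "m = (\<lambda>x. x * log_deriv snd f (x, y x))"
  have nz: "m w \<noteq> 0" if "w \<in> ball x s" for w
    using br' branch_torus[OF br' that] that by (auto simp: m_def branch_def torus_def)
  have Dv: "(v j has_field_derivative v (Suc j) w / m w) (at w)" if w: "w \<in> ball x s" for j w
  proof -
    have "(v j has_field_derivative (\<Sum>a\<in>A. \<alpha> a * (tangent_iter B f (Suc j) a (w, y w) / m w))) (at w)"
      unfolding v_def m_def by (intro DERIV_sum DERIV_cmult tangent_iter_has_derivative[OF B br' w])
    then show ?thesis by (simp add: v_def sum_divide_distrib del: tangent_iter.simps)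
  qed
  have hol_v: "v j holomorphic_on ball x s" for j
    unfolding holomorphic_on_open[OF open_ball] using Dv by blast
  have hol_y: "y holomorphic_on ball x s"
    unfolding holomorphic_on_open[OF open_ball] using br' by (auto simp: branch_def)
  have hol_m: "m holomorphic_on ball x s"
    unfolding m_def log_deriv_def zpow_def fst_conv snd_conv
    by (intro holomorphic_intros hol_y) (use branch_torus[OF br'] in \<open>auto simp: torus_def\<close>)
  have "has_order (v 0) x k \<longleftrightarrow> (\<forall>j<k. v (0 + j) x = 0) \<and> v (0 + k) x \<noteq> 0"
  proof (rule order_iff_iterated_derivation[OF s(1) hol_m nz hol_v])
    show "v (Suc j) w = m w * deriv (v j) w" if "w \<in> ball x s" for j w
      using DERIV_imp_deriv[OF Dv[OF that, of j]] nz[OF that] by simp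
  qed
  then show ?thesis by (simp add: v_def)
qed

lemma meets_if_order_on_branch:
  assumes br: "branch f (fst p) r y" and yp: "y (fst p) = snd p"
    and A: "finite A" and ord: "has_order (\<lambda>x. \<Sum>a\<in>A. \<alpha> a * zpow (x, y x) a) (fst p) k"
  shows "meets_with_multiplicity (\<Sum>a\<in>A. lmono a (\<alpha> a)) f p (int k)"
proof -
  let ?g = "\<Sum>a\<in>A. lmono a (\<alpha> a)"
  have r: "r > 0" and p: "p \<in> zero_locus f" "log_deriv snd f p \<noteq> 0"
    using br yp by (auto simp: branch_def dest!: bspec[of _ _ "fst p"])
  then have pt: "p \<in> torus" by (simp add: zero_locus_def)
  have "((\<lambda>w. (fst p, w)) has_derivative (\<lambda>h. (0, h))) (at (snd p))" by (intro derivative_intros)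
  from has_derivative_compose[OF this, of "leval f"
      "\<lambda>h. log_deriv fst f p / fst p * fst h + log_deriv snd f p / snd p * snd h"] leval_has_derivative[OF pt, of f]
  have "((\<lambda>w. leval f (fst p, w)) has_derivative (\<lambda>h. log_deriv snd f p / snd p * h)) (at (snd p))" by simp
  then have "((\<lambda>w. leval f (fst p, w)) has_field_derivative log_deriv snd f p / snd p) (at (snd p))"
    unfolding has_field_derivative_def by (rule has_derivative_eq_rhs) (simp add: fun_eq_iff)
  then have "deriv (\<lambda>w. leval f (fst p, w)) (snd p) \<noteq> 0"
    using p(2) pt by (simp add: DERIV_imp_deriv torus_def)
  then have smooth: "smooth_point f p" using p(1) by (simp add: smooth_point_def)
  define X where "X = (\<lambda>t. fst p + t)"
  define Y where "Y = (\<lambda>t. y (fst p + t))"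
  have shift: "fst p + t \<in> ball (fst p) r \<longleftrightarrow> t \<in> ball 0 r" for t by (simp add: dist_norm)
  have hol_y: "y holomorphic_on ball (fst p) r"
    unfolding holomorphic_on_open[OF open_ball] using br by (auto simp: branch_def)
  have "Y holomorphic_on ball 0 r"
    unfolding Y_def using shift
    by (intro holomorphic_on_compose_gen[OF _ hol_y, unfolded o_def] holomorphic_intros) auto
  then have "Y analytic_on {0}" unfolding analytic_at using r by (intro exI[of _ "ball 0 r"]) auto
  moreover have "X analytic_on {0}" unfolding X_def by (intro analytic_intros)
  moreover have "deriv X 0 = 1" unfolding X_def by (intro DERIV_imp_deriv derivative_eq_intros) auto
  moreover have "\<forall>\<^sub>F t in nhds 0. (X t, Y t) \<in> zero_locus f"
  proof -
    have "\<forall>\<^sub>F t in nhds 0. t \<in> ball 0 r" using r by (intro eventually_nhds_in_open) auto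
    then show ?thesis
    proof eventually_elim
      case (elim t)
      then have "fst p + t \<in> ball (fst p) r" by (simp only: shift)
      then show ?case using br unfolding branch_def X_def Y_def by blast
    qed
  qed
  ultimately have par: "local_parametrization f p X Y"
    using yp by (simp add: local_parametrization_def X_def Y_def)
  obtain s h where h: "s > 0" "h holomorphic_on ball (fst p) s" "h (fst p) \<noteq> 0"
      "\<And>w. w \<in> ball (fst p) s \<Longrightarrow> (\<Sum>a\<in>A. \<alpha> a * zpow (w, y w) a) = (w - fst p) ^ k * h w"
    using ord unfolding has_order_def by blast
  have "(\<lambda>t. h (fst p + t)) holomorphic_on ball 0 s"
    by (intro holomorphic_on_compose_gen[OF _ h(2), unfolded o_def] holomorphic_intros) (auto simp: dist_norm)
  then have "has_order (\<lambda>t. leval ?g (X t, Y t)) 0 k"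
    unfolding has_order_def using h
    by (intro exI[of _ s] conjI exI[of _ "\<lambda>t. h (fst p + t)"]) (auto simp: leval_sum X_def Y_def dist_norm)
  from has_order_zorder[OF this] show ?thesis
    unfolding meets_with_multiplicity_def using smooth par by blast
qed

section \<open>Elimination over rings of functions\<close>

text \<open>Polynomial and Laurent polynomial dependence on parameters is used only through closure under ring
operations, so rings of functions serve instead of polynomial rings.\<close>

definition function_ring :: "('s \<Rightarrow> complex) set \<Rightarrow> bool" where
  "function_ring R \<longleftrightarrow> (\<forall>c. (\<lambda>_. c) \<in> R) \<and>
     (\<forall>F\<in>R. \<forall>G\<in>R. (\<lambda>s. F s + G s) \<in> R \<and> (\<lambda>s. F s * G s) \<in> R)"

lemma function_ring_const: "function_ring R \<Longrightarrow> (\<lambda>_. c) \<in> R"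
  and function_ring_add: "function_ring R \<Longrightarrow> F \<in> R \<Longrightarrow> G \<in> R \<Longrightarrow> (\<lambda>s. F s + G s) \<in> R"
  and function_ring_mult: "function_ring R \<Longrightarrow> F \<in> R \<Longrightarrow> G \<in> R \<Longrightarrow> (\<lambda>s. F s * G s) \<in> R"
  unfolding function_ring_def by blast+

lemma function_ring_diff:
  assumes "function_ring R" "F \<in> R" "G \<in> R"
  shows "(\<lambda>s. F s - G s) \<in> R"
  using function_ring_add[OF assms(1,2) function_ring_mult[OF assms(1) function_ring_const[OF assms(1), of "-1"] assms(3)]]
  by simp

lemma function_ring_sum:
  assumes R: "function_ring R" and F: "\<And>i. i \<in> I \<Longrightarrow> F i \<in> R"
  shows "(\<lambda>s. \<Sum>i\<in>I. F i s) \<in> R"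
  using F
proof (induction I rule: infinite_finite_induct)
  case (insert i I)
  then have "(\<lambda>s. F i s + (\<Sum>i\<in>I. F i s)) \<in> R" by (intro function_ring_add[OF R]) auto
  then show ?case using insert.hyps by simp
qed (use function_ring_const[OF R] in auto)

text \<open>Gaussian elimination without divisions, so that all entries stay in the ring. The pivot is
chosen to be nonzero at \<open>s\<^sub>0\<close>, and \<open>\<rho>\<close> is the product of the successive pivots.\<close>

lemma solvable_near_nonsingular:
  fixes M :: "'i \<Rightarrow> 'j \<Rightarrow> 's \<Rightarrow> complex"
  assumes R: "function_ring R" and J: "finite J" "finite I" "card I = card J"
    and M: "\<And>i j. i \<in> I \<Longrightarrow> j \<in> J \<Longrightarrow> M i j \<in> R"
    and nonsing: "\<And>v j. (\<And>i. i \<in> I \<Longrightarrow> (\<Sum>j\<in>J. M i j s0 * v j) = 0) \<Longrightarrow> j \<in> J \<Longrightarrow> v j = 0"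
  shows "\<exists>\<rho>\<in>R. \<rho> s0 \<noteq> 0 \<and> (\<forall>s. \<rho> s \<noteq> 0 \<longrightarrow> (\<forall>e. \<exists>v. \<forall>i\<in>I. (\<Sum>j\<in>J. M i j s * v j) = e i))"
  using J M nonsing
proof (induction J arbitrary: I M rule: finite_induct)
  case empty
  then show ?case using function_ring_const[OF R, of 1] by (intro bexI[of _ "\<lambda>_. 1"]) auto
next
  case (insert j J)
  note nonsing = insert.prems(4) and M = insert.prems(3)
  have J: "finite J" "j \<notin> J" by (rule insert.hyps)+
  have split_sum: "(\<Sum>k\<in>insert j J. M i k s * (v(j := b)) k) = M i j s * b + (\<Sum>k\<in>J. M i k s * v k)" for i s v b
    using J by simp (intro sum.cong, auto)
  have "\<exists>r\<in>I. M r j s0 \<noteq> 0"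
  proof (rule ccontr)
    assume "\<not> ?thesis"
    then have "(\<Sum>k\<in>insert j J. M i k s0 * ((\<lambda>_. 0)(j := 1)) k) = 0" if "i \<in> I" for i
      unfolding split_sum using that by simp
    from nonsing[OF this, of j] show False by simp
  qed
  then obtain r where r: "r \<in> I" "M r j s0 \<noteq> 0" by blast
  define M' where "M' = (\<lambda>i k s. M r j s * M i k s - M i j s * M r k s)"
  have sum_M': "(\<Sum>k\<in>J. M' i k s * v k) = M r j s * (\<Sum>k\<in>J. M i k s * v k) - M i j s * (\<Sum>k\<in>J. M r k s * v k)" for i s v
    unfolding M'_def by (simp add: sum_distrib_left sum_subtractf algebra_simps)
  have "\<exists>\<rho>\<in>R. \<rho> s0 \<noteq> 0 \<and> (\<forall>s. \<rho> s \<noteq> 0 \<longrightarrow> (\<forall>e. \<exists>v. \<forall>i\<in>I - {r}. (\<Sum>k\<in>J. M' i k s * v k) = e i))"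
  proof (rule insert.IH)
    show "finite (I - {r})" using insert.prems(1) by simp
    show "card (I - {r}) = card J" using insert.prems(1,2) J r by simp
    show "M' i k \<in> R" if "i \<in> I - {r}" "k \<in> J" for i k
      unfolding M'_def using that r M
      by (intro function_ring_diff[OF R] function_ring_mult[OF R]) auto
    fix v k assume zero: "\<And>i. i \<in> I - {r} \<Longrightarrow> (\<Sum>k\<in>J. M' i k s0 * v k) = 0" and k: "k \<in> J"
    \<comment> \<open>The entry for the eliminated column that satisfies the pivot row.\<close>
    define b where "b = - (\<Sum>k\<in>J. M r k s0 * v k) / M r j s0"
    have "(\<Sum>k\<in>insert j J. M i k s0 * (v(j := b)) k) = 0" if i: "i \<in> I" for i
    proof (cases "i = r")
      case True
      then show ?thesis unfolding split_sum b_def using r by simp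
    next
      case False
      then show ?thesis unfolding split_sum b_def using zero[of i] i r
        unfolding sum_M' by (simp add: field_simps)
    qed
    from nonsing[OF this, of k] show "v k = 0" using k J by (auto split: if_splits)
  qed
  then obtain \<rho> where \<rho>: "\<rho> \<in> R" "\<rho> s0 \<noteq> 0"
    "\<And>s e. \<rho> s \<noteq> 0 \<Longrightarrow> \<exists>v. \<forall>i\<in>I - {r}. (\<Sum>k\<in>J. M' i k s * v k) = e i" by blast
  have "\<exists>v. \<forall>i\<in>I. (\<Sum>k\<in>insert j J. M i k s * v k) = e i" if s: "M r j s * \<rho> s \<noteq> 0" for s e
  proof -
    have nz: "M r j s \<noteq> 0" "\<rho> s \<noteq> 0" using s by auto
    obtain v where v: "\<And>i. i \<in> I - {r} \<Longrightarrow> (\<Sum>k\<in>J. M' i k s * v k) = M r j s * e i - M i j s * e r"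
      using \<rho>(3)[OF nz(2), of "\<lambda>i. M r j s * e i - M i j s * e r"] by blast
    define b where "b = (e r - (\<Sum>k\<in>J. M r k s * v k)) / M r j s"
    have "(\<Sum>k\<in>insert j J. M i k s * (v(j := b)) k) = e i" if i: "i \<in> I" for i
    proof (cases "i = r")
      case True
      then show ?thesis unfolding split_sum b_def using nz by simp
    next
      case False
      then show ?thesis unfolding split_sum b_def using v[of i] i nz
        unfolding sum_M' by (simp add: field_simps)
    qed
    then show ?thesis by blast
  qed
  moreover have "(\<lambda>s. M r j s * \<rho> s) \<in> R" using r M \<rho>(1) by (intro function_ring_mult[OF R]) auto
  ultimately show ?case using r(2) \<rho>(2) by (intro bexI[of _ "\<lambda>s. M r j s * \<rho> s"]) auto
qed

text \<open>The Laurent polynomials in one more variable \<open>w\<close>, as functions. Only the values for \<open>w \<noteq> 0\<close> matter, since at \<open>w = 0\<close>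
the power laws for negative exponents fail.\<close>

inductive_set laurent_ext :: "('s \<Rightarrow> complex) set \<Rightarrow> ('s \<times> complex \<Rightarrow> complex) set"
  for R :: "('s \<Rightarrow> complex) set" where
  mono: "c \<in> R \<Longrightarrow> (\<And>s w. w \<noteq> 0 \<Longrightarrow> F (s, w) = c s * w powi k) \<Longrightarrow> F \<in> laurent_ext R"
| add: "F \<in> laurent_ext R \<Longrightarrow> G \<in> laurent_ext R \<Longrightarrow>
    (\<And>s w. w \<noteq> 0 \<Longrightarrow> H (s, w) = F (s, w) + G (s, w)) \<Longrightarrow> H \<in> laurent_ext R"

lemma laurent_ext_mult:
  assumes R: "function_ring R" and F: "F \<in> laurent_ext R" and G: "G \<in> laurent_ext R"
  shows "(\<lambda>p. F p * G p) \<in> laurent_ext R"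
  using F
proof induction
  case (mono c F k)
  note F = mono.hyps
  from G show ?case
  proof induction
    case (mono d G l)
    show ?case
      by (rule laurent_ext.mono[OF function_ring_mult[OF R F(1) mono.hyps(1)], of _ "k + l"])
        (simp add: F(2) mono.hyps(2) power_int_add)
  next
    case (add G G' H)
    show ?case by (rule laurent_ext.add[OF add.IH]) (simp add: add.hyps(3) algebra_simps)
  qed
next
  case (add F F' H)
  show ?case by (rule laurent_ext.add[OF add.IH]) (simp add: add.hyps(3) algebra_simps)
qed

lemma function_ring_laurent_ext:
  assumes R: "function_ring R"
  shows "function_ring (laurent_ext R)"
  unfolding function_ring_def
proof (intro conjI allI ballI)
  show "(\<lambda>_. c) \<in> laurent_ext R" for c
    by (rule laurent_ext.mono[OF function_ring_const[OF R, of c], of _ 0]) simp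
  fix F G assume FG: "F \<in> laurent_ext R" "G \<in> laurent_ext R"
  show "(\<lambda>s. F s + G s) \<in> laurent_ext R" by (rule laurent_ext.add[OF FG]) simp
  show "(\<lambda>s. F s * G s) \<in> laurent_ext R" by (rule laurent_ext_mult[OF R FG])
qed

lemma laurent_ext_normal_form:
  assumes R: "function_ring R" and F: "F \<in> laurent_ext R"
  obtains K c where "finite K" "\<And>k. c k \<in> R" "\<And>s w. w \<noteq> 0 \<Longrightarrow> F (s, w) = (\<Sum>k\<in>K. c k s * w powi k)"
proof -
  from F have "\<exists>K c. finite K \<and> (\<forall>k. c k \<in> R) \<and> (\<forall>s w. w \<noteq> 0 \<longrightarrow> F (s, w) = (\<Sum>k\<in>K. c k s * w powi k))"
  proof induction
    case (mono c F k)
    then show ?case by (intro exI[of _ "{k}"] exI[of _ "\<lambda>_. c"]) simp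
  next
    case (add F G H)
    obtain K c where F: "finite K" "\<And>k. c k \<in> R" "\<And>s w. w \<noteq> 0 \<Longrightarrow> F (s, w) = (\<Sum>k\<in>K. c k s * w powi k)"
      using add.IH(1) by blast
    obtain L d where G: "finite L" "\<And>k. d k \<in> R" "\<And>s w. w \<noteq> 0 \<Longrightarrow> G (s, w) = (\<Sum>k\<in>L. d k s * w powi k)"
      using add.IH(2) by blast
    define c' where "c' = (\<lambda>k. if k \<in> K then c k else (\<lambda>_. 0))"
    define d' where "d' = (\<lambda>k. if k \<in> L then d k else (\<lambda>_. 0))"
    have R': "c' k \<in> R" "d' k \<in> R" for k using F(2) G(2) function_ring_const[OF R] by (simp_all add: c'_def d'_def)
    have "H (s, w) = (\<Sum>k\<in>K \<union> L. (c' k s + d' k s) * w powi k)" if w: "w \<noteq> 0" for s w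
    proof -
      have "(\<Sum>k\<in>K. c k s * w powi k) = (\<Sum>k\<in>K \<union> L. c' k s * w powi k)"
        by (rule sum.mono_neutral_cong_left) (use F G in \<open>auto simp: c'_def\<close>)
      moreover have "(\<Sum>k\<in>L. d k s * w powi k) = (\<Sum>k\<in>K \<union> L. d' k s * w powi k)"
        by (rule sum.mono_neutral_cong_left) (use F G in \<open>auto simp: d'_def\<close>)
      ultimately show ?thesis
        by (simp add: add.hyps(3)[OF w] F(3)[OF w] G(3)[OF w] sum.distrib distrib_right)
    qed
    then show ?case using F(1) G(1) function_ring_add[OF R R']
      by (intro exI[of _ "K \<union> L"] exI[of _ "\<lambda>k s. c' k s + d' k s"]) auto
  qed
  then show ?thesis using that by blast
qed

text \<open>Take for \<open>\<rho>\<close> a coefficient that does not vanish at \<open>s\<^sub>0\<close>.\<close>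

lemma laurent_ext_finite_zeros:
  assumes R: "function_ring R" and F: "F \<in> laurent_ext R" and nz: "w0 \<noteq> 0" "F (s0, w0) \<noteq> 0"
  obtains \<rho> where "\<rho> \<in> R" "\<rho> s0 \<noteq> 0" "\<And>s. \<rho> s \<noteq> 0 \<Longrightarrow> finite {w. w \<noteq> 0 \<and> F (s, w) = 0}"
proof -
  obtain K c where K: "finite K" "\<And>k. c k \<in> R" "\<And>s w. w \<noteq> 0 \<Longrightarrow> F (s, w) = (\<Sum>k\<in>K. c k s * w powi k)"
    using laurent_ext_normal_form[OF R F] by metis
  have "\<exists>k\<in>K. c k s0 \<noteq> 0"
  proof (rule ccontr)
    assume "\<not> ?thesis"
    then have "F (s0, w0) = 0" unfolding K(3)[OF nz(1)] by (intro sum.neutral) simp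
    then show False using nz by blast
  qed
  then obtain k where k: "k \<in> K" "c k s0 \<noteq> 0" by blast
  have "finite {w. w \<noteq> 0 \<and> F (s, w) = 0}" if "c k s \<noteq> 0" for s
  proof (rule ccontr)
    assume inf: "infinite {w. w \<noteq> 0 \<and> F (s, w) = 0}"
    have "c k s = 0"
      by (rule power_int_independent[OF K(1) inf _ _ k(1), where c = "\<lambda>k. c k s"]) (auto simp: K(3))
    then show False using that by blast
  qed
  then show ?thesis using that K(2) k(2) by blast
qed

lemma coprime_if_no_common_root:
  fixes p q :: "complex poly"
  assumes "p \<noteq> 0" "\<And>w. poly p w = 0 \<Longrightarrow> poly q w \<noteq> 0"
  shows "coprime p q"
proof (rule coprimeI)
  fix d assume d: "d dvd p" "d dvd q"
  show "is_unit d"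
  proof (cases "degree d = 0")
    case True
    then obtain a where "d = [:a:]" by (rule degree_eq_zeroE)
    moreover have "d \<noteq> 0" using d(1) assms(1) by auto
    ultimately show ?thesis by (simp add: is_unit_const_poly_iff dvd_field_iff)
  next
    case False
    then have "\<not> constant (poly d)" by (simp add: constant_degree)
    then obtain w where "poly d w = 0" using fundamental_theorem_of_algebra by blast
    then have "poly p w = 0" "poly q w = 0" using d by (auto elim!: dvdE)
    then show ?thesis using assms(2) by blast
  qed
qed

text \<open>The matrix is the Sylvester matrix, that is, the matrix of \<open>(U, V) \<mapsto> U P + V Q\<close> on polynomials of bounded degrees.
It is nonsingular at \<open>s\<^sub>0\<close>, as the polynomials are coprime there and the first one has full
degree. Wherever it is nonsingular, \<open>1\<close> is a combination of the two polynomials.\<close>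

lemma eliminate_polynomial:
  assumes R: "function_ring R" and f: "\<And>i. f i \<in> R" and g: "\<And>i. g i \<in> R"
    and lead: "f m s0 \<noteq> (0 :: complex)"
    and coprime: "\<And>w. (\<Sum>i\<le>m. f i s0 * w ^ i) = 0 \<Longrightarrow> (\<Sum>i\<le>n. g i s0 * w ^ i) \<noteq> 0"
  obtains \<rho> where "\<rho> \<in> R" "\<rho> s0 \<noteq> 0"
    "\<And>s w. \<rho> s \<noteq> 0 \<Longrightarrow> (\<Sum>i\<le>m. f i s * w ^ i) = 0 \<Longrightarrow> (\<Sum>i\<le>n. g i s * w ^ i) \<noteq> 0"
proof -
  \<comment> \<open>One more column than necessary, so that the constant polynomial \<open>1\<close> can be reached even if \<open>m = n = 0\<close>.\<close>
  define N where "N = Suc n"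
  define P where "P = (\<lambda>s. \<Sum>i\<le>m. monom (f i s) i)"
  define Q where "Q = (\<lambda>s. \<Sum>i\<le>n. monom (g i s) i)"
  have coeffP: "coeff (P s) i = (if i \<le> m then f i s else 0)" for s i by (simp add: P_def coeff_sum)
  have coeffQ: "coeff (Q s) i = (if i \<le> n then g i s else 0)" for s i by (simp add: Q_def coeff_sum)
  have polyP: "poly (P s) w = (\<Sum>i\<le>m. f i s * w ^ i)" for s w by (simp add: P_def poly_sum poly_monom)
  have polyQ: "poly (Q s) w = (\<Sum>i\<le>n. g i s * w ^ i)" for s w by (simp add: Q_def poly_sum poly_monom)
  have degP: "degree (P s) \<le> m" for s by (rule degree_le) (simp add: coeffP)
  have degQ: "degree (Q s) \<le> n" for s by (rule degree_le) (simp add: coeffQ)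
  have degP0: "degree (P s0) = m" using degP lead by (intro antisym le_degree) (simp_all add: coeffP)
  define I where "I = {..<m + N}"
  define J :: "(nat + nat) set" where "J = {..<N} <+> {..<m}"
  define M where "M = (\<lambda>r j s. case j of Inl j \<Rightarrow> coeff (monom 1 j * P s) r | Inr j \<Rightarrow> coeff (monom 1 j * Q s) r)"
  define U where "U = (\<lambda>v :: nat + nat \<Rightarrow> complex. \<Sum>j<N. monom (v (Inl j)) j)"
  define V where "V = (\<lambda>v :: nat + nat \<Rightarrow> complex. \<Sum>j<m. monom (v (Inr j)) j)"
  have sum_J: "(\<Sum>j\<in>J. M r j s * v j) = coeff (U v * P s + V v * Q s) r" for r s v
  proof -
    have "(\<Sum>j\<in>J. M r j s * v j) = (\<Sum>j<N. coeff (monom 1 j * P s) r * v (Inl j)) + (\<Sum>j<m. coeff (monom 1 j * Q s) r * v (Inr j))"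
      unfolding J_def by (subst sum.Plus) (simp_all add: M_def)
    also have "\<dots> = coeff (U v * P s + V v * Q s) r"
    proof -
      have scale: "coeff (monom a j * p) r = coeff (monom 1 j * p) r * a" for a :: complex and j p
        by (simp add: coeff_monom_mult)
      show ?thesis unfolding U_def V_def coeff_add sum_distrib_right coeff_sum
        by (simp only: scale[of "v _"])
    qed
    finally show ?thesis .
  qed
  have deg: "degree (U v * P s + V v * Q s) < m + N" for v s
  proof -
    have "degree (U v) \<le> N - 1" unfolding U_def
      by (intro degree_sum_le) (auto intro: order.trans[OF degree_monom_le])
    then have "degree (U v * P s) < m + N"
      using degree_mult_le[of "U v" "P s"] degP[of s] by (simp add: N_def)
    moreover have "degree (V v * Q s) < m + N"
    proof (cases "m = 0")
      case True
      then show ?thesis by (simp add: V_def N_def)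
    next
      case False
      have "degree (V v) \<le> m - 1" unfolding V_def
        by (intro degree_sum_le) (auto intro: order.trans[OF degree_monom_le])
      then show ?thesis using degree_mult_le[of "V v" "Q s"] degQ[of s] False by (simp add: N_def)
    qed
    ultimately show ?thesis by (rule degree_add_less)
  qed
  have "\<exists>\<rho>\<in>R. \<rho> s0 \<noteq> 0 \<and> (\<forall>s. \<rho> s \<noteq> 0 \<longrightarrow> (\<forall>e. \<exists>v. \<forall>i\<in>I. (\<Sum>j\<in>J. M i j s * v j) = e i))"
  proof (rule solvable_near_nonsingular[OF R])
    show "finite J" "finite I" "card I = card J" by (simp_all add: I_def J_def card_Plus)
    show "M r j \<in> R" for r j
    proof -
      have "(\<lambda>s. coeff (P s) i) \<in> R" "(\<lambda>s. coeff (Q s) i) \<in> R" for i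
        using f g function_ring_const[OF R, of 0]
        by (cases "i \<le> m"; cases "i \<le> n"; simp add: coeffP coeffQ)+
      then have "(\<lambda>s. coeff (monom 1 i * P s) r) \<in> R" "(\<lambda>s. coeff (monom 1 i * Q s) r) \<in> R" for i
        using function_ring_const[OF R, of 0] by (cases "r < i"; simp add: coeff_monom_mult)+
      then show ?thesis by (cases j) (auto simp: M_def)
    qed
    fix v j assume zero: "\<And>i. i \<in> I \<Longrightarrow> (\<Sum>j\<in>J. M i j s0 * v j) = 0" and j: "j \<in> J"
    have "coeff (U v * P s0 + V v * Q s0) r = 0" for r
    proof (cases "r < m + N")
      case True
      then show ?thesis using zero[of r] unfolding sum_J I_def by simp
    next
      case False
      then show ?thesis using deg[of v s0] by (intro coeff_eq_0) simp
    qed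
    then have UV: "U v * P s0 + V v * Q s0 = 0" by (intro poly_eqI) simp
    have P0: "P s0 \<noteq> 0" using lead coeffP[of s0 m] by auto
    have cop: "coprime (P s0) (Q s0)"
      by (rule coprime_if_no_common_root[OF P0]) (use coprime in \<open>simp add: polyP polyQ\<close>)
    have "V v * Q s0 = P s0 * (- U v)" using UV by (simp add: add_eq_0_iff mult.commute)
    then have "P s0 dvd V v * Q s0" by simp
    then have dvd: "P s0 dvd V v" using cop by (simp add: coprime_dvd_mult_left_iff)
    have V0: "V v = 0"
    proof (rule ccontr)
      assume ne: "V v \<noteq> 0"
      then have "m \<noteq> 0" by (cases m) (simp_all add: V_def)
      have "degree (V v) \<le> m - 1" unfolding V_def
        by (intro degree_sum_le) (auto intro: order.trans[OF degree_monom_le])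
      then show False using dvd_imp_degree_le[OF dvd ne] degP0 \<open>m \<noteq> 0\<close> by simp
    qed
    then have U0: "U v = 0" using UV P0 by simp
    show "v j = 0"
    proof (cases j)
      case (Inl i)
      then have "v j = coeff (U v) i" using j by (auto simp: U_def coeff_sum J_def)
      then show ?thesis using U0 by simp
    next
      case (Inr i)
      then have "v j = coeff (V v) i" using j by (auto simp: V_def coeff_sum J_def)
      then show ?thesis using V0 by simp
    qed
  qed
  then obtain \<rho> where \<rho>: "\<rho> \<in> R" "\<rho> s0 \<noteq> 0"
    "\<And>s e. \<rho> s \<noteq> 0 \<Longrightarrow> \<exists>v. \<forall>i\<in>I. (\<Sum>j\<in>J. M i j s * v j) = e i" by blast
  have "(\<Sum>i\<le>n. g i s * w ^ i) \<noteq> 0" if s: "\<rho> s \<noteq> 0" and w: "(\<Sum>i\<le>m. f i s * w ^ i) = 0" for s w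
  proof
    assume w': "(\<Sum>i\<le>n. g i s * w ^ i) = 0"
    obtain v where v: "\<And>i. i \<in> I \<Longrightarrow> (\<Sum>j\<in>J. M i j s * v j) = (if i = 0 then 1 else 0)"
      using \<rho>(3)[OF s, of "\<lambda>i. if i = 0 then 1 else 0"] by blast
    have "U v * P s + V v * Q s = 1"
    proof (rule poly_eqI)
      fix r
      show "coeff (U v * P s + V v * Q s) r = coeff 1 r"
      proof (cases "r < m + N")
        case True
        then show ?thesis using v[of r] unfolding sum_J by (simp add: I_def coeff_1)
      next
        case False
        then have "coeff (U v * P s + V v * Q s) r = 0" using deg[of v s] by (intro coeff_eq_0) simp
        then show ?thesis using False by (simp add: N_def coeff_1)
      qed
    qed
    then have "poly (U v * P s + V v * Q s) w = 1" by simp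
    then show False using w w' by (simp add: polyP polyQ)
  qed
  then show ?thesis using that \<rho> by blast
qed

text \<open>Multiplying by powers of \<open>w\<close> reduces this to ordinary polynomials. The conditions on both extreme coefficients
prevent a common root from moving in from \<open>0\<close> or from infinity when \<open>s\<close> varies.\<close>

lemma eliminate_laurent:
  assumes R: "function_ring R" and K: "finite K" "K \<noteq> {}" and c: "\<And>k. c k \<in> R" and G: "G \<in> laurent_ext R"
    and ends: "c (Min K) s0 \<noteq> 0" "c (Max K) s0 \<noteq> 0"
    and coprime: "\<And>w. w \<noteq> 0 \<Longrightarrow> (\<Sum>k\<in>K. c k s0 * w powi k) = 0 \<Longrightarrow> G (s0, w) \<noteq> 0"
  obtains \<rho> where "\<rho> \<in> R" "\<rho> s0 \<noteq> 0"
    "\<And>s w. \<rho> s \<noteq> 0 \<Longrightarrow> w \<noteq> 0 \<Longrightarrow> (\<Sum>k\<in>K. c k s * w powi k) = 0 \<Longrightarrow> G (s, w) \<noteq> 0"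
proof -
  have poly_form: "\<exists>m f. (\<forall>i. f i \<in> R) \<and> (\<forall>s. f 0 s = d l s) \<and> (\<forall>s. f m s = d h s) \<and>
      (\<forall>s w. w \<noteq> 0 \<longrightarrow> (\<Sum>i\<le>m. f i s * w ^ i) = w powi (- l) * (\<Sum>k\<in>L. d k s * w powi k))"
    if L: "finite L" "l \<in> L" "h \<in> L" "\<And>k. k \<in> L \<Longrightarrow> l \<le> k \<and> k \<le> h" and d: "\<And>k. d k \<in> R" for L d l h
  proof -
    define f where "f = (\<lambda>i. if l + int i \<in> L then d (l + int i) else (\<lambda>_. 0))"
    define m where "m = nat (h - l)"
    have lh: "l \<le> h" using L by blast
    have "(\<Sum>i\<le>m. f i s * w ^ i) = w powi (- l) * (\<Sum>k\<in>L. d k s * w powi k)" if w: "w \<noteq> 0" for s w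
    proof -
      have "(\<Sum>k\<in>L. d k s * w powi (k - l)) = (\<Sum>k\<in>(\<lambda>i. l + int i) ` {..m}. f (nat (k - l)) s * w ^ nat (k - l))"
      proof (rule sum.mono_neutral_cong_left)
        show "L \<subseteq> (\<lambda>i. l + int i) ` {..m}"
        proof
          fix k assume "k \<in> L"
          then have "l \<le> k" "k \<le> h" using L(4) by auto
          then show "k \<in> (\<lambda>i. l + int i) ` {..m}" by (intro image_eqI[of _ _ "nat (k - l)"]) (auto simp: m_def)
        qed
        show "d k s * w powi (k - l) = f (nat (k - l)) s * w ^ nat (k - l)" if "k \<in> L" for k
          using L(4)[OF that] that by (simp add: f_def power_int_def)
      qed (auto simp: f_def)
      also have "\<dots> = (\<Sum>i\<le>m. f i s * w ^ i)" by (subst sum.reindex) (auto intro: inj_onI)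
      finally show ?thesis using w
        by (simp add: power_int_diff power_int_minus sum_distrib_left field_simps)
    qed
    moreover have "f 0 s = d l s" "f m s = d h s" for s using L lh by (simp_all add: f_def m_def)
    moreover have "f i \<in> R" for i using d function_ring_const[OF R] by (simp add: f_def)
    ultimately show ?thesis by blast
  qed
  have "Min K \<in> K" "Max K \<in> K" "\<And>k. k \<in> K \<Longrightarrow> Min K \<le> k \<and> k \<le> Max K" using K by auto
  from poly_form[where d = c, OF K(1) this c] obtain m f where f: "\<And>i. f i \<in> R" "\<And>s. f 0 s = c (Min K) s" "\<And>s. f m s = c (Max K) s"
    "\<And>s w. w \<noteq> 0 \<Longrightarrow> (\<Sum>i\<le>m. f i s * w ^ i) = w powi (- Min K) * (\<Sum>k\<in>K. c k s * w powi k)" by blast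
  obtain L d where L: "finite L" "\<And>k. d k \<in> R" "\<And>s w. w \<noteq> 0 \<Longrightarrow> G (s, w) = (\<Sum>k\<in>L. d k s * w powi k)"
    using laurent_ext_normal_form[OF R G] by metis
  define L' where "L' = insert 0 L"
  define d' where "d' = (\<lambda>k. if k \<in> L then d k else (\<lambda>_. 0))"
  have L': "finite L'" "L' \<noteq> {}" "\<And>k. d' k \<in> R" using L function_ring_const[OF R] by (auto simp: L'_def d'_def)
  have G': "G (s, w) = (\<Sum>k\<in>L'. d' k s * w powi k)" if "w \<noteq> 0" for s w
    unfolding L(3)[OF that] by (rule sum.mono_neutral_cong_left) (use L in \<open>auto simp: L'_def d'_def\<close>)
  have "Min L' \<in> L'" "Max L' \<in> L'" "\<And>k. k \<in> L' \<Longrightarrow> Min L' \<le> k \<and> k \<le> Max L'" using L' by auto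
  from poly_form[where d = d', OF L'(1) this L'(3)] obtain n g where g: "\<And>i. g i \<in> R"
    "\<And>s w. w \<noteq> 0 \<Longrightarrow> (\<Sum>i\<le>n. g i s * w ^ i) = w powi (- Min L') * (\<Sum>k\<in>L'. d' k s * w powi k)" by blast
  have zf: "(\<Sum>i\<le>m. f i s * w ^ i) = 0 \<longleftrightarrow> (\<Sum>k\<in>K. c k s * w powi k) = 0" if "w \<noteq> 0" for s w
    unfolding f(4)[OF that] using that by simp
  have zg: "(\<Sum>i\<le>n. g i s * w ^ i) = 0 \<longleftrightarrow> G (s, w) = 0" if "w \<noteq> 0" for s w
    unfolding g(2)[OF that] G'[OF that] using that by simp
  have cop: "(\<Sum>i\<le>n. g i s0 * w ^ i) \<noteq> 0" if w: "(\<Sum>i\<le>m. f i s0 * w ^ i) = 0" for w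
  proof -
    have "w \<noteq> 0"
    proof
      assume "w = 0"
      then have "(\<Sum>i\<le>m. f i s0 * w ^ i) = f 0 s0" by (simp add: power_0_left sum.delta if_distrib cong: if_cong)
      then show False using w f(2) ends(1) by simp
    qed
    then show ?thesis using coprime w zf zg by blast
  qed
  have lead: "f m s0 \<noteq> 0" using f(3) ends(2) by simp
  from eliminate_polynomial[of R f g m s0 n, OF R f(1) g(1) lead cop]
  obtain \<rho> where \<rho>: "\<rho> \<in> R" "\<rho> s0 \<noteq> 0"
    "\<And>s w. \<rho> s \<noteq> 0 \<Longrightarrow> (\<Sum>i\<le>m. f i s * w ^ i) = 0 \<Longrightarrow> (\<Sum>i\<le>n. g i s * w ^ i) \<noteq> 0" by blast
  have "G (s, w) \<noteq> 0" if "\<rho> s \<noteq> 0" "w \<noteq> 0" "(\<Sum>k\<in>K. c k s * w powi k) = 0" for s w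
    using \<rho>(3)[OF that(1), of w] zf[OF that(2)] zg[OF that(2)] that(3) by blast
  then show ?thesis using that \<rho>(1,2) by blast
qed

section \<open>Generic finiteness\<close>

lemma function_ring_coeff_polys: "function_ring (coeff_polys B)"
  unfolding function_ring_def by (blast intro: coeff_polys.intros)

text \<open>Functions of a pair \<open>(f, z)\<close> that are polynomial in the coefficients of \<open>f\<close> and Laurent in \<open>z\<close>.\<close>

inductive_set torus_polys :: "(int \<times> int) set \<Rightarrow> (laurent \<times> complex \<times> complex \<Rightarrow> complex) set"
  for B :: "(int \<times> int) set" where
  const: "(\<lambda>_. c) \<in> torus_polys B"
| coord: "b \<in> B \<Longrightarrow> (\<lambda>s. lcoeff (fst s) b) \<in> torus_polys B"
| zpow: "(\<lambda>s. zpow (snd s) a) \<in> torus_polys B"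
| add: "F \<in> torus_polys B \<Longrightarrow> G \<in> torus_polys B \<Longrightarrow> (\<lambda>s. F s + G s) \<in> torus_polys B"
| mult: "F \<in> torus_polys B \<Longrightarrow> G \<in> torus_polys B \<Longrightarrow> (\<lambda>s. F s * G s) \<in> torus_polys B"

lemma function_ring_torus_polys: "function_ring (torus_polys B)"
  unfolding function_ring_def by (blast intro: torus_polys.intros)

lemma tangent_iter_torus_poly: "(\<lambda>s. tangent_iter B (fst s) j a (snd s)) \<in> torus_polys B"
proof (induction j arbitrary: a)
  case 0
  show ?case by (simp add: torus_polys.zpow)
next
  case (Suc j)
  show ?case unfolding tangent_iter.simps
    by (intro function_ring_sum[OF function_ring_torus_polys] torus_polys.mult torus_polys.coord torus_polys.const Suc.IH)
qed

text \<open>The weight \<open>snd\<close> gives a logarithmic derivative of \<open>f\<close>; indicator weights select the terms of \<open>f\<close> on a line.\<close>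

definition weighted_eval :: "(int \<times> int) set \<Rightarrow> (int \<times> int \<Rightarrow> complex) \<Rightarrow> laurent \<times> complex \<times> complex \<Rightarrow> complex" where
  "weighted_eval B w s = (\<Sum>b\<in>B. w b * lcoeff (fst s) b * zpow (snd s) b)"

lemma weighted_eval_torus_poly: "weighted_eval B w \<in> torus_polys B"
  unfolding weighted_eval_def[abs_def]
  by (intro function_ring_sum[OF function_ring_torus_polys] torus_polys.intros)

lemma log_deriv_eq_weighted_eval:
  assumes "finite B" "lsupp f \<subseteq> B"
  shows "log_deriv snd f z = weighted_eval B (\<lambda>b. of_int (snd b)) (f, z)"
  unfolding log_deriv_def weighted_eval_def
  by (rule sum.mono_neutral_cong_left) (use assms in \<open>auto simp: in_keys_iff\<close>)

lemma lcoeff_shift: "lcoeff (f + lmono b c) a = lcoeff f a + (if a = b then c else 0)"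
  by (simp add: lookup_add lookup_single when_def)

text \<open>The two elimination steps differ only in which torus coordinate \<open>w\<close> is eliminated and which one, \<open>t\<close>, is kept.\<close>

locale coordinate_choice =
  fixes e :: "complex \<Rightarrow> complex \<Rightarrow> complex \<times> complex" and k l :: "int \<times> int \<Rightarrow> int"
  assumes zpow_e: "zpow (e t w) a = t powi l a * w powi k a"
begin

lemma torus_poly_laurent_ext:
  assumes "\<Phi> \<in> torus_polys B"
  shows "(\<lambda>p. \<Phi> (fst (fst p), e (snd (fst p)) (snd p))) \<in> laurent_ext (laurent_ext (coeff_polys B))"
  using assms
proof induction
  note R1 = function_ring_coeff_polys[of B]
  note R2 = function_ring_laurent_ext[OF R1]
  note R3 = function_ring_laurent_ext[OF R2]
  case (const c)
  show ?case by (rule function_ring_const[OF R3])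
next
  case (coord b)
  have "(\<lambda>s. lcoeff (fst s) b) \<in> laurent_ext (coeff_polys B)"
    by (rule laurent_ext.mono[OF coeff_polys.coord[OF coord], of _ 0]) simp
  then show ?case by (rule laurent_ext.mono[of _ _ _ 0]) simp
next
  case (zpow a)
  have "(\<lambda>s :: laurent \<times> complex. snd s powi l a) \<in> laurent_ext (coeff_polys B)"
    by (rule laurent_ext.mono[OF coeff_polys.const[of 1], of _ "l a"]) simp
  then show ?case by (rule laurent_ext.mono[of _ _ _ "k a"]) (simp add: zpow_e)
next
  case (add F G)
  then show ?case by (intro function_ring_add[OF function_ring_laurent_ext[OF function_ring_laurent_ext[OF function_ring_coeff_polys]]])
next
  case (mult F G)
  then show ?case by (intro function_ring_mult[OF function_ring_laurent_ext[OF function_ring_laurent_ext[OF function_ring_coeff_polys]]])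
qed

definition slice :: "(int \<times> int) set \<Rightarrow> int \<Rightarrow> laurent \<times> complex \<Rightarrow> complex" where
  "slice B m s = (\<Sum>b\<in>{b\<in>B. k b = m}. lcoeff (fst s) b * snd s powi l b)"

lemma leval_slices:
  assumes "finite B" "lsupp f \<subseteq> B"
  shows "leval f (e t w) = (\<Sum>m\<in>k ` B. slice B m (f, t) * w powi m)"
proof -
  have "leval f (e t w) = (\<Sum>b\<in>B. lcoeff f b * t powi l b * w powi k b)"
    by (simp add: leval_sum_superset[OF assms] zpow_e mult.assoc)
  also have "\<dots> = (\<Sum>m\<in>k ` B. \<Sum>b\<in>{b\<in>B. k b = m}. lcoeff f b * t powi l b * w powi k b)"
    by (rule sum.group[symmetric]) (use assms in auto)
  also have "\<dots> = (\<Sum>m\<in>k ` B. slice B m (f, t) * w powi m)"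
    unfolding slice_def sum_distrib_right by (intro sum.cong) auto
  finally show ?thesis .
qed

lemma weighted_eval_slice:
  assumes "finite B"
  shows "weighted_eval B (\<lambda>b. of_bool (k b = m)) (f, e t w) = slice B m (f, t) * w powi m"
proof -
  have "weighted_eval B (\<lambda>b. of_bool (k b = m)) (f, e t w) = (\<Sum>b\<in>{b\<in>B. k b = m}. lcoeff f b * zpow (e t w) b)"
    unfolding weighted_eval_def by (rule sum.mono_neutral_cong_right) (use assms in auto)
  then show ?thesis unfolding slice_def sum_distrib_right zpow_e
    by (simp add: mult_ac cong: sum.cong_simp)
qed

text \<open>The resultant with respect to \<open>w\<close> is a Laurent polynomial in \<open>t\<close> that is not zero at \<open>(f\<^sub>1, t\<^sub>0)\<close>. One of
its coefficients is the required \<open>P\<close>: where \<open>P\<close> is nonzero, the resultant has finitely many zeros \<open>t\<close>.\<close>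

lemma eliminate_coordinate:
  assumes B: "finite B" "B \<noteq> {}" and \<Phi>: "\<Phi> \<in> torus_polys B" and t0: "t0 \<noteq> 0" and f1: "lsupp f1 \<subseteq> B"
    and ends: "slice B (Min (k ` B)) (f1, t0) \<noteq> 0" "slice B (Max (k ` B)) (f1, t0) \<noteq> 0"
    and coprime: "\<And>w. w \<noteq> 0 \<Longrightarrow> leval f1 (e t0 w) = 0 \<Longrightarrow> \<Phi> (f1, e t0 w) \<noteq> 0"
  obtains P where "P \<in> coeff_polys B" "P f1 \<noteq> 0"
    "\<And>f. lsupp f \<subseteq> B \<Longrightarrow> P f \<noteq> 0 \<Longrightarrow> finite {t. t \<noteq> 0 \<and> (\<exists>w. w \<noteq> 0 \<and> leval f (e t w) = 0 \<and> \<Phi> (f, e t w) = 0)}"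
proof -
  note R1 = function_ring_coeff_polys[of B]
  note R2 = function_ring_laurent_ext[OF R1]
  define G where "G = (\<lambda>p. \<Phi> (fst (fst p), e (snd (fst p)) (snd p)))"
  have G: "G \<in> laurent_ext (laurent_ext (coeff_polys B))" unfolding G_def by (rule torus_poly_laurent_ext[OF \<Phi>])
  have slice: "slice B m \<in> laurent_ext (coeff_polys B)" for m
    unfolding slice_def[abs_def]
  proof (rule function_ring_sum[OF R2])
    fix b assume "b \<in> {b \<in> B. k b = m}"
    then have "b \<in> B" by simp
    then show "(\<lambda>s. lcoeff (fst s) b * snd s powi l b) \<in> laurent_ext (coeff_polys B)"
      by (intro laurent_ext.mono[OF coeff_polys.coord, of b _ _ "l b"]) simp_all
  qed
  have "G ((f1, t0), w) \<noteq> 0" if "w \<noteq> 0" "(\<Sum>m\<in>k ` B. slice B m (f1, t0) * w powi m) = 0" for w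
    using coprime[OF that(1)] that(2) leval_slices[OF B(1) f1] by (simp add: G_def)
  from eliminate_laurent[of _ "k ` B" "slice B", OF R2 _ _ slice G ends this] B
  obtain \<rho> where \<rho>: "\<rho> \<in> laurent_ext (coeff_polys B)" "\<rho> (f1, t0) \<noteq> 0"
    "\<And>s w. \<rho> s \<noteq> 0 \<Longrightarrow> w \<noteq> 0 \<Longrightarrow> (\<Sum>m\<in>k ` B. slice B m s * w powi m) = 0 \<Longrightarrow> G (s, w) \<noteq> 0"
    by blast
  obtain P where P: "P \<in> coeff_polys B" "P f1 \<noteq> 0" "\<And>f. P f \<noteq> 0 \<Longrightarrow> finite {t. t \<noteq> 0 \<and> \<rho> (f, t) = 0}"
    using laurent_ext_finite_zeros[OF R1 \<rho>(1) t0 \<rho>(2)] by blast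
  have "finite {t. t \<noteq> 0 \<and> (\<exists>w. w \<noteq> 0 \<and> leval f (e t w) = 0 \<and> \<Phi> (f, e t w) = 0)}"
    if f: "lsupp f \<subseteq> B" "P f \<noteq> 0" for f
  proof (rule finite_subset[OF _ P(3)[OF f(2)]])
    have "\<rho> (f, t) = 0" if "w \<noteq> 0" "leval f (e t w) = 0" "\<Phi> (f, e t w) = 0" for t w
    proof (rule ccontr)
      assume "\<rho> (f, t) \<noteq> 0"
      from \<rho>(3)[OF this that(1)] show False using that leval_slices[OF B(1) f(1)] by (simp add: G_def)
    qed
    then show "{t. t \<noteq> 0 \<and> (\<exists>w. w \<noteq> 0 \<and> leval f (e t w) = 0 \<and> \<Phi> (f, e t w) = 0)} \<subseteq> {t. t \<noteq> 0 \<and> \<rho> (f, t) = 0}"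
      by blast
  qed
  then show ?thesis using that P by blast
qed

text \<open>The curve of \<open>f\<^sub>0 + c z\<^bsup>b\<^sub>0\<^esup>\<close> passes through \<open>(t\<^sub>0, w)\<close> for exactly one value \<open>c(w)\<close>, a Laurent polynomial in
\<open>w\<close>. Inserting it into \<open>\<Phi>\<close> gives a Laurent polynomial in \<open>w\<close> that is not zero at \<open>w\<^sub>0\<close>, so only finitely many
\<open>w\<close>, and hence finitely many \<open>c\<close>, are bad. This is the irreducibility of the variety of pairs \<open>(f, p)\<close> with
\<open>f(p) = 0\<close> in concrete form.\<close>

lemma finite_bad_shifts:
  assumes \<Phi>: "\<Phi> \<in> torus_polys B" and tor: "\<And>w. w \<noteq> 0 \<Longrightarrow> e t0 w \<in> torus"
    and w0: "w0 \<noteq> 0" "leval f0 (e t0 w0) = 0" "\<Phi> (f0, e t0 w0) \<noteq> 0"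
  shows "finite {c. \<exists>w. w \<noteq> 0 \<and> leval (f0 + lmono b0 c) (e t0 w) = 0 \<and> \<Phi> (f0 + lmono b0 c, e t0 w) = 0}"
proof -
  define R :: "(unit \<Rightarrow> complex) set" where "R = UNIV"
  have R: "function_ring R" by (simp add: function_ring_def R_def)
  note R' = function_ring_laurent_ext[OF R]
  \<comment> \<open>The shift for which the curve passes through the point with coordinate \<open>w\<close>.\<close>
  define c where "c = (\<lambda>w. - leval f0 (e t0 w) * zpow (e t0 w) (- b0))"
  have zpow_R: "(\<lambda>p. zpow (e t0 (snd p)) a) \<in> laurent_ext R" for a
    by (rule laurent_ext.mono[of "\<lambda>_. t0 powi l a" R _ "k a"]) (simp_all add: zpow_e R_def)
  have "(\<lambda>p. \<Sum>a\<in>lsupp f0. lcoeff f0 a * zpow (e t0 (snd p)) a) \<in> laurent_ext R"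
    by (intro function_ring_sum[OF R'] function_ring_mult[OF R'] function_ring_const[OF R'] zpow_R)
  then have "(\<lambda>p. leval f0 (e t0 (snd p))) \<in> laurent_ext R"
    by (simp add: leval_sum_superset[of "lsupp f0" f0])
  from function_ring_mult[OF R' function_ring_mult[OF R' function_ring_const[OF R', of "-1"] this] zpow_R[of "- b0"]]
  have c_R: "(\<lambda>p. c (snd p)) \<in> laurent_ext R" by (simp add: c_def)
  have H: "(\<lambda>p. \<Phi> (f0 + lmono b0 (c (snd p)), e t0 (snd p))) \<in> laurent_ext R"
    using \<Phi>
  proof induction
    case (coord b)
    have "(\<lambda>p. lcoeff f0 b + (if b = b0 then 1 else 0) * c (snd p)) \<in> laurent_ext R"
      by (intro function_ring_add[OF R'] function_ring_mult[OF R'] function_ring_const[OF R'] c_R)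
    then show ?case by (simp add: lcoeff_shift if_distrib[of "\<lambda>x. x * _"] cong: if_cong)
  next
    case (zpow a)
    show ?case using zpow_R by simp
  qed (auto intro: function_ring_add[OF R'] function_ring_mult[OF R'] function_ring_const[OF R'])
  have c0: "c w0 = 0" using w0 by (simp add: c_def)
  obtain \<rho> where "\<rho> \<in> R" "\<rho> () \<noteq> 0"
    "\<And>s. \<rho> s \<noteq> 0 \<Longrightarrow> finite {w. w \<noteq> 0 \<and> \<Phi> (f0 + lmono b0 (c w), e t0 w) = 0}"
    using laurent_ext_finite_zeros[OF R H w0(1), of "()"] w0(3) by (auto simp: c0)
  then have "finite {w. w \<noteq> 0 \<and> \<Phi> (f0 + lmono b0 (c w), e t0 w) = 0}" by blast
  then have "finite (c ` {w. w \<noteq> 0 \<and> \<Phi> (f0 + lmono b0 (c w), e t0 w) = 0})" by (rule finite_imageI)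
  moreover have "d = c w" if "w \<noteq> 0" "leval (f0 + lmono b0 d) (e t0 w) = 0" for d w
  proof -
    have t: "e t0 w \<in> torus" by (rule tor[OF that(1)])
    have "zpow (e t0 w) b0 * zpow (e t0 w) (- b0) = 1" using zpow_add[OF t, of b0 "- b0"] by simp
    moreover have "leval f0 (e t0 w) = - d * zpow (e t0 w) b0" using that(2) by (simp add: add_eq_0_iff2)
    ultimately show ?thesis unfolding c_def by (simp add: mult.assoc)
  qed
  ultimately show ?thesis by (elim finite_subset[rotated]) blast
qed

lemma finite_slice_zeros:
  assumes "finite B" "b0 \<in> B" "t0 \<noteq> 0" "slice B m (f0, t0) \<noteq> 0"
  shows "finite {c. slice B m (f0 + lmono b0 c, t0) = 0}"
proof -
  define r where "r = (if k b0 = m then t0 powi l b0 else 0)"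
  have "slice B m (f0 + lmono b0 c, t0) = slice B m (f0, t0) + c * r" for c
  proof -
    have "slice B m (f0 + lmono b0 c, t0) = slice B m (f0, t0) + (\<Sum>b\<in>{b\<in>B. k b = m}. if b = b0 then c * t0 powi l b0 else 0)"
      unfolding slice_def fst_conv snd_conv lcoeff_shift sum.distrib[symmetric]
      by (intro sum.cong) (auto simp: algebra_simps)
    then show ?thesis using assms(1,2) by (simp add: r_def)
  qed
  then have "{c. slice B m (f0 + lmono b0 c, t0) = 0} \<subseteq> {- slice B m (f0, t0) / r}"
    using assms(4) by (cases "r = 0") (auto simp: field_simps add_eq_0_iff)
  then show ?thesis by (rule finite_subset) simp
qed

end

interpretation vertical: coordinate_choice "\<lambda>t w. (w, t)" fst snd
  by standard (simp add: zpow_def)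

interpretation horizontal: coordinate_choice "\<lambda>t w. (t, w)" snd fst
  by standard (simp add: zpow_def)

text \<open>Shift one coefficient of \<open>f\<^sub>0\<close> by a generic \<open>c\<close>. Then on the line \<open>y = snd p\<close> and on the line \<open>x = fst p\<close> the
equations \<open>f = 0\<close> and \<open>\<Phi> = 0\<close> have no common solution, so both resultants are nonzero for the shifted curve.
Where both are nonzero, the common zeros lie in a product of two finite sets.\<close>

proposition generic_finite_exceptional_locus:
  assumes B: "finite B" "B \<noteq> {}" and \<Phi>: "\<Phi> \<in> torus_polys B" and f0: "lsupp f0 \<subseteq> B"
    and p: "p \<in> zero_locus f0" "\<Phi> (f0, p) \<noteq> 0"
    and ends: "vertical.slice B (Min (fst ` B)) (f0, snd p) \<noteq> 0" "vertical.slice B (Max (fst ` B)) (f0, snd p) \<noteq> 0"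
      "horizontal.slice B (Min (snd ` B)) (f0, fst p) \<noteq> 0" "horizontal.slice B (Max (snd ` B)) (f0, fst p) \<noteq> 0"
  obtains P f1 where "P \<in> coeff_polys B" "f1 \<in> supported_at B" "P f1 \<noteq> 0"
    "\<And>f. f \<in> supported_at B \<Longrightarrow> P f \<noteq> 0 \<Longrightarrow> finite {q \<in> zero_locus f. \<Phi> (f, q) = 0}"
proof -
  obtain b0 where b0: "b0 \<in> B" using B by blast
  obtain x y where p_eq: "p = (x, y)" by (cases p)
  have xy: "x \<noteq> 0" "y \<noteq> 0" "leval f0 (x, y) = 0" using p by (auto simp: p_eq zero_locus_def torus_def)
  define bad where "bad = {c. vertical.slice B (Min (fst ` B)) (f0 + lmono b0 c, y) = 0}
    \<union> {c. vertical.slice B (Max (fst ` B)) (f0 + lmono b0 c, y) = 0}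
    \<union> {c. horizontal.slice B (Min (snd ` B)) (f0 + lmono b0 c, x) = 0}
    \<union> {c. horizontal.slice B (Max (snd ` B)) (f0 + lmono b0 c, x) = 0}
    \<union> {c. \<exists>w. w \<noteq> 0 \<and> leval (f0 + lmono b0 c) (w, y) = 0 \<and> \<Phi> (f0 + lmono b0 c, (w, y)) = 0}
    \<union> {c. \<exists>w. w \<noteq> 0 \<and> leval (f0 + lmono b0 c) (x, w) = 0 \<and> \<Phi> (f0 + lmono b0 c, (x, w)) = 0}"
  have "finite bad"
    unfolding bad_def finite_Un using B(1) b0 xy ends p(2)
    by (intro conjI vertical.finite_slice_zeros horizontal.finite_slice_zeros
        vertical.finite_bad_shifts[OF \<Phi>, of y x] horizontal.finite_bad_shifts[OF \<Phi>, of x y])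
      (auto simp: p_eq torus_def)
  then have "bad \<noteq> UNIV" using infinite_UNIV_char_0 by blast
  then obtain c where c: "c \<notin> bad" by blast
  define f1 where "f1 = f0 + lmono b0 c"
  have f1: "lsupp f1 \<subseteq> B"
    using f0 b0 by (auto simp: f1_def in_keys_iff lcoeff_shift split: if_splits)
  obtain P where P: "P \<in> coeff_polys B" "P f1 \<noteq> 0" "\<And>f. lsupp f \<subseteq> B \<Longrightarrow> P f \<noteq> 0 \<Longrightarrow>
      finite {t. t \<noteq> 0 \<and> (\<exists>w. w \<noteq> 0 \<and> leval f (w, t) = 0 \<and> \<Phi> (f, (w, t)) = 0)}"
    using vertical.eliminate_coordinate[OF B \<Phi> xy(2) f1] c unfolding bad_def f1_def by blast
  obtain Q where Q: "Q \<in> coeff_polys B" "Q f1 \<noteq> 0" "\<And>f. lsupp f \<subseteq> B \<Longrightarrow> Q f \<noteq> 0 \<Longrightarrow>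
      finite {t. t \<noteq> 0 \<and> (\<exists>w. w \<noteq> 0 \<and> leval f (t, w) = 0 \<and> \<Phi> (f, (t, w)) = 0)}"
    using horizontal.eliminate_coordinate[OF B \<Phi> xy(1) f1] c unfolding bad_def f1_def by blast
  have "finite {q \<in> zero_locus f. \<Phi> (f, q) = 0}" if f: "f \<in> supported_at B" "P f * Q f \<noteq> 0" for f
  proof -
    have supp: "lsupp f \<subseteq> B" using f by (simp add: supported_at_def)
    have "finite ({t. t \<noteq> 0 \<and> (\<exists>w. w \<noteq> 0 \<and> leval f (t, w) = 0 \<and> \<Phi> (f, (t, w)) = 0)} \<times>
        {t. t \<noteq> 0 \<and> (\<exists>w. w \<noteq> 0 \<and> leval f (w, t) = 0 \<and> \<Phi> (f, (w, t)) = 0)})"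
      using P(3)[OF supp] Q(3)[OF supp] f(2) by (intro finite_cartesian_product) auto
    then show ?thesis by (rule finite_subset[rotated]) (auto simp: zero_locus_def torus_def)
  qed
  moreover have "(\<lambda>f. P f * Q f) \<in> coeff_polys B" by (rule coeff_polys.mult[OF P(1) Q(1)])
  moreover have "f1 \<in> supported_at B" using f1 by (simp add: supported_at_def)
  ultimately show ?thesis using that[of "\<lambda>f. P f * Q f" f1] P(2) Q(2) by simp
qed

text \<open>The irreducible \<open>f\<close> with full support vanishes at \<open>(1, 1)\<close> and is smooth there. On a small piece of its branch the
finitely many weighted sums stay nonzero, and at one of the points of this piece the independent
monomials have low orders only, so the values of their first iterated derivatives with respect to \<open>\<delta>\<close>
form a nonsingular matrix.\<close>

proposition good_point_exists:
  assumes A: "finite A" and B: "finite B" "noncollinear B"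
    and W: "finite W" "\<And>w. w \<in> W \<Longrightarrow> \<exists>b\<in>B. \<exists>c\<in>B. w b \<noteq> w c"
  obtains f p A' where "lsupp f \<subseteq> B" "p \<in> zero_locus f" "\<And>w. w \<in> W \<Longrightarrow> weighted_eval B w (f, p) \<noteq> 0"
    "A' \<subseteq> A" "card A \<le> card A' + card (conv A \<ominus>\<^sub>Z B)"
    "\<forall>\<alpha>. (\<forall>j<card A'. (\<Sum>a\<in>A'. tangent_iter B f j a p * \<alpha> a) = 0) \<longrightarrow> (\<forall>a\<in>A'. \<alpha> a = 0)"
proof -
  have nonconst: "\<exists>b\<in>B. \<exists>c\<in>B. snd b \<noteq> snd c" and two: "\<exists>c\<in>B. c \<noteq> b" for b :: "int \<times> int"
  proof -
    obtain b0 b1 b2 where b: "b0 \<in> B" "b1 \<in> B" "b2 \<in> B" "det2 (b1 - b0) (b2 - b0) \<noteq> 0"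
      using B(2) unfolding noncollinear_def by blast
    show "\<exists>b\<in>B. \<exists>c\<in>B. snd b \<noteq> snd c"
    proof (rule ccontr)
      assume "\<not> ?thesis"
      then have "snd b1 = snd b0" "snd b2 = snd b0" using b by blast+
      then show False using b(4) by (simp add: det2_def)
    qed
    have "b0 \<noteq> b1" using b(4) by (auto simp: det2_def)
    then show "\<exists>c\<in>B. c \<noteq> b" using b by metis
  qed
  \<comment> \<open>In addition to \<open>W\<close>: smoothness at \<open>(1, 1)\<close>, and presence of every exponent in \<open>B\<close>.\<close>
  define W' where "W' = W \<union> {\<lambda>b. of_int (snd b)} \<union> (\<lambda>b c. of_bool (c = b)) ` B"
  have W': "finite W'" using W B by (simp add: W'_def)
  have "\<exists>b\<in>B. \<exists>c\<in>B. w b \<noteq> w c" if "w \<in> W'" for w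
  proof -
    from that consider "w \<in> W" | "w = (\<lambda>b. of_int (snd b))" | b where "b \<in> B" "w = (\<lambda>c. of_bool (c = b))"
      unfolding W'_def by blast
    then show ?thesis
    proof cases
      case 1
      then show ?thesis by (rule W(2))
    next
      case 2
      then show ?thesis using nonconst by simp
    next
      case 3
      obtain c where "c \<in> B" "c \<noteq> b" using two[of b] by blast
      then show ?thesis using 3 by (intro bexI[of _ b] bexI[of _ c]) simp_all
    qed
  qed
  from irreducible_with_weights[OF B W' this]
  obtain f where f: "lsupp f \<subseteq> B" "laurent_irreducible f" "noncollinear (lsupp f)" "weighted_sum (\<lambda>_. 1) f = 0"
    "\<And>w. w \<in> W' \<Longrightarrow> weighted_sum w f \<noteq> 0" by blast
  have ws: "weighted_sum w f = weighted_eval B w (f, (1, 1))" for w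
    by (simp add: weighted_sum_superset[OF B(1) f(1)] weighted_eval_def zpow_def)
  have supp: "lsupp f = B"
  proof (rule antisym[OF f(1)], rule subsetI)
    fix b assume b: "b \<in> B"
    then have "weighted_sum (\<lambda>c. of_bool (c = b)) f \<noteq> 0" by (intro f(5)) (auto simp: W'_def)
    moreover have "weighted_sum (\<lambda>c. of_bool (c = b)) f = lcoeff f b"
      unfolding weighted_sum_superset[OF B(1) f(1)] using b B(1)
      by (simp add: of_bool_def if_distrib[of "\<lambda>x. x * _"] cong: if_cong)
    ultimately show "b \<in> lsupp f" by (simp add: in_keys_iff)
  qed
  have f0: "f \<noteq> 0" using f(3) by (auto simp: noncollinear_def)
  have z1: "(1, 1) \<in> zero_locus f"
    using f(4) by (simp add: ws weighted_eval_def zero_locus_def torus_def leval_sum_superset[OF B(1) f(1)])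
  have "log_deriv snd f (1, 1) \<noteq> 0"
    unfolding log_deriv_eq_weighted_eval[OF B(1) f(1)] ws[symmetric] by (rule f(5)) (simp add: W'_def)
  from branch_exists[OF z1 this] obtain r y where br: "branch f 1 r y" and y1: "y 1 = 1" by auto
  have r: "r > 0" using br by (simp add: branch_def)
  have cont_y: "continuous_on (ball 1 r) y"
    using br unfolding branch_def by (intro continuous_at_imp_continuous_on ballI DERIV_isCont) blast
  have cont_w: "continuous_on (ball 1 r) (\<lambda>x. weighted_eval B w (f, (x, y x)))" for w
    unfolding weighted_eval_def fst_conv snd_conv
    by (intro continuous_intros continuous_on_compose2[OF continuous_on_zpow] cont_y)
      (use branch_torus[OF br] in auto)
  define G where "G = ball 1 r \<inter> (\<Inter>w\<in>W. ball 1 r \<inter> (\<lambda>x. weighted_eval B w (f, (x, y x))) -` (- {0}))"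
  have "open G" unfolding G_def
    by (intro open_Int open_INT W(1) ballI open_ball continuous_open_preimage cont_w) auto
  moreover have "1 \<in> G" using r f(5) by (auto simp: G_def y1 W'_def simp flip: ws)
  ultimately obtain s where s: "s > 0" "ball 1 s \<subseteq> G" by (rule openE)
  then have sub: "ball (1 :: complex) s \<subseteq> ball 1 r" unfolding G_def by blast
  have br': "branch f 1 s y" by (rule branch_subset[OF br sub s(1)])
  have inf: "infinite (ball (1 :: complex) s)" using uncountable_ball[OF s(1)] countable_finite by blast
  have zeros: "(x, y x) \<in> torus \<and> leval f (x, y x) = 0" if "x \<in> ball 1 s" for x
    using br' that by (auto simp: branch_def zero_locus_def)
  obtain A' where A': "A' \<subseteq> A" "card A \<le> card A' + card (conv A \<ominus>\<^sub>Z lsupp f)"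
    "\<And>c a. (\<And>x. x \<in> ball 1 s \<Longrightarrow> (\<Sum>a\<in>A'. c a * zpow (x, y x) a) = 0) \<Longrightarrow> a \<in> A' \<Longrightarrow> c a = 0"
    using independent_exponents[OF A f(2) f0 inf zeros] by blast
  have hol_y: "y holomorphic_on ball 1 s"
    unfolding holomorphic_on_open[OF open_ball] using br' by (auto simp: branch_def)
  have "\<exists>x\<in>ball 1 s. \<forall>\<alpha>. (\<exists>a\<in>A'. \<alpha> a \<noteq> 0) \<longrightarrow>
      (\<exists>k<card A'. has_order (\<lambda>w. \<Sum>a\<in>A'. \<alpha> a * zpow (w, y w) a) x k)"
  proof (rule independent_functions_low_order[OF _ s(1)])
    show "finite A'" using A A'(1) by (rule finite_subset[rotated])
    show "(\<lambda>x. zpow (x, y x) a) holomorphic_on ball 1 s" for a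
      unfolding zpow_def fst_conv snd_conv using zeros
      by (intro holomorphic_intros hol_y) (auto simp: torus_def)
  qed (use A'(3) in blast)
  then obtain x where x: "x \<in> ball 1 s" "\<And>\<alpha> a. a \<in> A' \<Longrightarrow> \<alpha> a \<noteq> 0 \<Longrightarrow>
      \<exists>k<card A'. has_order (\<lambda>w. \<Sum>a\<in>A'. \<alpha> a * zpow (w, y w) a) x k" by blast
  show ?thesis
  proof (rule that[of f "(x, y x)" A'])
    show "(x, y x) \<in> zero_locus f" using zeros[OF x(1)] by (simp add: zero_locus_def)
    show "weighted_eval B w (f, (x, y x)) \<noteq> 0" if "w \<in> W" for w
    proof -
      have "x \<in> G" using x(1) s(2) by blast
      then show ?thesis using that unfolding G_def by blast
    qed
    show "card A \<le> card A' + card (conv A \<ominus>\<^sub>Z B)" using A'(2) supp by simp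
    have "\<alpha> a = 0" if zero: "\<And>j. j < card A' \<Longrightarrow> (\<Sum>a\<in>A'. tangent_iter B f j a (x, y x) * \<alpha> a) = 0"
      and a: "a \<in> A'" for \<alpha> a
    proof (rule ccontr)
      assume "\<alpha> a \<noteq> 0"
      then obtain k where k: "k < card A'" "has_order (\<lambda>w. \<Sum>a\<in>A'. \<alpha> a * zpow (w, y w) a) x k"
        using x(2)[OF a] by blast
      then have "(\<Sum>a\<in>A'. \<alpha> a * tangent_iter B f k a (x, y x)) \<noteq> 0"
        using order_on_branch_iff[OF B(1) f(1) br' x(1)] by blast
      then show False using zero[OF k(1)] by (simp add: mult.commute)
    qed
    then show "\<forall>\<alpha>. (\<forall>j<card A'. (\<Sum>a\<in>A'. tangent_iter B f j a (x, y x) * \<alpha> a) = 0) \<longrightarrow> (\<forall>a\<in>A'. \<alpha> a = 0)"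
      by blast
  qed (use f(1) A'(1) in auto)
qed

text \<open>The coefficients are the solution for the \<open>k\<close>-th unit vector: the iterated derivatives of the combination
vanish up to the one of order \<open>k\<close>, which is \<open>1\<close>.\<close>

lemma all_orders_attained:
  assumes B: "finite B" "lsupp f \<subseteq> B" and A': "finite A'" and p: "p \<in> zero_locus f" "log_deriv snd f p \<noteq> 0"
    and solve: "\<And>e. \<exists>\<alpha>. \<forall>j\<in>{..<n}. (\<Sum>a\<in>A'. tangent_iter B f j a p * \<alpha> a) = e j" and k: "k < n"
  shows "\<exists>g\<in>supported_at A'. meets_with_multiplicity g f p (int k)"
proof -
  obtain r y where br: "branch f (fst p) r y" and y: "y (fst p) = snd p" using branch_exists[OF p] .
  have r: "fst p \<in> ball (fst p) r" using br by (simp add: branch_def)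
  obtain \<alpha> where \<alpha>: "\<And>j. j < n \<Longrightarrow> (\<Sum>a\<in>A'. tangent_iter B f j a p * \<alpha> a) = (if j = k then 1 else 0)"
    using solve[of "\<lambda>j. if j = k then 1 else 0"] by auto
  have "has_order (\<lambda>x. \<Sum>a\<in>A'. \<alpha> a * zpow (x, y x) a) (fst p) k"
    unfolding order_on_branch_iff[OF B br r] y prod.collapse using \<alpha> k by (simp add: mult.commute)
  from meets_if_order_on_branch[OF br y A' this]
  have "meets_with_multiplicity (\<Sum>a\<in>A'. lmono a (\<alpha> a)) f p (int k)" .
  moreover have "(\<Sum>a\<in>A'. lmono a (\<alpha> a)) \<in> supported_at A'"
    using A' by (auto simp: supported_at_def in_keys_iff lookup_sum lookup_single when_def split: if_splits)
  ultimately show ?thesis by blast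
qed

theorem theorem1p2:
  fixes A B :: "(int \<times> int) set"
  assumes "finite A" and "finite B"
    and "\<not> shift_to_same_proper_sublattice A B"
    and "\<not> lies_on_segment A" and "\<not> lies_on_segment B"
  shows "\<exists>U. zariski_open B U \<and> U \<noteq> {} \<and>
    (\<forall>f\<in>U. finite {p \<in> zero_locus f.
       \<not> (\<forall>i::int. 0 \<le> i \<and> i \<le> int (card A) - int (card (conv A \<ominus>\<^sub>Z B)) - 1 \<longrightarrow>
             (\<exists>g \<in> supported_at A. meets_with_multiplicity g f p i))})"
proof -
  let ?exceptional = "\<lambda>f. {p \<in> zero_locus f.
       \<not> (\<forall>i::int. 0 \<le> i \<and> i \<le> int (card A) - int (card (conv A \<ominus>\<^sub>Z B)) - 1 \<longrightarrow>
             (\<exists>g \<in> supported_at A. meets_with_multiplicity g f p i))}"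
  have nc: "noncollinear B" using assms(2,5) by (rule noncollinear_if_not_on_segment)
  obtain b0 b1 b2 where b: "b0 \<in> B" "b1 \<in> B" "b2 \<in> B" "det2 (b1 - b0) (b2 - b0) \<noteq> 0"
    using nc unfolding noncollinear_def by blast
  have ncx: "\<exists>b\<in>B. \<exists>c\<in>B. fst b \<noteq> fst c" and ncy: "\<exists>b\<in>B. \<exists>c\<in>B. snd b \<noteq> snd c"
  proof -
    have "\<not> (fst b1 = fst b0 \<and> fst b2 = fst b0)" "\<not> (snd b1 = snd b0 \<and> snd b2 = snd b0)"
      using b(4) by (auto simp: det2_def)
    then show "\<exists>b\<in>B. \<exists>c\<in>B. fst b \<noteq> fst c" "\<exists>b\<in>B. \<exists>c\<in>B. snd b \<noteq> snd c" using b by blast+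
  qed
  \<comment> \<open>The weights select the four extreme edges of the support, as needed for elimination, and the
    logarithmic derivative that makes the point smooth.\<close>
  define on_line where "on_line = (\<lambda>h m b :: int \<times> int. of_bool (h b = (m :: int)) :: complex)"
  define W where "W = {\<lambda>b. of_int (snd b), on_line fst (Min (fst ` B)), on_line fst (Max (fst ` B)),
    on_line snd (Min (snd ` B)), on_line snd (Max (snd ` B))}"
  have W_nonconst: "\<exists>b\<in>B. \<exists>c\<in>B. w b \<noteq> w c" if "w \<in> W" for w
  proof -
    have line: "\<exists>b\<in>B. \<exists>c\<in>B. on_line h m b \<noteq> on_line h m c"
      if m: "m \<in> h ` B" and h: "\<exists>b\<in>B. \<exists>c\<in>B. h b \<noteq> h c" for h m
    proof -
      obtain c where "c \<in> B" "h c \<noteq> m" using h by metis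
      then show ?thesis using m by (auto simp: on_line_def)
    qed
    have ne: "B \<noteq> {}" using b by blast
    have "Min (fst ` B) \<in> fst ` B" "Max (fst ` B) \<in> fst ` B" "Min (snd ` B) \<in> snd ` B" "Max (snd ` B) \<in> snd ` B"
      using assms(2) ne by simp_all
    moreover have "\<exists>b\<in>B. \<exists>c\<in>B. (of_int (snd b) :: complex) \<noteq> of_int (snd c)" using ncy by simp
    ultimately show ?thesis using that line[OF _ ncx] line[OF _ ncy] unfolding W_def by blast
  qed
  have finW: "finite W" by (simp add: W_def)
  obtain f0 p A' where f0: "lsupp f0 \<subseteq> B" "p \<in> zero_locus f0"
    "\<And>w. w \<in> W \<Longrightarrow> weighted_eval B w (f0, p) \<noteq> 0" and A': "A' \<subseteq> A" "card A \<le> card A' + card (conv A \<ominus>\<^sub>Z B)"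
    and inj: "\<forall>\<alpha>. (\<forall>j<card A'. (\<Sum>a\<in>A'. tangent_iter B f0 j a p * \<alpha> a) = 0) \<longrightarrow> (\<forall>a\<in>A'. \<alpha> a = 0)"
    using good_point_exists[OF assms(1,2) nc finW W_nonconst] by blast
  have finA': "finite A'" using A'(1) assms(1) by (rule finite_subset)
  have "\<exists>\<rho>\<in>torus_polys B. \<rho> (f0, p) \<noteq> 0 \<and> (\<forall>s. \<rho> s \<noteq> 0 \<longrightarrow>
      (\<forall>e. \<exists>\<alpha>. \<forall>j\<in>{..<card A'}. (\<Sum>a\<in>A'. tangent_iter B (fst s) j a (snd s) * \<alpha> a) = e j))"
    by (rule solvable_near_nonsingular[OF function_ring_torus_polys, where M = "\<lambda>j a s. tangent_iter B (fst s) j a (snd s)"])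
      (use finA' inj in \<open>simp_all add: tangent_iter_torus_poly\<close>)
  then obtain \<rho> where \<rho>: "\<rho> \<in> torus_polys B" "\<rho> (f0, p) \<noteq> 0"
    "\<And>f z e. \<rho> (f, z) \<noteq> 0 \<Longrightarrow> \<exists>\<alpha>. \<forall>j\<in>{..<card A'}. (\<Sum>a\<in>A'. tangent_iter B f j a z * \<alpha> a) = e j" by force
  define \<Phi> where "\<Phi> = (\<lambda>s. \<rho> s * weighted_eval B (\<lambda>b. of_int (snd b)) s)"
  have \<Phi>: "\<Phi> \<in> torus_polys B" unfolding \<Phi>_def by (rule torus_polys.mult[OF \<rho>(1) weighted_eval_torus_poly])
  have \<Phi>0: "\<Phi> (f0, p) \<noteq> 0" unfolding \<Phi>_def using \<rho>(2) f0(3) by (simp add: W_def)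
  have on_line: "weighted_eval B (on_line fst m) (f0, p) = vertical.slice B m (f0, snd p) * fst p powi m"
    "weighted_eval B (on_line snd m) (f0, p) = horizontal.slice B m (f0, fst p) * snd p powi m" for m
    unfolding on_line_def using vertical.weighted_eval_slice[OF assms(2), of m f0 "fst p" "snd p"]
      horizontal.weighted_eval_slice[OF assms(2), of m f0 "fst p" "snd p"] by simp_all
  have v: "vertical.slice B (Min (fst ` B)) (f0, snd p) \<noteq> 0" "vertical.slice B (Max (fst ` B)) (f0, snd p) \<noteq> 0"
    using f0(3)[of "on_line fst _"] unfolding on_line by (auto simp: W_def)
  have h: "horizontal.slice B (Min (snd ` B)) (f0, fst p) \<noteq> 0" "horizontal.slice B (Max (snd ` B)) (f0, fst p) \<noteq> 0"
    using f0(3)[of "on_line snd _"] unfolding on_line by (auto simp: W_def)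
  have "B \<noteq> {}" using b by blast
  from generic_finite_exceptional_locus[OF assms(2) this \<Phi> f0(1,2) \<Phi>0 v h] obtain P f1 where P: "P \<in> coeff_polys B" "f1 \<in> supported_at B" "P f1 \<noteq> 0"
    "\<And>f. f \<in> supported_at B \<Longrightarrow> P f \<noteq> 0 \<Longrightarrow> finite {q \<in> zero_locus f. \<Phi> (f, q) = 0}"
    by blast
  define U where "U = {f \<in> supported_at B. P f \<noteq> 0}"
  have "zariski_open B U" unfolding zariski_open_def U_def using P(1) by (intro exI[of _ "{P}"]) auto
  moreover have "U \<noteq> {}" using P(2,3) by (auto simp: U_def)
  moreover have "finite (?exceptional f)" if f: "f \<in> U" for f
  proof (rule finite_subset)
    show "finite {q \<in> zero_locus f. \<Phi> (f, q) = 0}" using f P(4) by (simp add: U_def)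
    have supp: "lsupp f \<subseteq> B" using f by (simp add: U_def supported_at_def)
    have "\<exists>g\<in>supported_at A. meets_with_multiplicity g f q i"
      if q: "q \<in> zero_locus f" "\<Phi> (f, q) \<noteq> 0"
        and i: "0 \<le> i" "i \<le> int (card A) - int (card (conv A \<ominus>\<^sub>Z B)) - 1" for q i
    proof -
      have nz: "\<rho> (f, q) \<noteq> 0" "log_deriv snd f q \<noteq> 0"
        using q(2) by (auto simp: \<Phi>_def log_deriv_eq_weighted_eval[OF assms(2) supp])
      have "nat i < card A'" using i A'(2) by linarith
      from all_orders_attained[OF assms(2) supp finA' q(1) nz(2) \<rho>(3)[OF nz(1)] this]
      obtain g where "g \<in> supported_at A'" "meets_with_multiplicity g f q (int (nat i))" by blast
      then show ?thesis using A'(1) i(1) by (auto simp: supported_at_def intro!: bexI[of _ g])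
    qed
    then show "(?exceptional f) \<subseteq> {q \<in> zero_locus f. \<Phi> (f, q) = 0}"
      by blast
  qed
  ultimately show ?thesis by blast
qed

end
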